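(* Suppose $p>0$ and $\alpha$ is real. If $s$ is a complex parameter such that neither $n+s$ nor $n+s+(\alpha/p)$ is a negative integer, then a holomorphic function $f$ in $\mathbb B_n$ is in $A^p_\alpha$ if and only if $R_{s,\alpha/p}f$ is in $A^p$. Equivalently, $R_{s,\alpha/p}$ is an invertible operator from $A^p_\alpha$ onto $A^p$.
   Context: Fix a positive integer $n$. $\mathbb B_n$ is the open unit ball of $\mathbb C^n$, $H(\mathbb B_n)$ the space of holomorphic functions in $\mathbb B_n$, $dv$ is volume measure, and $dv_\alpha(z)=(1-|z|^2)^\alpha dv(z)$ for real $\alpha$ (normalized to be a probability measure when $\alpha>-1$). The radial derivative is $Rf(z)=\sum_{k=1}^n z_k\frac{\partial f}{\partial z_k}(z)$, $R^k$ is its $k$-fold iterate, $R^0f=f$. For $p>0$ and real $\alpha$, $A^p_\alpha$ is the space of $f\in H(\mathbb B_n)$ such that there is a nonnegative integer $k$ with $pk+\alpha>-1$ for which $(1-|z|^2)^kR^kf(z)\in L^p(\mathbb B_n,dv_\alpha)$ (this does not depend on the choice of such $k$). $A^p=A^p_0=H(\mathbb B_n)\cap L^p(\mathbb B_n,dv)$ is the ordinary Bergman space. With $N$ the smallest nonnegative integer such that $pN+\alpha>-1$, $A^p_\alpha$ is equipped with $$\|f\|_{p,\alpha}=|f(0)|+\left[\int_{\mathbb B_n}(1-|z|^2)^{pN}|R^Nf(z)|^p\,dv_\alpha(z)\right]^{1/p}$$ (a Banach norm if $p\ge1$; for $0<p<1$ the complete metric is $\|f-g\|_{p,\alpha}^p$).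 For complex $s,t$ such that neither $n+s$ nor $n+s+t$ is a negative integer, and $f=\sum_{k\ge0}f_k$ the homogeneous expansion of $f\in H(\mathbb B_n)$ ($f_k$ a homogeneous polynomial of degree $k$), $$R_{s,t}f(z)=\sum_{k=0}^\infty\frac{\Gamma(n+1+s+t)\Gamma(n+1+k+s)}{\Gamma(n+1+s)\Gamma(n+1+k+s+t)}f_k(z).$$ *)

theory Defs
  imports "HOL-Analysis.Analysis"
begin

text \<open>
  The complex space of dimension \<open>n\<close> is \<open>complex ^ 'n\<close> with \<open>n = CARD('n)\<close>; its norm is the Euclidean one,
  and \<open>lborel\<close> is Lebesgue measure on the underlying real space of dimension \<open>2 n\<close>.
\<close>

abbreviation unit_ball :: "(complex ^ 'n) set" where
  "unit_ball \<equiv> ball 0 1"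

text \<open>
  A function on the ball is represented by its extension by zero, so that equality of functions is
  equality on the ball and the pointwise vector space operations are available.
\<close>

definition holomorphic_ball :: "(complex ^ 'n \<Rightarrow> complex) set" where
  "holomorphic_ball =
    {f. (\<forall>z\<in>unit_ball. \<exists>D. (f has_derivative D) (at z) \<and> (\<forall>c v. D (c *s v) = c * D v)) \<and>
        (\<forall>z. z \<notin> unit_ball \<longrightarrow> f z = 0)}"

definition partial_deriv :: "'n \<Rightarrow> (complex ^ 'n \<Rightarrow> complex) \<Rightarrow> complex ^ 'n \<Rightarrow> complex" where
  "partial_deriv j f z = deriv (\<lambda>w. f (z + w *s axis j 1)) 0"

definition radial_deriv :: "(complex ^ 'n \<Rightarrow> complex) \<Rightarrow> complex ^ 'n \<Rightarrow> complex" where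
  "radial_deriv f z = (\<Sum>j\<in>UNIV. z $ j * partial_deriv j f z)"

text \<open>For \<open>\<alpha> \<le> -1\<close> the weight is not integrable and no normalization takes place.\<close>

definition weight_const :: "'n::finite itself \<Rightarrow> real \<Rightarrow> real" where
  "weight_const _ \<alpha> =
    (if \<alpha> > -1
     then 1 / (LINT z:(unit_ball :: (complex ^ 'n) set)|lborel. (1 - (norm z)\<^sup>2) powr \<alpha>)
     else 1)"

definition weighted_volume :: "real \<Rightarrow> (complex ^ 'n) measure" where
  "weighted_volume \<alpha> =
    density (restrict_space lborel unit_ball)
      (\<lambda>z. ennreal (weight_const TYPE('n) \<alpha> * (1 - (norm z)\<^sup>2) powr \<alpha>))"

definition in_Lp :: "'a measure \<Rightarrow> real \<Rightarrow> ('a \<Rightarrow> complex) \<Rightarrow> bool" where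
  "in_Lp M p g \<longleftrightarrow> g \<in> borel_measurable M \<and> integrable M (\<lambda>x. norm (g x) powr p)"

definition weighted_bergman :: "real \<Rightarrow> real \<Rightarrow> (complex ^ 'n \<Rightarrow> complex) set" where
  "weighted_bergman p \<alpha> =
    {f \<in> holomorphic_ball. \<exists>k::nat. p * real k + \<alpha> > -1 \<and>
       in_Lp (weighted_volume \<alpha>) p
         (\<lambda>z. of_real ((1 - (norm z)\<^sup>2) ^ k) * (radial_deriv ^^ k) f z)}"

definition bergman :: "real \<Rightarrow> (complex ^ 'n \<Rightarrow> complex) set" where
  "bergman p = {f \<in> holomorphic_ball. in_Lp (restrict_space lborel unit_ball) p f}"

definition bergman_order :: "real \<Rightarrow> real \<Rightarrow> nat" where
  "bergman_order p \<alpha> = (LEAST N. p * real N + \<alpha> > -1)"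

definition bergman_norm :: "real \<Rightarrow> real \<Rightarrow> (complex ^ 'n \<Rightarrow> complex) \<Rightarrow> real" where
  "bergman_norm p \<alpha> f =
    norm (f 0) +
    (LINT z|weighted_volume \<alpha>.
       (1 - (norm z)\<^sup>2) powr (p * real (bergman_order p \<alpha>)) *
       norm ((radial_deriv ^^ bergman_order p \<alpha>) f z) powr p) powr (1 / p)"

definition homogeneous_polynomial :: "nat \<Rightarrow> (complex ^ 'n \<Rightarrow> complex) \<Rightarrow> bool" where
  "homogeneous_polynomial k q \<longleftrightarrow>
    (\<exists>c :: ('n \<Rightarrow> nat) \<Rightarrow> complex.
       q = (\<lambda>z. \<Sum>m | (\<Sum>j\<in>UNIV. m j) = k. c m * (\<Prod>j\<in>UNIV. (z $ j) ^ m j)))"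

definition homogeneous_expansion ::
    "(complex ^ 'n \<Rightarrow> complex) \<Rightarrow> nat \<Rightarrow> complex ^ 'n \<Rightarrow> complex" where
  "homogeneous_expansion f =
    (THE F. (\<forall>k. homogeneous_polynomial k (F k)) \<and> (\<forall>z\<in>unit_ball. (\<lambda>k. F k z) sums f z))"

definition frac_radial ::
    "complex \<Rightarrow> complex \<Rightarrow> (complex ^ 'n \<Rightarrow> complex) \<Rightarrow> complex ^ 'n \<Rightarrow> complex" where
  "frac_radial s t f z =
    (if z \<in> unit_ball
     then \<Sum>k. (Gamma (of_nat CARD('n) + 1 + s + t) * Gamma (of_nat CARD('n) + 1 + of_nat k + s)) /
              (Gamma (of_nat CARD('n) + 1 + s) * Gamma (of_nat CARD('n) + 1 + of_nat k + s + t)) *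
              homogeneous_expansion f k z
     else 0)"

definition negative_integer :: "complex \<Rightarrow> bool" where
  "negative_integer w \<longleftrightarrow> (\<exists>m::int. m < 0 \<and> w = of_int m)"

text \<open>
  A linear bijection that is bounded together with its inverse. When the \<open>p\<close>-th power of the
  functional \<open>N\<close> is what induces the metric (\<open>0 < p < 1\<close>), boundedness with respect to \<open>N\<close> is
  still the same as continuity of a linear map, because \<open>N\<close> is homogeneous.
\<close>

definition invertible_operator ::
    "('a \<Rightarrow> complex) set \<Rightarrow> (('a \<Rightarrow> complex) \<Rightarrow> real) \<Rightarrow>
     ('b \<Rightarrow> complex) set \<Rightarrow> (('b \<Rightarrow> complex) \<Rightarrow> real) \<Rightarrow>
     (('a \<Rightarrow> complex) \<Rightarrow> 'b \<Rightarrow> complex) \<Rightarrow> bool" where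
  "invertible_operator X NX Y NY T \<longleftrightarrow>
    (\<forall>f\<in>X. \<forall>g\<in>X. T (\<lambda>z. f z + g z) = (\<lambda>z. T f z + T g z)) \<and>
    (\<forall>c. \<forall>f\<in>X. T (\<lambda>z. c * f z) = (\<lambda>z. c * T f z)) \<and>
    bij_betw T X Y \<and>
    (\<exists>C. \<forall>f\<in>X. NY (T f) \<le> C * NX f) \<and>
    (\<exists>C. \<forall>g\<in>Y. NX (inv_into X T g) \<le> C * NY g)"

end

theory Submission imports Defs "HOL-Complex_Analysis.Complex_Analysis" begin

text \<open>
The operators in the statement multiply the part of degree \<open>k\<close> of a holomorphic function by a number,
and both norms are integrals of a \<open>p\<close>-th power against a power of \<open>1 - |z|\<close>. Since
\<open>\<Gamma>(a + k + t) / \<Gamma>(a + k)\<close> grows like \<open>k\<close> to the power \<open>t\<close>, such a multiplier should cost exactly \<open>p t\<close> in the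
exponent of the weight. The proof makes this precise for two kinds of multipliers and obtains all
others as products of them.

A multiplier \<open>k + c\<close> is the differential operator \<open>R + c\<close>. By Cauchy's estimate it raises the exponent
by \<open>p\<close> (\<open>weight_bounded_shift\<close>). A multiplier \<open>\<Gamma>(a + k) / \<Gamma>(a + k + t)\<close> with \<open>t > 0\<close> is a fractional integral: by
the beta integral it averages \<open>f\<close> over the segment from \<open>0\<close> to \<open>z\<close> with density
\<open>x^(a-1) (1-x)^(t-1)\<close>, after removal of finitely many terms of low degree if \<open>Re a \<le> 0\<close>. It lowers the exponent by \<open>p t\<close>, as long as the resulting exponent exceeds \<open>-1\<close>
(\<open>weight_bounded_fractional\<close>). Division by \<open>k\<close>, the inverse of \<open>R\<close> on functions vanishing at \<open>0\<close>, is the case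
\<open>a = 0\<close>, \<open>t = 1\<close>. For real \<open>t\<close> of any sign, \<open>\<Gamma>(a + t + k) / \<Gamma>(a + k)\<close> is a product of finitely many factors
\<open>k + a + i\<close> and one fractional integral. Differentiating first and integrating afterwards keeps all
exponents above \<open>-1\<close>. With \<open>T\<close> the operator of the statement, \<open>T f\<close> is thus controlled by \<open>R^k f\<close> and \<open>f 0\<close>
(\<open>weighted_integral_frac_le\<close>), and \<open>R^k f\<close> by \<open>T f\<close> (\<open>weight_bounded_frac_inverse\<close>), for every \<open>k\<close> allowed in the
definition of the space. Since the multiplier with the reciprocal coefficients inverts \<open>T\<close> on all holomorphic
functions, this is the whole theorem.

Both estimates rest on the sub-mean-value property of \<open>|f|^p\<close>, with a constant
(\<open>sub_mean_value_powr\<close>). It bounds \<open>|f|^p\<close> near \<open>z\<close> by an average over a ball of radius comparable to \<open>1 - |z|\<close>,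
and replacing \<open>|f|^p\<close> by these averages does not increase the weighted integral by more than a factor
(\<open>integral_whitney_average_le\<close>). For the fractional integral the averages are also what makes a single
argument work for all \<open>p > 0\<close>: along the ray, \<open>|f(xz)|^p (1 - x|z|)^q\<close> is at most a multiple of one integral over
the ray (\<open>ray_pointwise_bound\<close>), the remaining integral in \<open>x\<close> is bounded by a power of \<open>1 - |z|\<close>
(\<open>beta_tail_bound\<close>), and the integral over \<open>z\<close> is estimated by Tonelli's theorem and dilation
(\<open>radial_average_le\<close>).
\<close>

section \<open>Holomorphic functions of several complex variables\<close>

definition clinear_deriv_at :: "(complex ^ 'n \<Rightarrow> complex) \<Rightarrow> complex ^ 'n \<Rightarrow> bool" where
  "clinear_deriv_at f z \<longleftrightarrow> (\<exists>D. (f has_derivative D) (at z) \<and> (\<forall>c v. D (c *s v) = c * D v))"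

abbreviation chol_on :: "(complex ^ 'n \<Rightarrow> complex) \<Rightarrow> (complex ^ 'n) set \<Rightarrow> bool" (infixl "chol'_on" 50) where
  "f chol_on S \<equiv> \<forall>z\<in>S. clinear_deriv_at f z"

abbreviation cderiv :: "(complex ^ 'n \<Rightarrow> complex) \<Rightarrow> complex ^ 'n \<Rightarrow> complex ^ 'n \<Rightarrow> complex" where
  "cderiv f z \<equiv> frechet_derivative f (at z)"

lemma norm_smult_vec: "norm (c *s v) = norm c * norm v" for v :: "complex ^ 'n"
  by (simp add: norm_vec_def L2_set_def norm_mult power_mult_distrib sum_distrib_left[symmetric] real_sqrt_mult)

lemma bounded_linear_smult_vec_left: "bounded_linear (\<lambda>w::complex. w *s v)" for v :: "complex ^ 'n"
  by (rule linear_conv_bounded_linear[THEN iffD1], rule linearI) (simp_all add: vec_eq_iff algebra_simps)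

lemma of_real_smult_vec: "complex_of_real x *s v = x *\<^sub>R v" for v :: "complex ^ 'n"
  by (simp add: vec_eq_iff) (metis scaleR_conv_of_real)

lemma chol_cderiv:
  assumes "clinear_deriv_at f z"
  shows "(f has_derivative cderiv f z) (at z)" "cderiv f z (c *s v) = c * cderiv f z v"
proof -
  from assms obtain D where D: "(f has_derivative D) (at z)" "\<And>c v. D (c *s v) = c * D v"
    unfolding clinear_deriv_at_def by blast
  have "cderiv f z = D" using D(1) by (metis frechet_derivative_at)
  with D show "(f has_derivative cderiv f z) (at z)" "cderiv f z (c *s v) = c * cderiv f z v" by auto
qed

lemma chol_slice_derivative:
  assumes "clinear_deriv_at f (z + w *s v)"
  shows "((\<lambda>w. f (z + w *s v)) has_field_derivative cderiv f (z + w *s v) v) (at w)"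
proof -
  have lin: "((\<lambda>w. z + w *s v) has_derivative (\<lambda>w. w *s v)) (at w)"
    by (auto intro!: derivative_eq_intros bounded_linear_imp_has_derivative bounded_linear_smult_vec_left)
  from has_derivative_compose[OF lin chol_cderiv(1)[OF assms]]
  have "((\<lambda>w. f (z + w *s v)) has_derivative (\<lambda>h. cderiv f (z + w *s v) (h *s v))) (at w)" .
  then show ?thesis
    by (simp only: has_field_derivative_def chol_cderiv(2)[OF assms] mult.commute[of _ "cderiv f (z + w *s v) v"])
qed

lemma chol_slice_derivative0:
  assumes "clinear_deriv_at f (w *s v)"
  shows "((\<lambda>w. f (w *s v)) has_field_derivative cderiv f (w *s v) v) (at w)"
  using chol_slice_derivative[of f 0 w v] assms by simp

lemma chol_slice_holomorphic:
  assumes "f chol_on S" "open T" "\<And>w. w \<in> T \<Longrightarrow> z + w *s v \<in> S"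
  shows "(\<lambda>w. f (z + w *s v)) holomorphic_on T"
proof (rule holomorphic_onI)
  fix w assume w: "w \<in> T"
  have "clinear_deriv_at f (z + w *s v)" using assms(1,3) w by blast
  from chol_slice_derivative[OF this]
  show "(\<lambda>w. f (z + w *s v)) field_differentiable at w within T"
    using field_differentiable_def field_differentiable_at_within by blast
qed

lemma chol_on_continuous_on: "f chol_on S \<Longrightarrow> continuous_on S f"
  by (meson chol_cderiv(1) continuous_at_imp_continuous_on has_derivative_continuous)

lemma vec_expansion: "v = (\<Sum>j\<in>UNIV. v $ j *s axis j 1)" for v :: "complex ^ 'n"
  by (simp add: vec_eq_iff axis_def if_distrib cong: if_cong)

lemma cderiv_expansion:
  assumes "clinear_deriv_at f z"
  shows "cderiv f z v = (\<Sum>j\<in>UNIV. v $ j * cderiv f z (axis j 1))"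
proof -
  have "linear (cderiv f z)" using chol_cderiv(1)[OF assms] has_derivative_linear by blast
  then have "cderiv f z (\<Sum>j\<in>UNIV. v $ j *s axis j 1) = (\<Sum>j\<in>UNIV. cderiv f z (v $ j *s axis j 1))"
    by (rule linear_sum)
  then show ?thesis using vec_expansion[of v] chol_cderiv(2)[OF assms] by simp
qed

lemma partial_deriv_cderiv:
  assumes "clinear_deriv_at f z"
  shows "partial_deriv j f z = cderiv f z (axis j 1)"
  unfolding partial_deriv_def
  by (rule DERIV_imp_deriv) (use chol_slice_derivative[of f z 0 "axis j 1"] assms in simp)

lemma radial_deriv_cderiv:
  assumes "clinear_deriv_at f z"
  shows "radial_deriv f z = cderiv f z z"
  unfolding radial_deriv_def by (subst cderiv_expansion[OF assms]) (simp add: partial_deriv_cderiv[OF assms])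

text \<open>
Cauchy's estimate for \<open>w \<mapsto> f (z + w v)\<close> on the disc of radius \<open>r / |v|\<close>.
\<close>

lemma cderiv_bound:
  assumes f: "f chol_on S" and r: "r > 0" and sub: "cball z r \<subseteq> S" and B: "\<And>u. u \<in> cball z r \<Longrightarrow> norm (f u) \<le> B"
  shows "norm (cderiv f z v) \<le> B / r * norm v"
proof (cases "v = 0")
  case True
  have "z \<in> S" using sub r by auto
  then have "linear (cderiv f z)" using f chol_cderiv(1) has_derivative_linear by blast
  then show ?thesis using True linear_0 by force
next
  case False
  then have v: "norm v > 0" by simp
  let ?g = "\<lambda>w. f (z + w *s v)" and ?s = "r / norm v"
  have s: "?s > 0" using r v by simp
  have inb: "z + w *s v \<in> cball z r" if "w \<in> cball 0 ?s" for w
    using that v by (simp add: dist_norm norm_smult_vec field_simps)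
  have d: "(?g has_field_derivative cderiv f (z + w *s v) v) (at w)" if "w \<in> cball 0 ?s" for w
    using chol_slice_derivative f sub inb[OF that] by blast
  have 1: "?g holomorphic_on ball 0 ?s"
    by (rule holomorphic_onI) (use d field_differentiable_at_within field_differentiable_def in \<open>meson ball_subset_cball subsetD\<close>)
  have 2: "continuous_on (cball 0 ?s) ?g"
    by (rule continuous_at_imp_continuous_on) (intro ballI DERIV_continuous[OF d])
  have "norm ((deriv ^^ 1) ?g 0) \<le> fact 1 * B / ?s ^ 1"
    by (rule Cauchy_inequality[OF 1 2 s]) (use inb B in auto)
  moreover have "deriv ?g 0 = cderiv f z v"
    by (rule DERIV_imp_deriv) (use d[of 0] s r in simp)
  ultimately show ?thesis by simp
qed

lemma clinear_deriv_at_const [simp]: "clinear_deriv_at (\<lambda>z. c) z"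
  unfolding clinear_deriv_at_def by (intro exI[of _ "\<lambda>_. 0"]) auto

lemma clinear_deriv_at_component: "clinear_deriv_at (\<lambda>z. z $ j) z"
  unfolding clinear_deriv_at_def
  by (intro exI[of _ "\<lambda>v. v $ j"]) (auto intro!: bounded_linear_imp_has_derivative bounded_linear_vec_nth)

lemma clinear_deriv_at_add:
  assumes "clinear_deriv_at f z" "clinear_deriv_at g z"
  shows "clinear_deriv_at (\<lambda>z. f z + g z) z"
proof -
  have "((\<lambda>z. f z + g z) has_derivative (\<lambda>v. cderiv f z v + cderiv g z v)) (at z)"
    using assms chol_cderiv by (auto intro: has_derivative_add)
  then show ?thesis unfolding clinear_deriv_at_def
    using chol_cderiv(2)[OF assms(1)] chol_cderiv(2)[OF assms(2)] by (auto simp: algebra_simps intro!: exI)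
qed

lemma clinear_deriv_at_mult:
  assumes "clinear_deriv_at f z" "clinear_deriv_at g z"
  shows "clinear_deriv_at (\<lambda>z. f z * g z) z"
proof -
  have "((\<lambda>z. f z * g z) has_derivative (\<lambda>v. f z * cderiv g z v + cderiv f z v * g z)) (at z)"
    using assms chol_cderiv by (auto intro: has_derivative_mult)
  then show ?thesis unfolding clinear_deriv_at_def
    using chol_cderiv(2)[OF assms(1)] chol_cderiv(2)[OF assms(2)] by (auto simp: algebra_simps intro!: exI)
qed

lemma clinear_deriv_at_power: "clinear_deriv_at f z \<Longrightarrow> clinear_deriv_at (\<lambda>z. f z ^ k) z"
  by (induction k) (auto intro: clinear_deriv_at_mult)

lemma clinear_deriv_at_sum: "(\<And>i. i \<in> I \<Longrightarrow> clinear_deriv_at (f i) z) \<Longrightarrow> clinear_deriv_at (\<lambda>z. \<Sum>i\<in>I. f i z) z"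
  by (induction I rule: infinite_finite_induct) (auto intro: clinear_deriv_at_add)

lemma clinear_deriv_at_prod: "(\<And>i. i \<in> I \<Longrightarrow> clinear_deriv_at (f i) z) \<Longrightarrow> clinear_deriv_at (\<lambda>z. \<Prod>i\<in>I. f i z) z"
  by (induction I rule: infinite_finite_induct) (auto intro: clinear_deriv_at_mult)

lemma clinear_deriv_at_cong:
  assumes "clinear_deriv_at f z" "open S" "z \<in> S" "\<And>u. u \<in> S \<Longrightarrow> f u = g u"
  shows "clinear_deriv_at g z" "cderiv g z = cderiv f z"
proof -
  have d: "(g has_derivative cderiv f z) (at z)"
    by (rule has_derivative_transform_within_open[OF chol_cderiv(1)[OF assms(1)] assms(2-4)])
  then show "clinear_deriv_at g z" using chol_cderiv(2)[OF assms(1)] unfolding clinear_deriv_at_def by blast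
  show "cderiv g z = cderiv f z" using d by (metis frechet_derivative_at)
qed

lemma chol_diff:
  assumes "clinear_deriv_at f z" "clinear_deriv_at g z"
  shows "clinear_deriv_at (\<lambda>z. f z - g z) z" "cderiv (\<lambda>z. f z - g z) z v = cderiv f z v - cderiv g z v"
proof -
  have d: "((\<lambda>z. f z - g z) has_derivative (\<lambda>v. cderiv f z v - cderiv g z v)) (at z)"
    using assms chol_cderiv by (auto intro: has_derivative_diff)
  show "clinear_deriv_at (\<lambda>z. f z - g z) z" unfolding clinear_deriv_at_def
    using d chol_cderiv(2)[OF assms(1)] chol_cderiv(2)[OF assms(2)] by (auto simp: algebra_simps intro!: exI)
  show "cderiv (\<lambda>z. f z - g z) z v = cderiv f z v - cderiv g z v"
    using frechet_derivative_at[OF d] by metis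
qed

text \<open>
The theorem of Weierstrass. By Cauchy's estimate the derivatives are uniformly Cauchy on a smaller ball,
so that termwise differentiation applies, and a limit of complex linear maps is complex linear.
\<close>

lemma chol_uniform_limit:
  assumes f: "\<And>n. f n chol_on ball z0 (2*r)" and r: "r > 0"
    and lim: "uniform_limit (ball z0 (2*r)) f g sequentially"
  shows "clinear_deriv_at g z0"
proof -
  let ?S = "ball z0 r"
  have cs: "cball z (r/2) \<subseteq> ball z0 (2*r)" if "z \<in> ?S" for z
  proof
    fix u assume "u \<in> cball z (r/2)"
    then show "u \<in> ball z0 (2*r)" using that dist_triangle[of z0 u z] r by auto
  qed
  have est: "norm (cderiv (f n) z h - cderiv (f m) z h) \<le> 2 * e / r * norm h"
    if z: "z \<in> ?S" and b: "\<And>u. u \<in> ball z0 (2*r) \<Longrightarrow> dist (f n u) (f m u) \<le> e" for n m z h e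
  proof -
    have zz: "z \<in> ball z0 (2*r)" using z r by auto
    have "norm (cderiv (\<lambda>u. f n u - f m u) z h) \<le> e / (r/2) * norm h"
      by (rule cderiv_bound[where S="ball z0 (2*r)"])
         (use r cs[OF z] b in \<open>auto intro!: chol_diff(1) f[rule_format] simp: dist_norm subset_iff\<close>)
    moreover have "cderiv (\<lambda>u. f n u - f m u) z h = cderiv (f n) z h - cderiv (f m) z h"
      by (rule chol_diff(2)[OF f[rule_format, OF zz] f[rule_format, OF zz]])
    moreover have "e / (r/2) = 2 * e / r" by simp
    ultimately show ?thesis by metis
  qed
  have unif: "\<exists>N. \<forall>n\<ge>N. \<forall>m\<ge>N. \<forall>z\<in>?S. \<forall>h. norm (cderiv (f n) z h - cderiv (f m) z h) \<le> e * norm h" if e: "e > 0" for e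
  proof -
    have "r * e / 4 > 0" using e r by simp
    from uniform_limitD[OF lim this] obtain N where N: "\<And>n u. n \<ge> N \<Longrightarrow> u \<in> ball z0 (2*r) \<Longrightarrow> dist (f n u) (g u) < r*e/4"
      unfolding eventually_sequentially by blast
    show ?thesis
    proof (intro exI allI impI ballI)
      fix n m z h assume nm: "N \<le> n" "N \<le> m" and z: "z \<in> ?S"
      have "norm (cderiv (f n) z h - cderiv (f m) z h) \<le> 2 * (r*e/2) / r * norm h"
      proof (rule est[OF z])
        fix u assume u: "u \<in> ball z0 (2*r)"
        show "dist (f n u) (f m u) \<le> r * e / 2"
          using N[OF nm(1) u] N[OF nm(2) u] dist_triangle2[of "f n u" "f m u" "g u"] by linarith
      qed
      then show "norm (cderiv (f n) z h - cderiv (f m) z h) \<le> e * norm h" using r by simp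
    qed
  qed
  define g' where "g' = (\<lambda>z h. lim (\<lambda>n. cderiv (f n) z h))"
  have conv: "(\<lambda>n. cderiv (f n) z h) \<longlonglongrightarrow> g' z h" if z: "z \<in> ?S" for z h
  proof -
    have "Cauchy (\<lambda>n. cderiv (f n) z h)"
    proof (rule metric_CauchyI)
      fix e :: real assume e: "e > 0"
      define e' where "e' = e / (norm h + 1)"
      have pos: "e' > 0" unfolding e'_def using e by (intro divide_pos_pos) (auto simp: add_nonneg_pos)
      obtain N where N: "\<forall>n\<ge>N. \<forall>m\<ge>N. \<forall>z\<in>?S. \<forall>h. norm (cderiv (f n) z h - cderiv (f m) z h) \<le> e' * norm h"
        using unif[OF pos] by blast
      have less: "e' * norm h < e" 
      proof -
        have "norm h + 1 > 0" by (simp add: add_nonneg_pos)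
        moreover have "e * norm h < e * (norm h + 1)" using e by simp
        ultimately show ?thesis unfolding e'_def by (simp only: times_divide_eq_left pos_divide_less_eq)
      qed
      show "\<exists>M. \<forall>m\<ge>M. \<forall>n\<ge>M. dist (cderiv (f m) z h) (cderiv (f n) z h) < e"
      proof (intro exI allI impI)
        fix m n assume "N \<le> m" "N \<le> n"
        then have "norm (cderiv (f m) z h - cderiv (f n) z h) \<le> e' * norm h" using N z by blast
        then show "dist (cderiv (f m) z h) (cderiv (f n) z h) < e" unfolding dist_norm using less by (rule order_le_less_trans)
      qed
    qed
    then show ?thesis unfolding g'_def using Cauchy_convergent convergent_LIMSEQ_iff by blast
  qed
  have z0: "z0 \<in> ?S" using r by simp
  have "\<exists>G. \<forall>x\<in>?S. (\<lambda>n. f n x) \<longlonglongrightarrow> G x \<and> (G has_derivative g' x) (at x within ?S)"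
  proof (rule has_derivative_sequence)
    show "(f n has_derivative cderiv (f n) x) (at x within ?S)" if "x \<in> ?S" for n x
      by (rule has_derivative_at_withinI, rule chol_cderiv(1), rule f[rule_format]) (use that r in auto)
    show "\<forall>\<^sub>F n in sequentially. \<forall>x\<in>?S. \<forall>h. norm (cderiv (f n) x h - g' x h) \<le> e * norm h" if e: "e > 0" for e
    proof -
      obtain N where N: "\<forall>n\<ge>N. \<forall>m\<ge>N. \<forall>z\<in>?S. \<forall>h. norm (cderiv (f n) z h - cderiv (f m) z h) \<le> e * norm h"
        using unif[OF e] by blast
      show ?thesis unfolding eventually_sequentially
      proof (intro exI allI impI ballI)
        fix n x h assume n: "N \<le> n" and x: "x \<in> ?S"
        have "(\<lambda>m. norm (cderiv (f n) x h - cderiv (f m) x h)) \<longlonglongrightarrow> norm (cderiv (f n) x h - g' x h)"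
          by (intro tendsto_intros conv x)
        then show "norm (cderiv (f n) x h - g' x h) \<le> e * norm h"
          by (rule Lim_bounded[of _ _ N]) (use N n x in blast)
      qed
    qed
    show "(\<lambda>n. f n z0) \<longlonglongrightarrow> g z0" using tendsto_uniform_limitI[OF lim] r by simp
  qed (use z0 in auto)
  then obtain G where G: "\<And>x. x \<in> ?S \<Longrightarrow> (\<lambda>n. f n x) \<longlonglongrightarrow> G x" "\<And>x. x \<in> ?S \<Longrightarrow> (G has_derivative g' x) (at x within ?S)"
    by blast
  have "(G has_derivative g' z0) (at z0)"
    using G(2)[OF z0] at_within_open[OF z0] by simp
  then have "(g has_derivative g' z0) (at z0)"
  proof (rule has_derivative_transform_within_open[where s="?S"])
    fix x assume x: "x \<in> ?S"
    have "(\<lambda>n. f n x) \<longlonglongrightarrow> g x" using tendsto_uniform_limitI[OF lim] x r by simp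
    with G(1)[OF x] show "G x = g x" using LIMSEQ_unique by blast
  qed (use z0 in auto)
  moreover have "g' z0 (c *s v) = c * g' z0 v" for c v
  proof -
    have "(\<lambda>n. cderiv (f n) z0 (c *s v)) = (\<lambda>n. c * cderiv (f n) z0 v)"
      by (rule ext, rule chol_cderiv(2), rule f[rule_format]) (use r in auto)
    then have "(\<lambda>n. cderiv (f n) z0 (c *s v)) \<longlonglongrightarrow> c * g' z0 v"
      using tendsto_mult_left[OF conv[OF z0, of v], of c] by simp
    with conv[OF z0] show ?thesis using LIMSEQ_unique by blast
  qed
  ultimately show ?thesis unfolding clinear_deriv_at_def by blast
qed

lemma clinear_deriv_at_shift:
  assumes "clinear_deriv_at f (z + u)"
  shows "clinear_deriv_at (\<lambda>z. f (z + u)) z"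
proof -
  have "((\<lambda>z. z + u) has_derivative (\<lambda>h. h)) (at z)" by (auto intro!: derivative_eq_intros)
  from has_derivative_compose[OF this chol_cderiv(1)[OF assms]] show ?thesis
    using chol_cderiv(2)[OF assms] unfolding clinear_deriv_at_def by blast
qed

lemma second_order_taylor_bound:
  assumes g: "g holomorphic_on ball 0 \<delta>" and B: "\<And>w. w \<in> ball 0 \<delta> \<Longrightarrow> norm (g w) \<le> B"
    and d: "\<delta> > 0" and a: "norm a \<le> \<delta> / 2"
  shows "norm (g a - g 0 - deriv g 0 * a) \<le> 32 * B / \<delta>\<^sup>2 * (norm a)\<^sup>2"
proof -
  have "norm ((\<lambda>i. (deriv ^^ i) g) 0 a - (\<Sum>i\<le>1. (deriv ^^ i) g 0 * (a - 0) ^ i / fact i)) \<le> (32 * B / \<delta>\<^sup>2) * norm (a - 0) ^ Suc 1 / fact 1"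
  proof (rule complex_Taylor[where S="cball 0 (\<delta>/2)"])
    fix i and x :: complex assume x: "x \<in> cball 0 (\<delta>/2)"
    have xx: "x \<in> ball 0 \<delta>" using x d by auto
    have "(deriv ^^ i) g holomorphic_on ball 0 \<delta>" using g by (intro holomorphic_higher_deriv) auto
    then have "((deriv ^^ i) g has_field_derivative (deriv ^^ Suc i) g x) (at x)"
      using xx holomorphic_derivI open_ball by auto
    then show "((deriv ^^ i) g has_field_derivative (deriv ^^ Suc i) g x) (at x within cball 0 (\<delta>/2))"
      using has_field_derivative_at_within by blast
  next
    fix x assume x: "x \<in> cball (0::complex) (\<delta>/2)"
    have sub: "cball x (\<delta>/4) \<subseteq> ball 0 \<delta>"
    proof
      fix u assume "u \<in> cball x (\<delta>/4)"
      then show "u \<in> ball 0 \<delta>" using x dist_triangle[of 0 u x] d by auto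
    qed
    have "norm ((deriv ^^ 2) g x) \<le> fact 2 * B / (\<delta>/4) ^ 2"
    proof (rule Cauchy_inequality)
      show "g holomorphic_on ball x (\<delta>/4)" using g sub by (meson ball_subset_cball holomorphic_on_subset order_trans)
      show "continuous_on (cball x (\<delta>/4)) g" using g sub holomorphic_on_imp_continuous_on holomorphic_on_subset by blast
    qed (use d sub B in \<open>auto simp: dist_norm\<close>)
    then show "norm ((deriv ^^ Suc 1) g x) \<le> 32 * B / \<delta>\<^sup>2"
      by (simp add: eval_nat_numeral field_simps)
  qed (use d a in auto)
  then show ?thesis by (simp add: power2_eq_square algebra_simps)
qed

text \<open>
A directional derivative is a locally uniform limit of difference quotients, which are holomorphic.
This is what allows iterated partial derivatives without any smoothness beyond differentiability.
\<close>

lemma chol_directional_derivative: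
  assumes f: "f chol_on S" and S: "open S" and z0: "z0 \<in> S"
  shows "clinear_deriv_at (\<lambda>z. cderiv f z v) z0"
proof (cases "v = 0")
  case True
  have "0 = cderiv f z v" if "z \<in> S" for z
  proof -
    have "linear (cderiv f z)" using f that chol_cderiv(1) has_derivative_linear by blast
    then show ?thesis using True linear_0 by force
  qed
  then show ?thesis
    using clinear_deriv_at_cong(1)[of "\<lambda>_. 0" z0 S] S z0 by auto
next
  case False
  then have v: "norm v > 0" by simp
  obtain \<rho> where \<rho>: "\<rho> > 0" "cball z0 \<rho> \<subseteq> S" using S z0 open_contains_cball by blast
  have "compact (f ` cball z0 \<rho>)"
    using chol_on_continuous_on[OF f] \<rho>(2) by (intro compact_continuous_image) (auto intro: continuous_on_subset)
  then obtain B where B: "\<And>u. u \<in> cball z0 \<rho> \<Longrightarrow> norm (f u) \<le> B"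
    by (meson bounded_iff compact_imp_bounded imageI)
  define \<delta> where "\<delta> = \<rho> / (2 * norm v)"
  have d: "\<delta> > 0" using \<rho> v by (simp add: \<delta>_def)
  have inb: "z + w *s v \<in> cball z0 \<rho>" if "z \<in> ball z0 (\<rho>/2)" "w \<in> ball 0 \<delta>" for z w
  proof -
    have "norm w * norm v \<le> \<rho> / 2" using that(2) v by (simp add: \<delta>_def field_simps)
    then have "dist z (z + w *s v) \<le> \<rho> / 2" by (simp add: dist_norm norm_smult_vec)
    then show ?thesis using dist_triangle[of z0 "z + w *s v" z] that(1) by auto
  qed
  \<comment> \<open>steps of the difference quotients, small enough to stay in the ball where \<open>f\<close> is bounded\<close>
  define a where "a = (\<lambda>n. complex_of_real (\<delta> / 2 / real (Suc n)))"
  have a0: "a n \<noteq> 0" for n unfolding a_def using d by (simp only: of_real_eq_0_iff) simp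
  have na: "norm (a n) = \<delta> / 2 / real (Suc n)" for n unfolding a_def using d by (simp only: norm_of_real) simp
  have aleq: "norm (a n) \<le> \<delta> / 2" for n unfolding na using d by (simp add: field_simps)
  have ab: "a n \<in> ball 0 \<delta>" for n using aleq[of n] d by simp
  let ?F = "\<lambda>n z. (f (z + a n *s v) + (-1) * f z) * inverse (a n)"
  have est: "norm (?F n z - cderiv f z v) \<le> 32 * B / \<delta>\<^sup>2 * norm (a n)" if z: "z \<in> ball z0 (\<rho>/2)" for n z
  proof -
    let ?g = "\<lambda>w. f (z + w *s v)"
    have g: "?g holomorphic_on ball 0 \<delta>" by (rule chol_slice_holomorphic[OF f]) (use inb[OF z] \<rho> in auto)
    have "z \<in> S" using z \<rho> by auto
    then have dg: "deriv ?g 0 = cderiv f z v" using chol_slice_derivative[of f z 0 v] f by (intro DERIV_imp_deriv) auto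
    have "norm (?g (a n) - ?g 0 - deriv ?g 0 * a n) \<le> 32 * B / \<delta>\<^sup>2 * (norm (a n))\<^sup>2"
      by (rule second_order_taylor_bound[OF g _ d aleq]) (use inb[OF z] B in auto)
    moreover have "?g (a n) - ?g 0 - deriv ?g 0 * a n = (?F n z - cderiv f z v) * a n"
      using a0[of n] by (simp add: dg field_simps)
    ultimately have "norm (?F n z - cderiv f z v) * norm (a n) \<le> (32 * B / \<delta>\<^sup>2 * norm (a n)) * norm (a n)"
      by (simp only: norm_mult power2_eq_square mult.assoc)
    then show ?thesis using a0[of n] by (meson mult_right_le_imp_le zero_less_norm_iff)
  qed
  show ?thesis
  proof (rule chol_uniform_limit[where r="\<rho>/4" and f="?F"])
    fix n show "?F n chol_on ball z0 (2 * (\<rho>/4))"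
    proof
      fix z assume z: "z \<in> ball z0 (2 * (\<rho>/4))"
      then have "z \<in> S" "z + a n *s v \<in> S" using inb[of z "a n"] ab \<rho> by auto
      then show "clinear_deriv_at (?F n) z"
        by (intro clinear_deriv_at_mult clinear_deriv_at_add clinear_deriv_at_const clinear_deriv_at_shift f[rule_format])
    qed
  next
    show "uniform_limit (ball z0 (2 * (\<rho>/4))) ?F (\<lambda>z. cderiv f z v) sequentially"
    proof (rule uniform_limitI)
      fix e :: real assume e: "e > 0"
      have "(\<lambda>n. 32 * B / \<delta>\<^sup>2 * (\<delta> / 2 * inverse (real (Suc n)))) \<longlonglongrightarrow> 32 * B / \<delta>\<^sup>2 * (\<delta> / 2 * 0)"
        by (intro tendsto_intros LIMSEQ_inverse_real_of_nat)
      then have "\<forall>\<^sub>F n in sequentially. 32 * B / \<delta>\<^sup>2 * (\<delta> / 2 * inverse (real (Suc n))) < e"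
        using e by (intro order_tendstoD(2)) auto
      then show "\<forall>\<^sub>F n in sequentially. \<forall>z\<in>ball z0 (2 * (\<rho>/4)). dist (?F n z) (cderiv f z v) < e"
      proof eventually_elim
        case (elim n)
        show ?case
        proof
          fix z assume "z \<in> ball z0 (2 * (\<rho>/4))"
          then have "norm (?F n z - cderiv f z v) \<le> 32 * B / \<delta>\<^sup>2 * norm (a n)" using est by simp
          also have "\<dots> < e" using elim unfolding na by (simp only: divide_inverse)
          finally show "dist (?F n z) (cderiv f z v) < e" by (simp only: dist_norm)
        qed
      qed
    qed
  qed (use \<rho>(1) in simp)
qed

section \<open>The homogeneous expansion\<close>

text \<open>
The Taylor coefficient at \<open>0\<close> of the slice \<open>w \<mapsto> f (w z)\<close>. The formula makes sense for every \<open>z\<close>, also outside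
the ball, where a homogeneous polynomial is determined by its values on the ball.
\<close>

definition hom_part :: "(complex ^ 'n \<Rightarrow> complex) \<Rightarrow> nat \<Rightarrow> complex ^ 'n \<Rightarrow> complex" where
  "hom_part f k z = (deriv ^^ k) (\<lambda>w. f (w *s z)) 0 / fact k"

lemma holomorphic_ball_chol: "f \<in> holomorphic_ball \<Longrightarrow> f chol_on unit_ball"
  by (simp add: holomorphic_ball_def clinear_deriv_at_def)

lemma holomorphic_ballI:
  "f chol_on unit_ball \<Longrightarrow> (\<And>z. z \<notin> unit_ball \<Longrightarrow> f z = 0) \<Longrightarrow> f \<in> holomorphic_ball"
  by (simp add: holomorphic_ball_def clinear_deriv_at_def)

lemma homogeneous_polynomial_zero: "homogeneous_polynomial k (\<lambda>z. 0)"
  unfolding homogeneous_polynomial_def by (intro exI[of _ "\<lambda>_. 0"]) simp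

lemma homogeneous_polynomial_add:
  assumes "homogeneous_polynomial k p" "homogeneous_polynomial k q"
  shows "homogeneous_polynomial k (\<lambda>z. p z + q z)"
proof -
  obtain c d where "p = (\<lambda>z. \<Sum>m | (\<Sum>j\<in>UNIV. m j) = k. c m * (\<Prod>j\<in>UNIV. (z $ j) ^ m j))"
    "q = (\<lambda>z. \<Sum>m | (\<Sum>j\<in>UNIV. m j) = k. d m * (\<Prod>j\<in>UNIV. (z $ j) ^ m j))"
    using assms unfolding homogeneous_polynomial_def by blast
  then show ?thesis unfolding homogeneous_polynomial_def
    by (intro exI[of _ "\<lambda>m. c m + d m"]) (simp add: algebra_simps sum.distrib)
qed

lemma homogeneous_polynomial_sum:
  "(\<And>i. i \<in> I \<Longrightarrow> homogeneous_polynomial k (p i)) \<Longrightarrow> homogeneous_polynomial k (\<lambda>z. \<Sum>i\<in>I. p i z)"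
  by (induction I rule: infinite_finite_induct) (auto intro: homogeneous_polynomial_zero homogeneous_polynomial_add)

lemma homogeneous_polynomial_scale:
  assumes "homogeneous_polynomial k p"
  shows "homogeneous_polynomial k (\<lambda>z. a * p z)"
proof -
  obtain c where "p = (\<lambda>z. \<Sum>m | (\<Sum>j\<in>UNIV. m j) = k. c m * (\<Prod>j\<in>UNIV. (z $ j) ^ m j))"
    using assms unfolding homogeneous_polynomial_def by blast
  then show ?thesis unfolding homogeneous_polynomial_def
    by (intro exI[of _ "\<lambda>m. a * c m"]) (simp add: algebra_simps sum_distrib_left)
qed

lemma finite_multi_indices: "finite {m :: 'n::finite \<Rightarrow> nat. (\<Sum>j\<in>UNIV. m j) = k}"
proof (rule finite_subset)
  show "{m :: 'n \<Rightarrow> nat. (\<Sum>j\<in>UNIV. m j) = k} \<subseteq> {m. \<forall>j. m j \<in> {..k}}"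
    by (auto intro: member_le_sum)
  show "finite {m :: 'n \<Rightarrow> nat. \<forall>j. m j \<in> {..k}}"
    using finite_PiE[of UNIV "\<lambda>_::'n. {..k}"] by (simp add: PiE_def extensional_def Pi_def)
qed

lemma homogeneous_polynomial_times_component:
  fixes p :: "complex ^ 'n \<Rightarrow> complex"
  assumes "homogeneous_polynomial k p"
  shows "homogeneous_polynomial (Suc k) (\<lambda>z. z $ i * p z)"
proof -
  let ?M = "\<lambda>k. {m :: 'n \<Rightarrow> nat. (\<Sum>j\<in>UNIV. m j) = k}"
  \<comment> \<open>multiplication by \<open>z $ i\<close> raises the \<open>i\<close>-th exponent by one\<close>
  let ?s = "\<lambda>m :: 'n \<Rightarrow> nat. m(i := Suc (m i))" and ?u = "\<lambda>m :: 'n \<Rightarrow> nat. m(i := m i - 1)"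
  let ?S = "{m \<in> ?M (Suc k). m i > 0}"
  obtain c where c: "p = (\<lambda>z. \<Sum>m\<in>?M k. c m * (\<Prod>j\<in>UNIV. (z $ j) ^ m j))"
    using assms unfolding homogeneous_polynomial_def by blast
  have sum_upd: "(\<Sum>j\<in>UNIV. (m(i := x)) j) = x + (\<Sum>j\<in>UNIV-{i}. m j)" for m :: "'n \<Rightarrow> nat" and x
    by (subst sum.remove[of _ i]) (auto intro!: sum.cong)
  have sum_rem: "(\<Sum>j\<in>UNIV. m j) = m i + (\<Sum>j\<in>UNIV-{i}. m j)" for m :: "'n \<Rightarrow> nat"
    by (subst sum.remove[of _ i]) auto
  have mon: "z $ i * (\<Prod>j\<in>UNIV. (z $ j) ^ m j) = (\<Prod>j\<in>UNIV. (z $ j) ^ (?s m) j)" for z :: "complex ^ 'n" and m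
  proof -
    have "(\<Prod>j\<in>UNIV. (z $ j) ^ (?s m) j) = (z $ i) ^ Suc (m i) * (\<Prod>j\<in>UNIV-{i}. (z $ j) ^ m j)"
      by (subst prod.remove[of _ i]) (auto intro!: prod.cong)
    moreover have "(\<Prod>j\<in>UNIV. (z $ j) ^ m j) = (z $ i) ^ (m i) * (\<Prod>j\<in>UNIV-{i}. (z $ j) ^ m j)"
      by (subst prod.remove[of _ i]) auto
    ultimately show ?thesis by simp
  qed
  have us: "?u (?s m) = m" for m by (simp add: fun_eq_iff)
  have "z $ i * p z = (\<Sum>m\<in>?M (Suc k). (if m i > 0 then c (?u m) else 0) * (\<Prod>j\<in>UNIV. (z $ j) ^ m j))" for z
  proof -
    have "z $ i * p z = (\<Sum>m\<in>?M k. c m * (\<Prod>j\<in>UNIV. (z $ j) ^ (?s m) j))"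
      unfolding c sum_distrib_left mon[symmetric] by (simp add: mult.left_commute)
    also have "\<dots> = (\<Sum>m\<in>?S. c (?u m) * (\<Prod>j\<in>UNIV. (z $ j) ^ m j))"
    proof (rule sum.reindex_bij_witness[where i="?u" and j="?s"])
      fix m assume m: "m \<in> ?M k"
      then show "?s m \<in> ?S" using sum_upd[of m "Suc (m i)"] sum_rem[of m] by simp
      show "?u (?s m) = m" by (rule us)
      show "c (?u (?s m)) * (\<Prod>j\<in>UNIV. (z $ j) ^ (?s m) j) = c m * (\<Prod>j\<in>UNIV. (z $ j) ^ (?s m) j)"
        by (simp only: us)
    next
      fix m assume m: "m \<in> ?S"
      then show "?u m \<in> ?M k" using sum_upd[of m "m i - 1"] sum_rem[of m] by simp
      show "?s (?u m) = m" using m by (auto simp: fun_eq_iff)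
    qed
    also have "\<dots> = (\<Sum>m\<in>?M (Suc k). (if m i > 0 then c (?u m) else 0) * (\<Prod>j\<in>UNIV. (z $ j) ^ m j))"
      by (rule sum.mono_neutral_cong_left) (auto simp: finite_multi_indices)
    finally show ?thesis .
  qed
  then show ?thesis unfolding homogeneous_polynomial_def
    by (intro exI[of _ "\<lambda>m. if m i > 0 then c (?u m) else 0"]) (simp add: fun_eq_iff)
qed

lemma homogeneous_polynomial_const: "homogeneous_polynomial 0 (\<lambda>z::complex ^ 'n. a)"
proof -
  have "{m :: 'n \<Rightarrow> nat. (\<Sum>j\<in>UNIV. m j) = 0} = {\<lambda>_. 0}" by auto
  then show ?thesis unfolding homogeneous_polynomial_def by (intro exI[of _ "\<lambda>_. a"]) simp
qed

lemma homogeneous_polynomial_homogeneous: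
  assumes "homogeneous_polynomial k p"
  shows "p (a *s z) = a ^ k * p z"
proof -
  obtain c where c: "p = (\<lambda>z. \<Sum>m | (\<Sum>j\<in>UNIV. m j) = k. c m * (\<Prod>j\<in>UNIV. (z $ j) ^ m j))"
    using assms unfolding homogeneous_polynomial_def by blast
  show ?thesis unfolding c sum_distrib_left
    by (rule sum.cong) (auto simp: power_mult_distrib prod.distrib power_sum[symmetric] simp flip: power_sum)
qed

lemma homogeneous_polynomial_chol:
  assumes "homogeneous_polynomial k p"
  shows "clinear_deriv_at p z"
proof -
  obtain c where c: "p = (\<lambda>z. \<Sum>m | (\<Sum>j\<in>UNIV. m j) = k. c m * (\<Prod>j\<in>UNIV. (z $ j) ^ m j))"
    using assms unfolding homogeneous_polynomial_def by blast
  show ?thesis unfolding c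
    by (intro clinear_deriv_at_sum clinear_deriv_at_mult clinear_deriv_at_const clinear_deriv_at_prod
        clinear_deriv_at_power clinear_deriv_at_component)
qed

lemma slice_ball:
  assumes "norm w * norm z < 1" shows "w *s z \<in> unit_ball"
  using assms by (simp add: norm_smult_vec)

definition slice_disc :: "complex ^ 'n \<Rightarrow> complex set" where
  "slice_disc z = {w. norm w * norm z < 1}"

lemma slice_disc: "open (slice_disc z)" "0 \<in> slice_disc z" "w \<in> slice_disc z \<Longrightarrow> w *s z \<in> unit_ball"
proof -
  show "open (slice_disc z)" unfolding slice_disc_def by (intro open_Collect_less continuous_intros)
qed (auto simp: slice_disc_def norm_smult_vec)

lemma slice_holomorphic:
  assumes "f chol_on unit_ball"
  shows "(\<lambda>w. f (w *s z)) holomorphic_on slice_disc z"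
  using chol_slice_holomorphic[OF assms slice_disc(1)[of z], of 0 z] slice_disc(3)[of _ z] by simp

lemma higher_deriv_sum:
  fixes f :: "'a \<Rightarrow> complex \<Rightarrow> complex"
  assumes "\<And>i. i \<in> I \<Longrightarrow> f i holomorphic_on S" "open S" "z \<in> S"
  shows "(deriv ^^ n) (\<lambda>w. \<Sum>i\<in>I. f i w) z = (\<Sum>i\<in>I. (deriv ^^ n) (f i) z)"
  using assms
proof (induction I rule: infinite_finite_induct)
  case (insert a A)
  have "(deriv ^^ n) (\<lambda>w. f a w + (\<Sum>i\<in>A. f i w)) z = (deriv ^^ n) (f a) z + (deriv ^^ n) (\<lambda>w. \<Sum>i\<in>A. f i w) z"
    by (rule higher_deriv_add) (use insert.prems in \<open>auto intro!: holomorphic_on_sum\<close>)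
  then show ?case using insert by simp
qed (simp_all add: higher_deriv_const)

text \<open>
By the chain rule, the derivative of a slice of \<open>f\<close> is the sum of \<open>z $ j\<close> times the slices of the partial
derivatives of \<open>f\<close>, and these are holomorphic again. Each differentiation therefore contributes one
linear factor.
\<close>

lemma higher_deriv_slice_homogeneous:
  fixes f :: "complex ^ 'n \<Rightarrow> complex"
  assumes "f chol_on unit_ball"
  shows "homogeneous_polynomial k (\<lambda>z. (deriv ^^ k) (\<lambda>w. f (w *s z)) 0)"
  using assms
proof (induction k arbitrary: f)
  case 0
  then show ?case using homogeneous_polynomial_const[of "f 0"] by simp
next
  case (Suc k)
  let ?d = "\<lambda>j z. cderiv f z (axis j 1)"
  have d: "?d j chol_on unit_ball" for j
    using chol_directional_derivative[OF Suc.prems] by simp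
  have "(deriv ^^ Suc k) (\<lambda>w. f (w *s z)) 0 = (\<Sum>j\<in>UNIV. z $ j * (deriv ^^ k) (\<lambda>w. ?d j (w *s z)) 0)" for z
  proof -
    have 1: "deriv (\<lambda>w. f (w *s z)) w = (\<Sum>j\<in>UNIV. z $ j * ?d j (w *s z))" if w: "w \<in> slice_disc z" for w
    proof -
      have c: "clinear_deriv_at f (w *s z)" using Suc.prems slice_disc(3)[OF w] by blast
      show ?thesis using DERIV_imp_deriv[OF chol_slice_derivative0[OF c]] cderiv_expansion[OF c, of z] by simp
    qed
    have h: "(\<lambda>w. z $ j * ?d j (w *s z)) holomorphic_on slice_disc z" for j
      by (intro holomorphic_intros slice_holomorphic d)
    have "(deriv ^^ Suc k) (\<lambda>w. f (w *s z)) 0 = (deriv ^^ k) (deriv (\<lambda>w. f (w *s z))) 0"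
      by (simp add: funpow_swap1)
    also have "\<dots> = (deriv ^^ k) (\<lambda>w. \<Sum>j\<in>UNIV. z $ j * ?d j (w *s z)) 0"
      by (rule higher_deriv_transform_within_open[OF _ _ slice_disc(1)[of z] slice_disc(2)[of z] 1])
         (auto intro!: holomorphic_deriv slice_holomorphic Suc.prems slice_disc(1) holomorphic_on_sum h)
    also have "\<dots> = (\<Sum>j\<in>UNIV. (deriv ^^ k) (\<lambda>w. z $ j * ?d j (w *s z)) 0)"
      by (rule higher_deriv_sum[OF h slice_disc(1)[of z] slice_disc(2)[of z]])
    also have "\<dots> = (\<Sum>j\<in>UNIV. z $ j * (deriv ^^ k) (\<lambda>w. ?d j (w *s z)) 0)"
      by (intro sum.cong refl higher_deriv_cmult[OF slice_holomorphic[OF d] slice_disc(2,1)])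
    finally show ?thesis .
  qed
  moreover have "homogeneous_polynomial (Suc k) (\<lambda>z. \<Sum>j\<in>UNIV. z $ j * (deriv ^^ k) (\<lambda>w. ?d j (w *s z)) 0)"
    by (intro homogeneous_polynomial_sum homogeneous_polynomial_times_component Suc.IH d)
  ultimately show ?case by presburger
qed

lemma hom_part_polynomial: "f chol_on unit_ball \<Longrightarrow> homogeneous_polynomial k (hom_part f k)"
  using homogeneous_polynomial_scale[OF higher_deriv_slice_homogeneous, of f k "1 / fact k"]
  unfolding hom_part_def[abs_def] by simp

lemma hom_part_homogeneous: "f chol_on unit_ball \<Longrightarrow> hom_part f k (a *s z) = a ^ k * hom_part f k z"
  using hom_part_polynomial homogeneous_polynomial_homogeneous by blast

lemma hom_part_sums_slice:
  assumes f: "f chol_on unit_ball" and w: "norm w * norm z < 1"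
  shows "(\<lambda>k. hom_part f k z * w ^ k) sums f (w *s z)"
proof (cases "z = 0")
  case True
  have "hom_part f k 0 = (if k = 0 then f 0 else 0)" for k
    unfolding hom_part_def by (simp add: higher_deriv_const)
  then have "(\<lambda>k. hom_part f k z * w ^ k) = (\<lambda>k. if k = 0 then f 0 else 0)"
    using True by (auto simp: fun_eq_iff)
  then show ?thesis using True sums_single[of 0 "\<lambda>_. f 0"] by simp
next
  case False
  then have "slice_disc z = ball 0 (1 / norm z)" by (auto simp: slice_disc_def field_simps)
  then have "(\<lambda>w. f (w *s z)) holomorphic_on ball 0 (1 / norm z)" "w \<in> ball 0 (1 / norm z)"
    using slice_holomorphic[OF f, of z] w False by (auto simp: field_simps)
  from holomorphic_power_series[OF this] show ?thesis by (simp add: hom_part_def)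
qed

lemma hom_part_sums: "f chol_on unit_ball \<Longrightarrow> z \<in> unit_ball \<Longrightarrow> (\<lambda>k. hom_part f k z) sums f z"
  using hom_part_sums_slice[of f 1 z] by simp

lemma hom_part_0: "hom_part f 0 z = f 0"
  by (simp add: hom_part_def)

lemma hom_part_bound:
  assumes f: "f chol_on unit_ball" and \<rho>: "0 < \<rho>" "\<rho> < 1" and B: "\<And>u. u \<in> cball 0 \<rho> \<Longrightarrow> norm (f u) \<le> B"
  shows "norm (hom_part f k z) \<le> B * (norm z / \<rho>) ^ k"
proof (cases "z = 0")
  case True
  have "norm (f 0) \<le> B" using B[of 0] \<rho> by simp
  then show ?thesis using True by (cases k) (simp_all add: hom_part_def higher_deriv_const)
next
  case False
  then have z: "norm z > 0" by simp
  let ?s = "\<rho> / norm z"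
  have s: "?s > 0" using \<rho> z by simp
  have inb: "norm (w *s z) \<le> \<rho>" if "w \<in> cball 0 ?s" for w using that z by (simp add: norm_smult_vec field_simps)
  have sub: "cball 0 ?s \<subseteq> slice_disc z"
    using z \<rho> by (auto simp: slice_disc_def field_simps)
  have hol: "(\<lambda>w. f (w *s z)) holomorphic_on cball 0 ?s"
    using slice_holomorphic[OF f, of z] sub holomorphic_on_subset by blast
  have "norm ((deriv ^^ k) (\<lambda>w. f (w *s z)) 0) \<le> fact k * B / ?s ^ k"
  proof (rule Cauchy_inequality[OF _ _ s])
    show "(\<lambda>w. f (w *s z)) holomorphic_on ball 0 ?s" using hol holomorphic_on_subset ball_subset_cball by blast
    show "continuous_on (cball 0 ?s) (\<lambda>w. f (w *s z))" using hol by (rule holomorphic_on_imp_continuous_on)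
    fix x :: complex assume "norm (0 - x) = ?s"
    then show "norm (f (x *s z)) \<le> B" using inb[of x] by (intro B) simp
  qed
  then have "norm ((deriv ^^ k) (\<lambda>w. f (w *s z)) 0) / fact k \<le> B / ?s ^ k"
    by (simp add: field_simps)
  then show ?thesis by (simp add: hom_part_def norm_divide power_divide)
qed

lemma power_series_coeff_zero:
  fixes a :: "nat \<Rightarrow> complex"
  assumes r: "r > 0" and s: "\<And>w. norm w < r \<Longrightarrow> (\<lambda>k. a k * w ^ k) sums 0"
  shows "a k = 0"
proof (rule ccontr)
  assume k: "a k \<noteq> 0"
  show False
  proof (cases "k = 0")
    case True
    then show False using s[of 0] k r powser_sums_zero_iff by auto
  next
    case False
    have 0: "(0::complex) = a 0" using s[of 0] r by (simp add: powser_sums_zero_iff)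
    obtain s' where s': "0 < s'" "\<And>z. z \<in> cball 0 s' - {0} \<Longrightarrow> (\<lambda>w::complex. 0::complex) z \<noteq> 0"
      by (rule powser_0_nonzero[of r 0 a "\<lambda>_. 0" k]) (use s k False r in auto)
    then show False using s'(2)[of "of_real s'"] s'(1) by auto
  qed
qed

text \<open>
On the slice through \<open>z\<close> both expansions are power series with the same sum.
\<close>

lemma hom_part_unique:
  assumes f: "f chol_on unit_ball"
    and hom: "\<And>k a z. F k (a *s z) = a ^ k * F k z" and s: "\<And>z. z \<in> unit_ball \<Longrightarrow> (\<lambda>k. F k z) sums f z"
  shows "F k z = hom_part f k z"
proof -
  have "F k z - hom_part f k z = 0"
  proof (rule power_series_coeff_zero)
    show "1 / (norm z + 1) > 0" by (simp add: add_nonneg_pos)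
    fix w :: complex assume "norm w < 1 / (norm z + 1)"
    moreover have "norm z + 1 > 0" by (simp add: add_nonneg_pos)
    ultimately have "norm w * (norm z + 1) < 1" by (simp only: pos_less_divide_eq)
    moreover have "norm w * norm z \<le> norm w * (norm z + 1)" by (intro mult_left_mono) auto
    ultimately have w: "norm w * norm z < 1" by linarith
    have "(\<lambda>k. F k (w *s z)) sums f (w *s z)" by (rule s) (rule slice_ball[OF w])
    from sums_diff[OF this hom_part_sums_slice[OF f w]]
    show "(\<lambda>k. (F k z - hom_part f k z) * w ^ k) sums 0" by (simp add: hom algebra_simps)
  qed
  then show ?thesis by simp
qed

lemma homogeneous_expansion_eq:
  assumes f: "f chol_on unit_ball"
  shows "homogeneous_expansion f = hom_part f"
  unfolding homogeneous_expansion_def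
proof (rule the_equality)
  show "(\<forall>k. homogeneous_polynomial k (hom_part f k)) \<and> (\<forall>z\<in>unit_ball. (\<lambda>k. hom_part f k z) sums f z)"
    using hom_part_polynomial[OF f] hom_part_sums[OF f] by blast
  fix F assume F: "(\<forall>k. homogeneous_polynomial k (F k)) \<and> (\<forall>z\<in>unit_ball. (\<lambda>k. F k z) sums f z)"
  show "F = hom_part f"
    by (intro ext hom_part_unique[OF f]) (use F homogeneous_polynomial_homogeneous in blast)+
qed

section \<open>Coefficient multipliers\<close>

text \<open>
The coefficient sequences of power series with radius of convergence at least \<open>1\<close>. Such factors preserve the
convergence of homogeneous expansions in the open ball.
\<close>

definition subexponential :: "(nat \<Rightarrow> complex) \<Rightarrow> bool" where
  "subexponential \<mu> \<longleftrightarrow> (\<forall>q. 0 < q \<and> q < 1 \<longrightarrow> (\<exists>C. \<forall>k. norm (\<mu> k) * q ^ k \<le> C))"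

definition multiplier :: "(nat \<Rightarrow> complex) \<Rightarrow> (complex ^ 'n \<Rightarrow> complex) \<Rightarrow> complex ^ 'n \<Rightarrow> complex" where
  "multiplier \<mu> f z = (if z \<in> unit_ball then \<Sum>k. \<mu> k * hom_part f k z else 0)"

lemma subexponential_mult:
  assumes "subexponential \<mu>" "subexponential \<nu>"
  shows "subexponential (\<lambda>k. \<mu> k * \<nu> k)"
  unfolding subexponential_def
proof (intro allI impI)
  fix q :: real assume q: "0 < q \<and> q < 1"
  then have s: "0 < sqrt q \<and> sqrt q < 1" by simp
  obtain C where C: "\<And>k. norm (\<mu> k) * sqrt q ^ k \<le> C" using assms(1) s unfolding subexponential_def by blast
  obtain D where D: "\<And>k. norm (\<nu> k) * sqrt q ^ k \<le> D" using assms(2) s unfolding subexponential_def by blast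
  have "norm (\<mu> k * \<nu> k) * q ^ k \<le> C * D" for k
  proof -
    have "q ^ k = sqrt q ^ k * sqrt q ^ k" using q by (simp flip: power_mult_distrib)
    then have "norm (\<mu> k * \<nu> k) * q ^ k = (norm (\<mu> k) * sqrt q ^ k) * (norm (\<nu> k) * sqrt q ^ k)"
      by (simp only: norm_mult mult_ac)
    also have "\<dots> \<le> C * D"
      by (intro mult_mono C D order_trans[OF _ C[of k]]) (use q in auto)
    finally show ?thesis .
  qed
  then show "\<exists>C. \<forall>k. norm (\<mu> k * \<nu> k) * q ^ k \<le> C" by blast
qed

lemma subexponential_ratio:
  assumes lim: "(\<lambda>k. \<mu> (Suc k) / \<mu> k) \<longlonglongrightarrow> 1" and nz: "\<forall>\<^sub>F k in sequentially. \<mu> k \<noteq> 0"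
  shows "subexponential \<mu>"
  unfolding subexponential_def
proof (intro allI impI)
  fix q :: real assume q: "0 < q \<and> q < 1"
  have "(\<lambda>k. norm (\<mu> (Suc k) / \<mu> k)) \<longlonglongrightarrow> norm (1::complex)" by (intro tendsto_norm lim)
  then have "\<forall>\<^sub>F k in sequentially. norm (\<mu> (Suc k) / \<mu> k) < 1 / q"
    using q by (intro order_tendstoD(2)) auto
  with nz have "\<forall>\<^sub>F k in sequentially. norm (\<mu> (Suc k)) * q \<le> norm (\<mu> k)"
    by eventually_elim (use q in \<open>auto simp: norm_divide field_simps\<close>)
  then obtain N where N: "\<And>k. k \<ge> N \<Longrightarrow> norm (\<mu> (Suc k)) * q \<le> norm (\<mu> k)"
    unfolding eventually_sequentially by blast
  define C where "C = (\<Sum>k\<le>N. norm (\<mu> k) * q ^ k)"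
  have le: "norm (\<mu> k) * q ^ k \<le> C" if "k \<le> N" for k
    unfolding C_def by (rule member_le_sum) (use that q in auto)
  have ge: "norm (\<mu> (N + j)) * q ^ (N + j) \<le> C" for j
  proof (induction j)
    case 0 then show ?case using le[of N] by simp
  next
    case (Suc j)
    have "norm (\<mu> (N + Suc j)) * q ^ (N + Suc j) = (norm (\<mu> (Suc (N + j))) * q) * q ^ (N + j)" by simp
    also have "\<dots> \<le> norm (\<mu> (N + j)) * q ^ (N + j)" by (intro mult_right_mono N) (use q in auto)
    finally show ?case using Suc by linarith
  qed
  have "norm (\<mu> k) * q ^ k \<le> C" for k
    using le[of k] ge[of "k - N"] by (cases "k \<le> N") auto
  then show "\<exists>C. \<forall>k. norm (\<mu> k) * q ^ k \<le> C" by blast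
qed

lemma subexponential_const: "subexponential (\<lambda>k. c)"
  unfolding subexponential_def
proof (intro allI impI exI)
  fix q :: real and k assume "0 < q \<and> q < 1"
  then show "norm c * q ^ k \<le> norm c" by (intro mult_left_le power_le_one) auto
qed

lemma subexponential_add:
  assumes "subexponential \<mu>" "subexponential \<nu>"
  shows "subexponential (\<lambda>k. \<mu> k + \<nu> k)"
  unfolding subexponential_def
proof (intro allI impI)
  fix q :: real assume q: "0 < q \<and> q < 1"
  obtain C where C: "\<And>k. norm (\<mu> k) * q ^ k \<le> C" using assms(1) q unfolding subexponential_def by blast
  obtain D where D: "\<And>k. norm (\<nu> k) * q ^ k \<le> D" using assms(2) q unfolding subexponential_def by blast
  have "norm (\<mu> k + \<nu> k) * q ^ k \<le> C + D" for k
  proof -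
    have "norm (\<mu> k + \<nu> k) * q ^ k \<le> (norm (\<mu> k) + norm (\<nu> k)) * q ^ k"
      by (intro mult_right_mono norm_triangle_ineq) (use q in auto)
    then show ?thesis using C[of k] D[of k] by (simp add: distrib_right)
  qed
  then show "\<exists>C. \<forall>k. norm (\<mu> k + \<nu> k) * q ^ k \<le> C" by blast
qed

lemma shift_ratio_tendsto_1: "(\<lambda>k. (a + of_nat k) / (b + of_nat k)) \<longlonglongrightarrow> (1::complex)"
proof -
  have inf: "filterlim (\<lambda>k. b + of_nat k :: complex) at_infinity sequentially"
    by (rule tendsto_add_filterlim_at_infinity[OF tendsto_const tendsto_of_nat])
  have "\<forall>\<^sub>F k in sequentially. norm (b + of_nat k :: complex) \<ge> 1"
    using inf unfolding filterlim_at_infinity[OF order_refl] by (auto dest: spec[of _ 1])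
  then have "\<forall>\<^sub>F k in sequentially. 1 + (a - b) / (b + of_nat k) = (a + of_nat k) / (b + of_nat k)"
  proof eventually_elim
    case (elim k)
    then have "b + of_nat k \<noteq> 0" by auto
    then have "1 + (a - b) / (b + of_nat k) = ((b + of_nat k) + (a - b)) / (b + of_nat k)"
      by (subst add_divide_distrib) simp
    then show ?case by (simp add: algebra_simps)
  qed
  moreover have "(\<lambda>k. 1 + (a - b) / (b + of_nat k)) \<longlonglongrightarrow> 1 + 0"
    by (intro tendsto_add tendsto_const tendsto_divide_0[OF tendsto_const inf])
  ultimately show ?thesis using tendsto_cong by fastforce
qed

lemma subexponential_shift: "subexponential (\<lambda>k. of_nat k + c)"
proof (rule subexponential_ratio)
  show "(\<lambda>k. (of_nat (Suc k) + c) / (of_nat k + c)) \<longlonglongrightarrow> 1"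
    using shift_ratio_tendsto_1[of "1 + c" c] by (simp add: add_ac)
  have "filterlim (\<lambda>k. c + of_nat k :: complex) at_infinity sequentially"
    by (rule tendsto_add_filterlim_at_infinity[OF tendsto_const tendsto_of_nat])
  then have "\<forall>\<^sub>F k in sequentially. norm (c + of_nat k :: complex) \<ge> 1"
    unfolding filterlim_at_infinity[OF order_refl] by (auto dest: spec[of _ 1])
  then show "\<forall>\<^sub>F k in sequentially. of_nat k + c \<noteq> 0"
    by eventually_elim (metis add.commute norm_zero not_one_le_zero)
qed

lemma subexponential_of_nat: "subexponential of_nat"
  using subexponential_shift[of 0] by simp

lemma subexponential_power: "subexponential \<mu> \<Longrightarrow> subexponential (\<lambda>k. \<mu> k ^ n)"
  by (induction n) (auto intro: subexponential_mult subexponential_const)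

lemma subexponential_bounded:
  assumes "\<And>k. norm (\<mu> k) \<le> C" shows "subexponential \<mu>"
  unfolding subexponential_def
proof (intro allI impI exI)
  fix q :: real and k assume q: "0 < q \<and> q < 1"
  have "norm (\<mu> k) * q ^ k \<le> norm (\<mu> k)" using q by (intro mult_left_le power_le_one) auto
  then show "norm (\<mu> k) * q ^ k \<le> C" using assms[of k] by linarith
qed

lemma eventually_Re_pos: "\<forall>\<^sub>F k in sequentially. Re a + real k > 0"
  using eventually_gt_at_top[of "nat \<lceil>\<bar>Re a\<bar>\<rceil>"] by eventually_elim linarith

lemma Re_pos_not_nonpos_Int: "Re z > 0 \<Longrightarrow> z \<notin> \<int>\<^sub>\<le>\<^sub>0"
  by (auto elim!: nonpos_Ints_cases)

lemma subexponential_Gamma_ratio: "subexponential (\<lambda>k. Gamma (a + of_nat k) / Gamma (b + of_nat k))"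
proof (rule subexponential_ratio)
  have ev: "\<forall>\<^sub>F k in sequentially. a + of_nat k \<notin> \<int>\<^sub>\<le>\<^sub>0 \<and> b + of_nat k \<notin> \<int>\<^sub>\<le>\<^sub>0"
    using eventually_Re_pos[of a] eventually_Re_pos[of b]
    by eventually_elim (auto intro!: Re_pos_not_nonpos_Int)
  then show "\<forall>\<^sub>F k in sequentially. Gamma (a + of_nat k) / Gamma (b + of_nat k) \<noteq> 0"
    by eventually_elim (auto simp: Gamma_eq_zero_iff)
  have "\<forall>\<^sub>F k in sequentially. (a + of_nat k) / (b + of_nat k) =
      (Gamma (a + of_nat (Suc k)) / Gamma (b + of_nat (Suc k))) / (Gamma (a + of_nat k) / Gamma (b + of_nat k))"
    using ev
  proof eventually_elim
    case (elim k)
    have "Gamma (a + of_nat (Suc k)) = (a + of_nat k) * Gamma (a + of_nat k)"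
      "Gamma (b + of_nat (Suc k)) = (b + of_nat k) * Gamma (b + of_nat k)"
      using Gamma_plus1[of "a + of_nat k"] Gamma_plus1[of "b + of_nat k"] elim by (auto simp: add_ac)
    moreover have "Gamma (a + of_nat k) \<noteq> 0" "Gamma (b + of_nat k) \<noteq> 0" using elim by (auto simp: Gamma_eq_zero_iff)
    ultimately show ?case by simp
  qed
  then show "(\<lambda>k. (Gamma (a + of_nat (Suc k)) / Gamma (b + of_nat (Suc k))) / (Gamma (a + of_nat k) / Gamma (b + of_nat k))) \<longlonglongrightarrow> 1"
    using shift_ratio_tendsto_1[of a b] tendsto_cong by fast
qed

lemma chol_bounded_on_cball:
  assumes "f chol_on unit_ball" "\<rho> < 1"
  obtains B where "\<And>u. u \<in> cball 0 \<rho> \<Longrightarrow> norm (f u) \<le> B"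
proof -
  have "continuous_on (cball 0 \<rho>) f"
    using chol_on_continuous_on[OF assms(1)] by (rule continuous_on_subset) (use assms(2) in auto)
  then have "compact (f ` cball 0 \<rho>)" by (intro compact_continuous_image) auto
  then show ?thesis using that by (meson bounded_iff compact_imp_bounded imageI)
qed

text \<open>
Uniform geometric decay on smaller balls; it gives holomorphy of the sum by the theorem of Weierstrass.
\<close>

lemma multiplier_terms_bound:
  fixes f :: "complex ^ 'n \<Rightarrow> complex"
  assumes f: "f chol_on unit_ball" and \<mu>: "subexponential \<mu>" and r: "r < 1"
  obtains C q where "0 \<le> q" "q < 1" "\<And>z k. norm z \<le> r \<Longrightarrow> norm (\<mu> k * hom_part f k z) \<le> C * q ^ k"
proof -
  define s where "s = max r (1/2)"
  define \<rho> where "\<rho> = (s + 1) / 2"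
  have s: "0 < s" "s < 1" "r \<le> s" "s < \<rho>" "\<rho> < 1" using r by (auto simp: s_def \<rho>_def)
  \<comment> \<open>one factor \<open>q ^ k\<close> of the decay \<open>(s / \<rho>) ^ k\<close> absorbs the growth of \<open>\<mu> k\<close>, the other remains\<close>
  define q where "q = sqrt (s / \<rho>)"
  have q: "0 < q" "q < 1" "q * q = s / \<rho>" using s by (auto simp: q_def)
  obtain B where B: "\<And>u. u \<in> cball 0 \<rho> \<Longrightarrow> norm (f u) \<le> B" using chol_bounded_on_cball[OF f s(5)] by blast
  obtain C where C: "\<And>k. norm (\<mu> k) * q ^ k \<le> C" using \<mu> q unfolding subexponential_def by blast
  have B0: "B \<ge> 0" using order_trans[OF norm_ge_zero B[of 0]] s by auto
  show ?thesis
  proof (rule that[of q "C * B"])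
    fix z :: "complex ^ 'n" and k assume z: "norm z \<le> r"
    have "norm (hom_part f k z) \<le> B * (norm z / \<rho>) ^ k"
      by (rule hom_part_bound[OF f _ s(5) B]) (use s in auto)
    also have "\<dots> \<le> B * (q * q) ^ k" unfolding q(3)
      by (intro mult_left_mono power_mono divide_right_mono) (use z s B0 in auto)
    finally have "norm (hom_part f k z) \<le> B * q ^ k * q ^ k" by (simp add: power_mult_distrib)
    then have "norm (\<mu> k * hom_part f k z) \<le> norm (\<mu> k) * (B * q ^ k * q ^ k)"
      unfolding norm_mult by (intro mult_left_mono) auto
    also have "\<dots> = (norm (\<mu> k) * q ^ k) * (B * q ^ k)" by (simp only: mult_ac)
    also have "\<dots> \<le> C * (B * q ^ k)" by (intro mult_right_mono C) (use B0 q in auto)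
    finally show "norm (\<mu> k * hom_part f k z) \<le> C * B * q ^ k" by (simp only: mult_ac)
  qed (use q in auto)
qed

lemma multiplier_summable_norm:
  assumes f: "f chol_on unit_ball" and \<mu>: "subexponential \<mu>" and z: "z \<in> unit_ball"
  shows "summable (\<lambda>k. norm (\<mu> k * hom_part f k z))"
proof -
  have "norm z < 1" using z by simp
  from multiplier_terms_bound[OF f \<mu> this] obtain C q where
    Cq: "0 \<le> q" "q < 1" "\<And>k. norm (\<mu> k * hom_part f k z) \<le> C * q ^ k"
    by (metis order_refl)
  have "summable (\<lambda>k. C * q ^ k)" using Cq by (intro summable_mult summable_geometric) auto
  then show ?thesis by (rule summable_comparison_test') (use Cq(3) in simp)
qed

lemma multiplier_sums:
  assumes f: "f chol_on unit_ball" and \<mu>: "subexponential \<mu>" and z: "z \<in> unit_ball"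
  shows "(\<lambda>k. \<mu> k * hom_part f k z) sums multiplier \<mu> f z"
  using summable_norm_cancel[OF multiplier_summable_norm[OF assms]] z
  by (simp add: multiplier_def summable_sums)

lemma multiplier_chol:
  fixes f :: "complex ^ 'n \<Rightarrow> complex"
  assumes f: "f chol_on unit_ball" and \<mu>: "subexponential \<mu>"
  shows "multiplier \<mu> f chol_on unit_ball"
proof
  fix z0 :: "complex ^ 'n" assume z0: "z0 \<in> unit_ball"
  define r where "r = (1 - norm z0) / 4"
  have r: "r > 0" using z0 by (simp add: r_def)
  have sub: "norm z \<le> norm z0 + 2 * r" if "z \<in> ball z0 (2 * r)" for z
    using that norm_triangle_ineq2[of z z0] by (simp add: dist_norm norm_minus_commute)
  have lt: "norm z0 + 2 * r < 1" using z0 by (simp add: r_def field_simps)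
  from multiplier_terms_bound[OF f \<mu> lt] obtain C q where
    Cq: "0 \<le> q" "q < 1" "\<And>z k. norm z \<le> norm z0 + 2 * r \<Longrightarrow> norm (\<mu> k * hom_part f k z) \<le> C * q ^ k"
    by metis
  have "uniform_limit (ball z0 (2*r)) (\<lambda>n z. \<Sum>k<n. \<mu> k * hom_part f k z) (\<lambda>z. \<Sum>k. \<mu> k * hom_part f k z) sequentially"
  proof (rule Weierstrass_m_test)
    show "summable (\<lambda>k. C * q ^ k)" using Cq by (intro summable_mult summable_geometric) auto
  qed (use Cq(3) sub in blast)
  then have "clinear_deriv_at (\<lambda>z. \<Sum>k. \<mu> k * hom_part f k z) z0"
    by (rule chol_uniform_limit[OF _ r, rotated])
       (intro ballI clinear_deriv_at_sum clinear_deriv_at_mult clinear_deriv_at_const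
          homogeneous_polynomial_chol[OF hom_part_polynomial[OF f]])
  then show "clinear_deriv_at (multiplier \<mu> f) z0"
    by (rule clinear_deriv_at_cong(1)[OF _ open_ball z0]) (simp add: multiplier_def)
qed

lemma multiplier_outside: "z \<notin> unit_ball \<Longrightarrow> multiplier \<mu> f z = 0"
  unfolding multiplier_def by (simp only: if_False)

lemma multiplier_holomorphic_ball:
  "f chol_on unit_ball \<Longrightarrow> subexponential \<mu> \<Longrightarrow> multiplier \<mu> f \<in> holomorphic_ball"
  by (intro holomorphic_ballI multiplier_chol multiplier_outside)

lemma hom_part_multiplier:
  assumes f: "f chol_on unit_ball" and \<mu>: "subexponential \<mu>"
  shows "hom_part (multiplier \<mu> f) k z = \<mu> k * hom_part f k z"
  by (rule hom_part_unique[symmetric, OF multiplier_chol[OF assms]])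
     (auto simp: hom_part_homogeneous[OF f] intro: multiplier_sums[OF assms])

lemma multiplier_multiplier:
  assumes "f chol_on unit_ball" "subexponential \<mu>"
  shows "multiplier \<nu> (multiplier \<mu> f) = multiplier (\<lambda>k. \<nu> k * \<mu> k) f"
  unfolding multiplier_def[of \<nu>] multiplier_def[of "\<lambda>k. \<nu> k * \<mu> k"] hom_part_multiplier[OF assms] mult.assoc ..

lemma multiplier_one:
  assumes "f \<in> holomorphic_ball"
  shows "multiplier (\<lambda>_. 1) f = f"
proof
  fix z
  show "multiplier (\<lambda>_. 1) f z = f z"
    using hom_part_sums[OF holomorphic_ball_chol[OF assms], of z] assms
    by (auto simp: multiplier_def sums_iff holomorphic_ball_def)
qed

lemma multiplier_at_0:
  assumes "f chol_on unit_ball" "subexponential \<mu>"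
  shows "multiplier \<mu> f 0 = \<mu> 0 * f 0"
  using hom_part_multiplier[OF assms, of 0 0] by (simp add: hom_part_0)

lemma multiplier_lincomb:
  assumes f: "f chol_on unit_ball" and g: "g chol_on unit_ball" and \<mu>: "subexponential \<mu>"
  shows "multiplier \<mu> (\<lambda>z. a * f z + b * g z) = (\<lambda>z. a * multiplier \<mu> f z + b * multiplier \<mu> g z)"
proof
  fix z
  have h: "(\<lambda>z. a * f z + b * g z) chol_on unit_ball"
    using f g by (intro ballI clinear_deriv_at_add clinear_deriv_at_mult clinear_deriv_at_const) auto
  have hp: "hom_part (\<lambda>z. a * f z + b * g z) k z = a * hom_part f k z + b * hom_part g k z" for k z
    by (rule hom_part_unique[OF h, symmetric])
       (auto simp: hom_part_homogeneous[OF f] hom_part_homogeneous[OF g] algebra_simps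
             intro!: sums_add sums_mult hom_part_sums f g)
  show "multiplier \<mu> (\<lambda>z. a * f z + b * g z) z = a * multiplier \<mu> f z + b * multiplier \<mu> g z"
  proof (cases "z \<in> unit_ball")
    case True
    have "(\<lambda>k. a * (\<mu> k * hom_part f k z) + b * (\<mu> k * hom_part g k z)) sums (a * multiplier \<mu> f z + b * multiplier \<mu> g z)"
      by (intro sums_add sums_mult multiplier_sums f g \<mu> True)
    moreover have "(\<lambda>k. \<mu> k * hom_part (\<lambda>z. a * f z + b * g z) k z) sums multiplier \<mu> (\<lambda>z. a * f z + b * g z) z"
      by (rule multiplier_sums[OF h \<mu> True])
    ultimately show ?thesis unfolding hp by (simp add: algebra_simps sums_unique2)
  qed (simp add: multiplier_def)
qed

lemma multiplier_add_sequences: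
  assumes f: "f chol_on unit_ball" and "subexponential \<mu>" "subexponential \<nu>"
  shows "multiplier (\<lambda>k. \<mu> k + \<nu> k) f z = multiplier \<mu> f z + multiplier \<nu> f z"
proof (cases "z \<in> unit_ball")
  case True
  have "(\<lambda>k. (\<mu> k + \<nu> k) * hom_part f k z) sums (multiplier \<mu> f z + multiplier \<nu> f z)"
    unfolding distrib_right by (intro sums_add multiplier_sums assms True)
  then show ?thesis using multiplier_sums[OF f subexponential_add[OF assms(2,3)] True] sums_unique2 by blast
qed (simp add: multiplier_def)

lemma multiplier_supported_at_0:
  assumes f: "f chol_on unit_ball" and \<mu>: "\<And>k. k > 0 \<Longrightarrow> \<mu> k = 0" and z: "z \<in> unit_ball"
  shows "multiplier \<mu> f z = \<mu> 0 * f 0"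
proof -
  have "(\<lambda>k. \<mu> k * hom_part f k z) = (\<lambda>k. if k = 0 then \<mu> 0 * f 0 else 0)"
    using \<mu> by (auto simp: hom_part_0)
  then have "(\<lambda>k. \<mu> k * hom_part f k z) sums (\<mu> 0 * f 0)" using sums_single[of 0 "\<lambda>_. \<mu> 0 * f 0"] by simp
  then show ?thesis using z by (simp add: multiplier_def sums_iff)
qed

lemma multiplier_cmult:
  assumes f: "f chol_on unit_ball" and se: "subexponential \<mu>"
  shows "multiplier (\<lambda>k. c * \<mu> k) f = (\<lambda>z. c * multiplier \<mu> f z)"
proof
  fix z
  show "multiplier (\<lambda>k. c * \<mu> k) f z = c * multiplier \<mu> f z"
  proof (cases "z \<in> unit_ball")
    case True
    have "(\<lambda>k. c * \<mu> k * hom_part f k z) sums (c * multiplier \<mu> f z)"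
      unfolding mult.assoc by (intro sums_mult multiplier_sums f se True)
    then show ?thesis using True unfolding multiplier_def[of "\<lambda>k. c * \<mu> k"] by (simp add: sums_iff)
  qed (simp add: multiplier_def)
qed

text \<open>
Termwise differentiation of the slice \<open>w \<mapsto> f (w z)\<close> at \<open>w = 1\<close>.
\<close>

lemma multiplier_of_nat:
  assumes f: "f chol_on unit_ball" and z: "z \<in> unit_ball"
  shows "multiplier of_nat f z = cderiv f z z"
proof -
  obtain K where K: "K > 1" "K * norm z < 1"
  proof (cases "z = 0")
    case False
    show ?thesis
    proof (rule that[of "(1 + 1 / norm z) / 2"])
      show "1 < (1 + 1 / norm z) / 2" using z False by (simp add: field_simps)
      show "(1 + 1 / norm z) / 2 * norm z < 1" using z False by (simp add: field_simps)
    qed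
  qed (use that[of 2] in auto)
  have "(\<lambda>n. diffs (\<lambda>k. hom_part f k z) n * 1 ^ n) sums cderiv f z z"
  proof (rule termdiffs_sums_strong)
    fix w :: complex assume w: "norm w < K"
    then have "norm w * norm z \<le> K * norm z" by (intro mult_right_mono) auto
    then show "(\<lambda>n. hom_part f n z * w ^ n) sums f (w *s z)" using K by (intro hom_part_sums_slice[OF f]) auto
  next
    show "((\<lambda>w. f (w *s z)) has_field_derivative cderiv f z z) (at 1)"
      using chol_slice_derivative0[of f 1 z] f z by simp
  next
    show "norm (1::complex) < K" using K by simp
  qed
  then have "(\<lambda>n. of_nat (Suc n) * hom_part f (Suc n) z) sums cderiv f z z" by (simp add: diffs_def)
  then have "(\<lambda>n. of_nat n * hom_part f n z) sums cderiv f z z"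
    using sums_Suc_iff[of "\<lambda>n. of_nat n * hom_part f n z"] by simp
  then show ?thesis using multiplier_sums[OF f subexponential_of_nat z] sums_unique2 by blast
qed

lemma multiplier_shift:
  assumes f: "f chol_on unit_ball" and z: "z \<in> unit_ball"
  shows "multiplier (\<lambda>k. of_nat k + c) f z = cderiv f z z + c * f z"
proof -
  have "multiplier (\<lambda>k. of_nat k + c) f z = multiplier of_nat f z + multiplier (\<lambda>_. c) f z"
    by (rule multiplier_add_sequences[OF f subexponential_of_nat subexponential_const])
  moreover have "multiplier (\<lambda>_. c) f z = c * f z"
    using sums_mult[OF hom_part_sums[OF f z], of c] z by (simp add: multiplier_def sums_iff)
  ultimately show ?thesis using multiplier_of_nat[OF f z] by simp
qed

lemma radial_deriv_power_multiplier:
  fixes f :: "complex ^ 'n \<Rightarrow> complex"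
  assumes f: "f \<in> holomorphic_ball" and z: "z \<in> unit_ball"
  shows "(radial_deriv ^^ k) f z = multiplier (\<lambda>j. of_nat j ^ k) f z"
  using z
proof (induction k arbitrary: z)
  case 0
  then show ?case using multiplier_one[OF f] by simp
next
  case (Suc k)
  let ?g = "multiplier (\<lambda>j. of_nat j ^ k) f"
  have cf: "f chol_on unit_ball" by (rule holomorphic_ball_chol[OF f])
  have se: "subexponential (\<lambda>j. of_nat j ^ k)" by (intro subexponential_power subexponential_of_nat)
  have g: "?g chol_on unit_ball" by (rule multiplier_chol[OF cf se])
  note cong = clinear_deriv_at_cong[OF g[rule_format, OF Suc.prems] open_ball Suc.prems Suc.IH[symmetric]]
  have "radial_deriv ((radial_deriv ^^ k) f) z = cderiv ((radial_deriv ^^ k) f) z z"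
    by (rule radial_deriv_cderiv[OF cong(1)])
  also have "\<dots> = cderiv ?g z z" by (simp only: cong(2))
  also have "\<dots> = multiplier of_nat ?g z" by (rule multiplier_of_nat[OF g Suc.prems, symmetric])
  also have "\<dots> = multiplier (\<lambda>j. of_nat j ^ Suc k) f z" by (simp add: multiplier_multiplier[OF cf se])
  finally show ?case by simp
qed

section \<open>Sub-mean-value inequalities\<close>

text \<open>
By Vitali's covering theorem an open set is a disjoint union of balls up to a null set, and an isometry
maps balls to balls of the same radius.
\<close>

lemma emeasure_open_isometry_le:
  fixes T S :: "'a::euclidean_space \<Rightarrow> 'a"
  assumes iso: "\<And>x y. dist (S x) (S y) = dist x y" and TS: "\<And>x. T (S x) = x" "\<And>x. S (T x) = x"
    and T: "continuous_on UNIV T" and U: "open U"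
  shows "emeasure lborel U \<le> emeasure lborel (T -` U)"
proof -
  let ?K = "{(x, r). 0 < r \<and> ball x r \<subseteq> U}"
  have cov: "\<exists>i. i \<in> ?K \<and> x \<in> ball (fst i) (snd i) \<and> snd i < d" if xU: "x \<in> U" and d0: "0 < d" for x d
  proof -
    obtain e where "e > 0" "ball x e \<subseteq> U" by (rule openE[OF U xU])
    moreover have "ball x (min e (d/2)) \<subseteq> ball x e" by (rule subset_ball) simp
    ultimately have "ball x (min e (d/2)) \<subseteq> U" using \<open>ball x e \<subseteq> U\<close> by (meson order_trans)
    then show ?thesis using d0 \<open>e > 0\<close> by (intro exI[of _ "(x, min e (d/2))"]) simp
  qed
  obtain C where C: "countable C" "C \<subseteq> ?K"
      "pairwise (\<lambda>i j. disjnt (ball (fst i) (snd i)) (ball (fst j) (snd j))) C"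
      "negligible (U - (\<Union>i\<in>C. ball (fst i) (snd i)))"
    by (rule Vitali_covering_theorem_balls[of U ?K fst snd, OF cov])
  let ?B = "\<lambda>i. ball (fst i) (snd i)" and ?B' = "\<lambda>i. ball (S (fst i)) (snd i)"
  have img: "?B' i = T -` ?B i" for i
  proof (rule set_eqI)
    fix y
    have "dist (S (fst i)) y = dist (fst i) (T y)" using iso[of "fst i" "T y"] TS(2)[of y] by simp
    then show "y \<in> ?B' i \<longleftrightarrow> y \<in> T -` ?B i" by (simp only: mem_ball vimage_eq)
  qed
  have disj: "disjoint_family_on ?B C"
    using C(3) unfolding disjoint_family_on_def pairwise_def disjnt_def by (intro ballI impI) simp
  then have disj': "disjoint_family_on ?B' C"
    unfolding img disjoint_family_on_def by (metis vimage_Int vimage_empty)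
  have meas: "(\<Union>i\<in>C. ?B i) \<in> sets lborel" using C(1) by (intro sets.countable_UN'') auto
  have null: "U - (\<Union>i\<in>C. ?B i) \<in> null_sets lebesgue" using C(4) negligible_iff_null_sets by blast
  have sub: "(\<Union>i\<in>C. ?B i) \<subseteq> U"
  proof (rule UN_least)
    fix i assume "i \<in> C"
    then have "i \<in> ?K" using C(2) by blast
    then show "?B i \<subseteq> U" by (cases i) simp
  qed
  have "emeasure lborel U \<le> emeasure lborel ((\<Union>i\<in>C. ?B i) \<union> (U - (\<Union>i\<in>C. ?B i)))"
    using U meas by (intro emeasure_mono) auto
  also have "\<dots> \<le> emeasure lborel (\<Union>i\<in>C. ?B i) + emeasure lborel (U - (\<Union>i\<in>C. ?B i))"
    using U meas by (intro emeasure_subadditive) auto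
  also have "emeasure lborel (U - (\<Union>i\<in>C. ?B i)) = 0"
    using null U meas by (simp add: null_sets_def)
  also have "emeasure lborel (\<Union>i\<in>C. ?B i) = (\<integral>\<^sup>+i. emeasure lborel (?B i) \<partial>count_space C)"
    using C(1) disj by (intro emeasure_UN_countable) auto
  also have "\<dots> = (\<integral>\<^sup>+i. emeasure lborel (?B' i) \<partial>count_space C)"
  proof (rule nn_integral_cong)
    fix i assume "i \<in> space (count_space C)"
    then have "0 \<le> snd i" using C(2) by auto
    then show "emeasure lborel (?B i) = emeasure lborel (?B' i)" by (simp add: emeasure_ball)
  qed
  also have "\<dots> = emeasure lborel (\<Union>i\<in>C. ?B' i)"
    using C(1) disj' by (intro emeasure_UN_countable[symmetric]) auto
  also have "\<dots> \<le> emeasure lborel (T -` U)"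
  proof (rule emeasure_mono)
    show "(\<Union>i\<in>C. ?B' i) \<subseteq> T -` U" unfolding img using sub by blast
    show "T -` U \<in> sets lborel" using T U by (simp add: open_vimage)
  qed
  finally show ?thesis by simp
qed

lemma distr_lborel_isometry:
  fixes T S :: "'a::euclidean_space \<Rightarrow> 'a"
  assumes iso: "\<And>x y. dist (T x) (T y) = dist x y" and TS: "\<And>x. T (S x) = x" "\<And>x. S (T x) = x"
  shows "distr lborel borel T = lborel"
proof (rule lborel_eqI[symmetric])
  have iso': "dist (S x) (S y) = dist x y" for x y using iso[of "S x" "S y"] TS by simp
  have cont: "continuous_on UNIV T" "continuous_on UNIV S"
    using iso iso' by (auto simp: continuous_on_iff intro!: exI)
  have [measurable]: "T \<in> borel_measurable borel" using cont(1) by (rule borel_measurable_continuous_onI)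
  fix l u :: 'a assume lu: "\<And>b. b \<in> Basis \<Longrightarrow> l \<bullet> b \<le> u \<bullet> b"
  have "emeasure lborel (T -` box l u) \<le> emeasure lborel (S -` (T -` box l u))"
    by (rule emeasure_open_isometry_le[OF iso TS(2,1) cont(2)]) (use cont(1) in \<open>simp add: open_vimage open_box\<close>)
  also have "S -` (T -` box l u) = box l u" using TS by auto
  finally have "emeasure lborel (T -` box l u) = emeasure lborel (box l u)"
    using emeasure_open_isometry_le[OF iso' TS cont(1) open_box, of l u] by (rule antisym)
  then show "emeasure (distr lborel borel T) (box l u) = (\<Prod>b\<in>Basis. (u - l) \<bullet> b)"
    using lu by (simp add: emeasure_distr)
qed simp

lemma distr_lborel_unimodular:
  assumes "norm c = 1"
  shows "distr lborel borel (\<lambda>z :: complex ^ 'n. c *s z) = lborel"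
proof (rule distr_lborel_isometry)
  have c: "c * cnj c = 1" "cnj c * c = 1" using assms by (simp_all add: complex_norm_square[symmetric] mult.commute)
  show "c *s (cnj c *s x) = x" "cnj c *s (c *s x) = x" for x :: "complex ^ 'n"
    by (simp_all add: c)
  fix x y :: "complex ^ 'n"
  have "c *s x - c *s y = c *s (x - y)" by (simp add: vec_eq_iff algebra_simps)
  then show "dist (c *s x) (c *s y) = dist x y" using assms by (simp only: dist_norm norm_smult_vec mult_1)
qed

lemma continuous_on_smult_vec [continuous_intros]:
  fixes g :: "'a::topological_space \<Rightarrow> complex ^ 'n"
  shows "continuous_on S a \<Longrightarrow> continuous_on S g \<Longrightarrow> continuous_on S (\<lambda>x. a x *s g x)"
  unfolding vector_scalar_mult_def by (intro continuous_intros)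

text \<open>
Cauchy's integral formula at the centre, with the circle parametrized by \<open>[0, 1]\<close>.
\<close>

lemma circle_mean_bound:
  assumes g: "g holomorphic_on T" and T: "cball 0 1 \<subseteq> T"
  shows "ennreal (norm (g 0)) \<le> (\<integral>\<^sup>+x. indicator {0..1} x * ennreal (norm (g (exp (2 * of_real pi * \<i> * of_real x)))) \<partial>lborel)"
proof -
  let ?e = "\<lambda>x::real. exp (2 * of_real pi * \<i> * of_real x)"
  have hol: "g holomorphic_on cball 0 1" using g T holomorphic_on_subset by blast
  have "((\<lambda>u. g u / (u - 0)) has_contour_integral (2 * of_real pi * \<i> * g 0)) (circlepath 0 1)"
    by (rule Cauchy_integral_circlepath_simple[OF hol]) simp
  moreover have "g (circlepath 0 1 x) / (circlepath 0 1 x - 0) * vector_derivative (circlepath 0 1) (at x within {0..1})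
      = g (?e x) * (2 * of_real pi * \<i>)" if "x \<in> {0..1}" for x
    using vector_derivative_circlepath01[of x 0 1] that by (simp add: circlepath)
  ultimately have "((\<lambda>x. g (?e x) * (2 * of_real pi * \<i>)) has_integral (g 0 * (2 * of_real pi * \<i>))) {0..1}"
    unfolding has_contour_integral_def by (subst (asm) has_integral_cong) (auto simp: mult.commute)
  moreover have "a * (2 * of_real pi * \<i>) * inverse (2 * of_real pi * \<i>) = a" for a :: complex
    using nonzero_mult_div_cancel_right[of "2 * of_real pi * \<i>" a] unfolding divide_inverse by simp
  ultimately have I: "((\<lambda>x. g (?e x)) has_integral g 0) {0..1}"
    using has_integral_mult_left[of "\<lambda>x. g (?e x) * (2 * of_real pi * \<i>)" "g 0 * (2 * of_real pi * \<i>)" "{0..1}" "inverse (2 * of_real pi * \<i>)"]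
    by (simp only:)
  have in_disc: "?e x \<in> cball 0 1" for x
    by (simp add: norm_exp_eq_Re)
  have cont: "continuous_on {0..1} (\<lambda>x. norm (g (?e x)))"
    by (intro continuous_on_norm continuous_on_compose2[OF holomorphic_on_imp_continuous_on[OF hol]] continuous_intros)
       (use in_disc in auto)
  then have N: "((\<lambda>x. norm (g (?e x))) has_integral integral {0..1} (\<lambda>x. norm (g (?e x)))) {0..1}"
    by (intro integrable_integral integrable_continuous_real)
  have "norm (g 0) \<le> integral {0..1} (\<lambda>x. norm (g (?e x)))"
    using integral_norm_bound_integral[OF has_integral_integrable[OF I] has_integral_integrable[OF N]] integral_unique[OF I] by simp
  then have "ennreal (norm (g 0)) \<le> ennreal (integral {0..1} (\<lambda>x. norm (g (?e x))))" by (rule ennreal_leI)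
  also have "\<dots> = (\<integral>\<^sup>+x. ennreal (indicator {0..1} x * norm (g (?e x))) \<partial>lborel)"
    by (rule nn_integral_has_integral_lebesgue[OF _ N, symmetric]) simp
  also have "\<dots> = (\<integral>\<^sup>+x. indicator {0..1} x * ennreal (norm (g (?e x))) \<partial>lborel)"
    by (intro nn_integral_cong) (auto simp: indicator_def)
  finally show ?thesis .
qed

lemma holomorphic_ball_measurable:
  assumes "f \<in> holomorphic_ball"
  shows "f \<in> borel_measurable borel"
proof -
  have "f = (\<lambda>z. indicator unit_ball z *\<^sub>R f z)"
    using assms by (auto simp: holomorphic_ball_def indicator_def fun_eq_iff)
  moreover have "(\<lambda>z. indicator unit_ball z *\<^sub>R f z) \<in> borel_measurable borel"
    by (rule borel_measurable_continuous_on_indicator) (auto intro: chol_on_continuous_on[OF holomorphic_ball_chol[OF assms]])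
  ultimately show ?thesis by simp
qed

lemma nn_integral_unimodular:
  assumes [measurable]: "h \<in> borel_measurable (borel :: (complex ^ 'n) measure)" and c: "norm c = 1"
  shows "(\<integral>\<^sup>+v. h (c *s v) \<partial>lborel) = (\<integral>\<^sup>+v. h v \<partial>lborel)"
proof -
  have [measurable]: "(\<lambda>v :: complex ^ 'n. c *s v) \<in> borel_measurable borel"
    by (intro borel_measurable_continuous_onI continuous_intros)
  have "(\<integral>\<^sup>+v. h v \<partial>lborel) = (\<integral>\<^sup>+v. h v \<partial>distr lborel borel (\<lambda>v. c *s v))"
    by (simp only: distr_lborel_unimodular[OF c])
  also have "\<dots> = (\<integral>\<^sup>+v. h (c *s v) \<partial>lborel)" by (subst nn_integral_distr) auto
  finally show ?thesis by simp
qed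

lemma nn_integral_translate:
  fixes h :: "'a::euclidean_space \<Rightarrow> ennreal"
  assumes [measurable]: "h \<in> borel_measurable borel"
  shows "(\<integral>\<^sup>+v. h (w + v) \<partial>lborel) = (\<integral>\<^sup>+v. h v \<partial>lborel)"
proof -
  have "(\<integral>\<^sup>+v. h v \<partial>lborel) = (\<integral>\<^sup>+v. h v \<partial>distr lborel borel ((+) w))"
    by (simp only: lborel_distr_plus)
  also have "\<dots> = (\<integral>\<^sup>+v. h (w + v) \<partial>lborel)" by (subst nn_integral_distr) auto
  finally show ?thesis by simp
qed

text \<open>
The mean value inequality on the circles \<open>w + e^(i \<theta>) v\<close> is integrated over \<open>v\<close>. Since Lebesgue measure is
invariant under multiplication by \<open>e^(i \<theta>)\<close>, the circles disappear after exchanging the integrals.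
\<close>

lemma sub_mean_value:
  fixes f :: "complex ^ 'n \<Rightarrow> complex"
  assumes f: "f \<in> holomorphic_ball" and sub: "ball w r \<subseteq> unit_ball"
  shows "ennreal (norm (f w)) * emeasure lborel (ball w r) \<le> (\<integral>\<^sup>+u. indicator (ball w r) u * ennreal (norm (f u)) \<partial>lborel)"
proof (cases "r > 0")
  case r: True
  let ?e = "\<lambda>x::real. exp (2 * of_real pi * \<i> * of_real x)"
  note [measurable] = holomorphic_ball_measurable[OF f]
  have e1: "norm (?e x) = 1" for x by (simp add: norm_exp_eq_Re)
  have [measurable]: "ball (0 :: complex ^ 'n) r \<in> sets borel" "ball w r \<in> sets borel" by simp_all
  have m0: "(\<lambda>p :: real \<times> (complex ^ 'n). w + ?e (fst p) *s snd p) \<in> borel_measurable borel"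
    by (intro borel_measurable_continuous_onI continuous_intros)
  have [measurable]: "(\<lambda>p :: real \<times> (complex ^ 'n). w + ?e (fst p) *s snd p) \<in> borel_measurable (lborel \<Otimes>\<^sub>M lborel)"
    using m0 by (subst measurable_cong_sets[OF _ refl]) (auto simp: borel_prod[symmetric] intro!: sets_pair_measure_cong)
  have pt: "indicator (ball 0 r) v * ennreal (norm (f w)) \<le>
      (\<integral>\<^sup>+x. indicator {0..1} x * (indicator (ball 0 r) v * ennreal (norm (f (w + ?e x *s v)))) \<partial>lborel)" for v
  proof (cases "v \<in> ball 0 r")
    case True
    define T where "T = {c :: complex. norm c * norm v < r}"
    have "open T" unfolding T_def by (intro open_Collect_less continuous_intros)
    have "w + c *s v \<in> unit_ball" if "c \<in> T" for c
    proof -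
      have "w + c *s v \<in> ball w r" using that by (simp add: T_def dist_norm norm_smult_vec)
      then show ?thesis using sub by blast
    qed
    then have g: "(\<lambda>c. f (w + c *s v)) holomorphic_on T"
      by (rule chol_slice_holomorphic[OF holomorphic_ball_chol[OF f] \<open>open T\<close>])
    have "cball 0 1 \<subseteq> T"
    proof
      fix c :: complex assume "c \<in> cball 0 1"
      then have "norm c * norm v \<le> 1 * norm v" by (intro mult_right_mono) auto
      then show "c \<in> T" using True by (simp add: T_def)
    qed
    from circle_mean_bound[OF g this] show ?thesis using True by simp
  qed simp
  have "ennreal (norm (f w)) * emeasure lborel (ball w r) = (\<integral>\<^sup>+v. indicator (ball (0 :: complex ^ 'n) r) v * ennreal (norm (f w)) \<partial>lborel)"
  proof -
    have "(\<integral>\<^sup>+v. indicator (ball (0 :: complex ^ 'n) r) v * ennreal (norm (f w)) \<partial>lborel) = (\<integral>\<^sup>+v. indicator (ball (0 :: complex ^ 'n) r) v \<partial>lborel) * ennreal (norm (f w))"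
      by (rule nn_integral_multc, rule borel_measurable_indicator) simp
    also have "\<dots> = emeasure lborel (ball w r) * ennreal (norm (f w))" using r by (simp add: emeasure_ball)
    finally show ?thesis unfolding mult.commute[of "ennreal (norm (f w))"] by (rule sym)
  qed
  also have "\<dots> \<le> (\<integral>\<^sup>+v. \<integral>\<^sup>+x. indicator {0..1} x * (indicator (ball 0 r) v * ennreal (norm (f (w + ?e x *s v)))) \<partial>lborel \<partial>lborel)"
    by (rule nn_integral_mono) (rule pt)
  also have "\<dots> = (\<integral>\<^sup>+x. \<integral>\<^sup>+v. indicator {0..1} x * (indicator (ball 0 r) v * ennreal (norm (f (w + ?e x *s v)))) \<partial>lborel \<partial>lborel)"
    by (rule lborel_pair.Fubini') measurable
  also have "\<dots> = (\<integral>\<^sup>+x. indicator {0..1::real} x * (\<integral>\<^sup>+u. indicator (ball w r) u * ennreal (norm (f u)) \<partial>lborel) \<partial>lborel)"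
  proof (rule nn_integral_cong)
    fix x :: real
    let ?h = "\<lambda>v. indicator (ball 0 r) v * ennreal (norm (f (w + v)))"
    have [measurable]: "(\<lambda>v. w + ?e x *s v) \<in> borel_measurable borel"
      by (intro borel_measurable_continuous_onI continuous_intros)
    have "(\<integral>\<^sup>+v. indicator {0..1} x * (indicator (ball 0 r) v * ennreal (norm (f (w + ?e x *s v)))) \<partial>lborel)
        = indicator {0..1} x * (\<integral>\<^sup>+v. indicator (ball 0 r) v * ennreal (norm (f (w + ?e x *s v))) \<partial>lborel)"
      by (rule nn_integral_cmult) measurable
    also have "(\<integral>\<^sup>+v. indicator (ball 0 r) v * ennreal (norm (f (w + ?e x *s v))) \<partial>lborel) = (\<integral>\<^sup>+v. ?h (?e x *s v) \<partial>lborel)"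
      by (rule nn_integral_cong) (auto simp: indicator_def norm_smult_vec e1)
    also have "\<dots> = (\<integral>\<^sup>+v. ?h v \<partial>lborel)" by (rule nn_integral_unimodular[OF _ e1]) measurable
    also have "\<dots> = (\<integral>\<^sup>+v. indicator (ball w r) (w + v) * ennreal (norm (f (w + v))) \<partial>lborel)"
      by (rule nn_integral_cong) (auto simp: indicator_def dist_norm)
    also have "\<dots> = (\<integral>\<^sup>+u. indicator (ball w r) u * ennreal (norm (f u)) \<partial>lborel)"
      by (rule nn_integral_translate[where h="\<lambda>u. indicator (ball w r) u * ennreal (norm (f u))"]) measurable
    finally show "(\<integral>\<^sup>+v. indicator {0..1} x * (indicator (ball 0 r) v * ennreal (norm (f (w + ?e x *s v)))) \<partial>lborel)
       = indicator {0..1} x * (\<integral>\<^sup>+u. indicator (ball w r) u * ennreal (norm (f u)) \<partial>lborel)" .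
  qed
  also have "\<dots> = (\<integral>\<^sup>+u. indicator (ball w r) u * ennreal (norm (f u)) \<partial>lborel)"
    by (subst nn_integral_multc) auto
  finally show ?thesis .
qed (simp add: ball_empty)

abbreviation ball_integral :: "real \<Rightarrow> (complex ^ 'n \<Rightarrow> complex) \<Rightarrow> complex ^ 'n \<Rightarrow> real \<Rightarrow> ennreal" where
  "ball_integral p f w r \<equiv> (\<integral>\<^sup>+u. indicator (ball w r) u * ennreal (norm (f u) powr p) \<partial>lborel)"

lemma power_as_powr_inverse:
  assumes "p > 0" "x > 0" shows "(x powr (real d / p)) powr p = x ^ d"
  using assms by (simp add: powr_powr powr_realpow)

text \<open>
For \<open>p \<ge> 1\<close>, splitting at the level \<open>l = |f w| / 2\<close> gives \<open>|f| \<le> l + l^(1-p) |f|^p\<close>, and the first summand is absorbed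
by the left-hand side of the case \<open>p = 1\<close>.

For \<open>p < 1\<close>, let \<open>\<Phi>\<close> be the maximum of \<open>(r - |u - w|)^(D/p) |f u|\<close> on the ball, \<open>D\<close> being the real dimension. On the ball around a
point of maximum of half its distance to the boundary, \<open>|f|\<close> is controlled by \<open>\<Phi>\<close>. There
\<open>|f| = |f|^(1-p) |f|^p\<close>, so the case \<open>p = 1\<close> yields \<open>\<Phi> \<le> C \<Phi>^(1-p) J\<close> with \<open>J\<close> the integral of \<open>|f|^p\<close>; all powers of the
radius cancel.
\<close>

lemma sub_mean_value_powr:
  assumes p: "p > 0"
  shows "\<exists>C\<ge>0. \<forall>f \<in> (holomorphic_ball :: (complex ^ 'n \<Rightarrow> complex) set). \<forall>w r. r > 0 \<and> cball w r \<subseteq> unit_ball \<longrightarrow>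
    ennreal (norm (f w) powr p * r ^ DIM(complex ^ 'n))
      \<le> ennreal C * ball_integral p f w r"
proof -
  let ?D = "DIM(complex ^ 'n)"
  define V where "V = unit_ball_vol (real ?D)"
  have V: "V > 0" by (simp add: V_def)
  have vol: "emeasure lborel (ball w r) = ennreal (V * r ^ ?D)" if "r > 0" for w :: "complex ^ 'n" and r
    using that by (simp add: emeasure_ball V_def)
  have "\<exists>C\<ge>0. \<forall>f \<in> (holomorphic_ball :: (complex ^ 'n \<Rightarrow> complex) set). \<forall>w r J. r > 0 \<and> cball w r \<subseteq> unit_ball \<and> 0 \<le> J \<and>
      ball_integral p f w r = ennreal J \<longrightarrow> norm (f w) powr p * r ^ ?D \<le> C * J"
  proof (cases "p \<ge> 1")
    case p1: True
    show ?thesis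
    proof (intro exI[of _ "2 powr p / V"] conjI ballI allI impI)
      show "0 \<le> 2 powr p / V" using V by simp
      fix f :: "complex ^ 'n \<Rightarrow> complex" and w r J
      assume f: "f \<in> holomorphic_ball" and A: "r > 0 \<and> cball w r \<subseteq> unit_ball \<and> 0 \<le> J \<and>
        ball_integral p f w r = ennreal J"
      note [measurable] = holomorphic_ball_measurable[OF f]
      show "norm (f w) powr p * r ^ ?D \<le> 2 powr p / V * J"
      proof (cases "f w = 0")
        case False
        \<comment> \<open>level at which \<open>|f|\<close> is split\<close>
        define l where "l = norm (f w) / 2"
        have l: "l > 0" using False by (simp add: l_def)
        have pt: "norm (f u) \<le> l + l powr (1 - p) * norm (f u) powr p" for u
        proof (cases "norm (f u) \<le> l")
          case True
          then show ?thesis by (simp add: add_increasing2)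
        next
          case False
          then have "norm (f u) powr (1 - p) \<le> l powr (1 - p)" using p1 l by (intro powr_mono2') auto
          then have "norm (f u) powr (1 - p) * norm (f u) powr p \<le> l powr (1 - p) * norm (f u) powr p"
            by (intro mult_right_mono) auto
          moreover have "norm (f u) powr (1 - p) * norm (f u) powr p = norm (f u)"
            using False l by (simp flip: powr_add)
          ultimately show ?thesis using l by linarith
        qed
        have sub: "ball w r \<subseteq> unit_ball" using A ball_subset_cball by blast
        have "ennreal (2 * l * (V * r ^ ?D)) = ennreal (norm (f w)) * emeasure lborel (ball w r)"
          using A V by (simp add: vol ennreal_mult l_def)
        also have "\<dots> \<le> (\<integral>\<^sup>+u. indicator (ball w r) u * ennreal (norm (f u)) \<partial>lborel)"
          by (rule sub_mean_value[OF f sub])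
        also have "\<dots> \<le> (\<integral>\<^sup>+u. ennreal l * indicator (ball w r) u + ennreal (l powr (1 - p)) * (indicator (ball w r) u * ennreal (norm (f u) powr p)) \<partial>lborel)"
          by (rule nn_integral_mono) (use pt l in \<open>auto simp: indicator_def simp flip: ennreal_mult ennreal_plus intro!: ennreal_leI\<close>)
        also have "\<dots> = ennreal l * emeasure lborel (ball w r) + ennreal (l powr (1 - p)) * ennreal J"
        proof -
          have [measurable]: "ball w r \<in> sets borel" by simp
          have "(\<integral>\<^sup>+u. ennreal l * indicator (ball w r) u + ennreal (l powr (1 - p)) * (indicator (ball w r) u * ennreal (norm (f u) powr p)) \<partial>lborel)
            = (\<integral>\<^sup>+u. ennreal l * indicator (ball w r) u \<partial>lborel) + (\<integral>\<^sup>+u. ennreal (l powr (1 - p)) * (indicator (ball w r) u * ennreal (norm (f u) powr p)) \<partial>lborel)"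
            by (rule nn_integral_add) measurable
          also have "(\<integral>\<^sup>+u. ennreal l * indicator (ball w r) u \<partial>lborel) = ennreal l * emeasure lborel (ball w r)"
            by (rule nn_integral_cmult_indicator) simp
          also have "(\<integral>\<^sup>+u. ennreal (l powr (1 - p)) * (indicator (ball w r) u * ennreal (norm (f u) powr p)) \<partial>lborel) = ennreal (l powr (1 - p)) * ennreal J"
            using A by (subst nn_integral_cmult) auto
          finally show ?thesis .
        qed
        also have "\<dots> = ennreal (l * (V * r ^ ?D) + l powr (1 - p) * J)"
          using A V l by (simp add: vol flip: ennreal_mult ennreal_plus)
        finally have "2 * l * (V * r ^ ?D) \<le> l * (V * r ^ ?D) + l powr (1 - p) * J"
          using A V l by (subst (asm) ennreal_le_iff) auto
        then have "l * (V * r ^ ?D) \<le> l powr (1 - p) * J" by linarith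
        then have "l powr (p - 1) * (l * (V * r ^ ?D)) \<le> l powr (p - 1) * (l powr (1 - p) * J)"
          by (intro mult_left_mono) auto
        moreover have "l powr (p - 1) * l = l powr p" using l by (simp add: powr_diff)
        moreover have "l powr (p - 1) * l powr (1 - p) = 1" using l by (simp flip: powr_add)
        ultimately have "l powr p * (V * r ^ ?D) \<le> J" by (metis mult.assoc mult_1)
        moreover have "norm (f w) powr p = 2 powr p * l powr p" using l by (simp add: l_def flip: powr_mult)
        ultimately show ?thesis using V by (simp add: field_simps)
      qed (use A V in simp)
    qed
  next
    case p1: False
    let ?e = "real ?D / p"
    show ?thesis
    proof (intro exI[of _ "2 powr ?e / V"] conjI ballI allI impI)
      show "0 \<le> 2 powr ?e / V" using V by simp
      fix f :: "complex ^ 'n \<Rightarrow> complex" and w r J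
      assume f: "f \<in> holomorphic_ball" and A: "r > 0 \<and> cball w r \<subseteq> unit_ball \<and> 0 \<le> J \<and>
        ball_integral p f w r = ennreal J"
      note [measurable] = holomorphic_ball_measurable[OF f]
      define \<phi> where "\<phi> = (\<lambda>u. (r - dist w u) powr ?e * norm (f u))"
      have e: "?e > 0" using p by simp
      have "continuous_on (cball w r) \<phi>" unfolding \<phi>_def
        by (intro continuous_intros continuous_on_powr' continuous_on_subset[OF chol_on_continuous_on[OF holomorphic_ball_chol[OF f]]])
           (use A e in auto)
      moreover have "compact (cball w r)" "cball w r \<noteq> {}" using A by auto
      ultimately obtain u0 where u0: "u0 \<in> cball w r" "\<And>u. u \<in> cball w r \<Longrightarrow> \<phi> u \<le> \<phi> u0"
        using continuous_attains_sup[of "cball w r" \<phi>] by blast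
      define \<Phi> where "\<Phi> = \<phi> u0"
      have w: "r powr ?e * norm (f w) \<le> \<Phi>" using u0(2)[of w] A by (simp add: \<phi>_def \<Phi>_def)
      have "\<Phi> \<ge> 0" by (simp add: \<Phi>_def \<phi>_def)
      show "norm (f w) powr p * r ^ ?D \<le> 2 powr ?e / V * J"
      proof (cases "\<Phi> = 0")
        case True
        then have "f w = 0" using w A by (auto simp: mult_le_0_iff)
        then show ?thesis using A V by simp
      next
        case False
        then have \<Phi>: "\<Phi> > 0" using \<open>\<Phi> \<ge> 0\<close> by simp
        \<comment> \<open>half the distance of the maximum point to the boundary\<close>
        define h where "h = (r - dist w u0) / 2"
        have h: "h > 0"
        proof -
          have "r - dist w u0 \<noteq> 0" using \<Phi> by (auto simp: \<Phi>_def \<phi>_def)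
          then show ?thesis using u0(1) by (simp add: h_def)
        qed
        have inb: "u \<in> cball w r \<and> h \<le> r - dist w u" if "u \<in> ball u0 h" for u
        proof -
          have "dist w u \<le> dist w u0 + dist u0 u" by (rule dist_triangle)
          then show ?thesis using that h by (simp add: h_def field_simps)
        qed
        have fb: "norm (f u) \<le> \<Phi> * h powr - ?e" if "u \<in> ball u0 h" for u
        proof -
          have "h powr ?e * norm (f u) \<le> (r - dist w u) powr ?e * norm (f u)"
            using inb[OF that] h e by (intro mult_right_mono powr_mono2) auto
          also have "\<dots> \<le> \<Phi>" using u0(2)[of u] inb[OF that] by (simp add: \<phi>_def \<Phi>_def)
          finally show ?thesis using h by (simp add: powr_minus field_simps)
        qed
        let ?M = "\<Phi> * h powr - ?e"
        have pt: "norm (f u) \<le> ?M powr (1 - p) * norm (f u) powr p" if "u \<in> ball u0 h" for u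
        proof (cases "f u = 0")
          case False
          have "norm (f u) = norm (f u) powr (1 - p) * norm (f u) powr p" using False by (simp flip: powr_add)
          also have "\<dots> \<le> ?M powr (1 - p) * norm (f u) powr p"
            using fb[OF that] p1 by (intro mult_right_mono powr_mono2) auto
          finally show ?thesis .
        qed simp
        have sub: "ball u0 h \<subseteq> ball w r" using inb h by fastforce
        then have sub': "ball u0 h \<subseteq> unit_ball" using A ball_subset_cball by blast
        have "ennreal (norm (f u0) * (V * h ^ ?D)) = ennreal (norm (f u0)) * emeasure lborel (ball u0 h)"
          using h V by (simp add: vol ennreal_mult)
        also have "\<dots> \<le> (\<integral>\<^sup>+u. indicator (ball u0 h) u * ennreal (norm (f u)) \<partial>lborel)"
          by (rule sub_mean_value[OF f sub'])
        also have "\<dots> \<le> (\<integral>\<^sup>+u. ennreal (?M powr (1 - p)) * (indicator (ball w r) u * ennreal (norm (f u) powr p)) \<partial>lborel)"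
        proof (rule nn_integral_mono)
          fix u
          show "indicator (ball u0 h) u * ennreal (norm (f u)) \<le> ennreal (?M powr (1 - p)) * (indicator (ball w r) u * ennreal (norm (f u) powr p))"
          proof (cases "u \<in> ball u0 h")
            case True
            then have "u \<in> ball w r" using sub by blast
            then show ?thesis using True pt[OF True] by (simp flip: ennreal_mult)
          qed simp
        qed
        also have "\<dots> = ennreal (?M powr (1 - p) * J)"
        proof -
          have [measurable]: "ball w r \<in> sets borel" by simp
          have m: "(\<lambda>u. indicator (ball w r) u * ennreal (norm (f u) powr p)) \<in> borel_measurable lborel" by measurable
          have "(\<integral>\<^sup>+u. ennreal (?M powr (1 - p)) * (indicator (ball w r) u * ennreal (norm (f u) powr p)) \<partial>lborel) = ennreal (?M powr (1 - p)) * ennreal J"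
            using A nn_integral_cmult[OF m, of "ennreal (?M powr (1 - p))"] by simp
          then show ?thesis using A by (simp only: ennreal_mult powr_ge_zero)
        qed
        finally have "norm (f u0) * (V * h ^ ?D) \<le> ?M powr (1 - p) * J"
          using A by (subst (asm) ennreal_le_iff) auto
        moreover have "norm (f u0) = \<Phi> * 2 powr - ?e * h powr - ?e"
        proof -
          have "2 * h = r - dist w u0" by (simp add: h_def)
          then have "\<Phi> = (2 * h) powr ?e * norm (f u0)" by (simp only: \<Phi>_def \<phi>_def)
          then show ?thesis using h by (simp add: powr_mult powr_minus field_simps)
        qed
        moreover have "?M powr (1 - p) = \<Phi> powr (1 - p) * (h powr - ?e * h ^ ?D)"
        proof -
          have "- ?e * (1 - p) = - ?e + real ?D" using p by (simp add: field_simps)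
          then have "(h powr - ?e) powr (1 - p) = h powr - ?e * h ^ ?D"
            by (simp only: powr_powr powr_add powr_realpow[OF h])
          then show ?thesis using \<Phi> by (simp only: powr_mult less_imp_le powr_ge_zero)
        qed
        ultimately have "(\<Phi> * 2 powr - ?e * V) * (h powr - ?e * h ^ ?D) \<le> (\<Phi> powr (1 - p) * J) * (h powr - ?e * h ^ ?D)"
          by (simp only: mult_ac)
        then have "\<Phi> * 2 powr - ?e * V \<le> \<Phi> powr (1 - p) * J" using h by (simp add: mult_le_cancel_right)
        then have "\<Phi> powr (p - 1) * (\<Phi> * 2 powr - ?e * V) \<le> \<Phi> powr (p - 1) * (\<Phi> powr (1 - p) * J)"
          by (intro mult_left_mono) auto
        moreover have "\<Phi> powr (p - 1) * \<Phi> = \<Phi> powr p" using \<Phi> by (simp add: powr_diff)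
        moreover have "\<Phi> powr (p - 1) * \<Phi> powr (1 - p) = 1" using \<Phi> by (simp flip: powr_add)
        ultimately have "\<Phi> powr p * (2 powr - ?e * V) \<le> J" by (metis mult.assoc mult_1)
        then have "\<Phi> powr p \<le> 2 powr ?e / V * J" using V by (simp add: powr_minus field_simps)
        moreover have "norm (f w) powr p * r ^ ?D \<le> \<Phi> powr p"
        proof -
          have rr: "(r powr ?e) powr p = r ^ ?D" by (rule power_as_powr_inverse) (use p A in auto)
          have "norm (f w) powr p * r ^ ?D = (r powr ?e) powr p * norm (f w) powr p" unfolding rr by (rule mult.commute)
          also have "\<dots> = (r powr ?e * norm (f w)) powr p" by (rule powr_mult[symmetric])
          also have "\<dots> \<le> \<Phi> powr p" using w p by (intro powr_mono2) auto
          finally show ?thesis .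
        qed
        ultimately show ?thesis by linarith
      qed
    qed
  qed
  then obtain C where C: "C \<ge> 0" "\<And>(f :: complex ^ 'n \<Rightarrow> complex) w r J. f \<in> holomorphic_ball \<Longrightarrow> r > 0 \<Longrightarrow> cball w r \<subseteq> unit_ball \<Longrightarrow> 0 \<le> J \<Longrightarrow>
      ball_integral p f w r = ennreal J \<Longrightarrow> norm (f w) powr p * r ^ ?D \<le> C * J"
    by blast
  show ?thesis
  proof (intro exI[of _ "C + 1"] conjI ballI allI impI)
    show "0 \<le> C + 1" using C(1) by simp
    fix f :: "complex ^ 'n \<Rightarrow> complex" and w :: "complex ^ 'n" and r
    assume f: "f \<in> holomorphic_ball" and A: "r > 0 \<and> cball w r \<subseteq> unit_ball"
    let ?I = "ball_integral p f w r"
    show "ennreal (norm (f w) powr p * r ^ ?D) \<le> ennreal (C + 1) * ?I"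
    proof (cases "?I = top")
      case True
      have "ennreal (C + 1) \<noteq> 0" using C(1) by (simp add: ennreal_eq_0_iff)
      then show ?thesis unfolding True by (simp add: ennreal_mult_top)
    next
      case False
      then obtain J where J: "0 \<le> J" "?I = ennreal J" by (cases ?I) auto
      have "norm (f w) powr p * r ^ ?D \<le> C * J" using C(2)[OF f _ _ J] A by blast
      also have "\<dots> \<le> (C + 1) * J" using J by (intro mult_right_mono) auto
      finally have "ennreal (norm (f w) powr p * r ^ ?D) \<le> ennreal ((C + 1) * J)" by (rule ennreal_leI)
      also have "\<dots> = ennreal (C + 1) * ?I" unfolding J(2) using C(1) J(1) by (intro ennreal_mult) auto
      finally show ?thesis .
    qed
  qed
qed

section \<open>Averages over Whitney balls\<close>

lemma powr_comparable:
  fixes x y b :: real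
  assumes "0 < x" "x \<le> 4 * y" "y \<le> 4 * x"
  shows "y powr b \<le> 4 powr \<bar>b\<bar> * x powr b"
proof -
  have y: "y > 0" using assms by linarith
  have "(y / x) powr b \<le> 4 powr \<bar>b\<bar>"
  proof (cases "b \<ge> 0")
    case True
    then show ?thesis using assms y by (auto intro!: powr_mono2 simp: field_simps)
  next
    case False
    have "(y / x) powr b = (x / y) powr (- b)" using assms(1) y by (simp add: powr_divide powr_minus field_simps)
    also have "\<dots> \<le> 4 powr (- b)" using assms y False by (intro powr_mono2) (auto simp: field_simps)
    finally show ?thesis using False by simp
  qed
  then show ?thesis using assms(1) y by (simp add: powr_divide field_simps)
qed

lemma powr_diff_nat: "0 < x \<Longrightarrow> x powr (b - real k) = x powr b / x ^ k" for x :: real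
  by (simp add: powr_diff powr_realpow)

definition weighted_integral :: "real \<Rightarrow> real \<Rightarrow> (complex ^ 'n \<Rightarrow> complex) \<Rightarrow> ennreal" where
  "weighted_integral p b f = (\<integral>\<^sup>+z. indicator unit_ball z * ennreal ((1 - norm z) powr b * norm (f z) powr p) \<partial>lborel)"

text \<open>
The average, up to a constant, of \<open>|f|^p\<close> over a ball around \<open>z\<close> that stays away from the unit sphere by a
fixed fraction of \<open>1 - |z|\<close>.
\<close>

definition whitney_average :: "real \<Rightarrow> (complex ^ 'n \<Rightarrow> complex) \<Rightarrow> complex ^ 'n \<Rightarrow> ennreal" where
  "whitney_average p f z = ennreal (1 / (1 - norm z) ^ DIM(complex ^ 'n)) *
     (\<integral>\<^sup>+u. indicator {u. dist z u < 3/4 * (1 - norm z)} u * ennreal (norm (f u) powr p) \<partial>lborel)"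

lemma whitney_average_measurable:
  fixes f :: "complex ^ 'n \<Rightarrow> complex"
  assumes [measurable]: "f \<in> borel_measurable borel"
  shows "whitney_average p f \<in> borel_measurable borel"
proof -
  have [measurable]: "{x :: (complex ^ 'n) \<times> (complex ^ 'n). dist (fst x) (snd x) < 3/4 * (1 - norm (fst x))} \<in> sets (borel \<Otimes>\<^sub>M borel)"
    unfolding borel_prod by (intro borel_open open_Collect_less continuous_intros)
  have "(\<lambda>x :: (complex ^ 'n) \<times> (complex ^ 'n). indicator {x. dist (fst x) (snd x) < 3/4 * (1 - norm (fst x))} x * ennreal (norm (f (snd x)) powr p))
      \<in> borel_measurable (borel \<Otimes>\<^sub>M borel)"
    by measurable
  also have "(\<lambda>x :: (complex ^ 'n) \<times> (complex ^ 'n). indicator {x. dist (fst x) (snd x) < 3/4 * (1 - norm (fst x))} x * ennreal (norm (f (snd x)) powr p))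
      = (\<lambda>(z, u). indicator {u. dist z u < 3/4 * (1 - norm z)} u * ennreal (norm (f u) powr p))"
    by (auto simp: fun_eq_iff indicator_def)
  finally have "(\<lambda>(z, u). indicator {u. dist z u < 3/4 * (1 - norm z)} u * ennreal (norm (f u) powr p)) \<in> borel_measurable (borel \<Otimes>\<^sub>M lborel)"
    by (simp cong: measurable_cong_sets sets_pair_measure_cong)
  then have [measurable]: "(\<lambda>z. \<integral>\<^sup>+u. indicator {u. dist z u < 3/4 * (1 - norm z)} u * ennreal (norm (f u) powr p) \<partial>lborel) \<in> borel_measurable borel"
    by (rule lborel.borel_measurable_nn_integral)
  show ?thesis unfolding whitney_average_def[abs_def] by measurable
qed

text \<open>
The ball of radius \<open>(1 - |z|) / 4\<close> around \<open>w\<close> lies in the ball over which the average at \<open>z\<close> is taken.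
\<close>

lemma pointwise_le_whitney_average:
  assumes p: "p > 0"
  shows "\<exists>C\<ge>0. \<forall>f \<in> (holomorphic_ball :: (complex ^ 'n \<Rightarrow> complex) set). \<forall>z\<in>unit_ball. \<forall>w. dist z w \<le> (1 - norm z) / 2 \<longrightarrow>
    ennreal (norm (f w) powr p) \<le> ennreal C * whitney_average p f z"
proof -
  let ?D = "DIM(complex ^ 'n)"
  obtain C where C: "C \<ge> 0" "\<And>(f :: complex ^ 'n \<Rightarrow> complex) w r. f \<in> holomorphic_ball \<Longrightarrow> r > 0 \<Longrightarrow> cball w r \<subseteq> unit_ball \<Longrightarrow>
      ennreal (norm (f w) powr p * r ^ ?D) \<le> ennreal C * ball_integral p f w r"
    using sub_mean_value_powr[OF p] by blast
  show ?thesis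
  proof (intro exI[of _ "C * 4 ^ ?D"] conjI ballI allI impI)
    show "0 \<le> C * 4 ^ ?D" using C by simp
    fix f :: "complex ^ 'n \<Rightarrow> complex" and z w :: "complex ^ 'n"
    assume f: "f \<in> holomorphic_ball" and z: "z \<in> unit_ball" and w: "dist z w \<le> (1 - norm z) / 2"
    let ?d = "1 - norm z"
    let ?I = "\<integral>\<^sup>+u. indicator {u. dist z u < 3/4 * ?d} u * ennreal (norm (f u) powr p) \<partial>lborel"
    have d: "?d > 0" using z by simp
    have sub: "u \<in> unit_ball" if "u \<in> cball w (?d / 4)" for u
    proof -
      have "norm u \<le> norm z + dist z w + dist w u"
        using norm_triangle_ineq2[of u z] dist_triangle[of z u w] by (simp add: dist_norm norm_minus_commute)
      then show ?thesis using that w d by simp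
    qed
    have sub2: "dist z u < 3/4 * ?d" if "u \<in> ball w (?d / 4)" for u
      using that w dist_triangle[of z u w] by simp
    have "ennreal (norm (f w) powr p) = ennreal (4 ^ ?D / ?d ^ ?D) * ennreal (norm (f w) powr p * (?d / 4) ^ ?D)"
      using d by (simp add: power_divide flip: ennreal_mult)
    also have "ennreal (norm (f w) powr p * (?d / 4) ^ ?D) \<le> ennreal C * (\<integral>\<^sup>+u. indicator (ball w (?d / 4)) u * ennreal (norm (f u) powr p) \<partial>lborel)"
      by (rule C(2)[OF f]) (use d sub in auto)
    also have "(\<integral>\<^sup>+u. indicator (ball w (?d / 4)) u * ennreal (norm (f u) powr p) \<partial>lborel) \<le> ?I"
      by (rule nn_integral_mono, rule mult_right_mono) (use sub2 in \<open>auto simp: indicator_def\<close>)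
    finally have "ennreal (norm (f w) powr p) \<le> ennreal (4 ^ ?D / ?d ^ ?D) * (ennreal C * ?I)"
      by (simp add: mult_left_mono)
    also have "ennreal (4 ^ ?D / ?d ^ ?D) = ennreal (4 ^ ?D) * ennreal (1 / ?d ^ ?D)"
      using d by (simp flip: ennreal_mult)
    also have "\<dots> * (ennreal C * ?I) = ennreal (C * 4 ^ ?D) * (ennreal (1 / ?d ^ ?D) * ?I)"
      using C(1) by (simp add: ennreal_mult mult_ac)
    finally show "ennreal (norm (f w) powr p) \<le> ennreal (C * 4 ^ ?D) * whitney_average p f z"
      unfolding whitney_average_def .
  qed
qed

lemma emeasure_ball_scale:
  "r \<ge> 0 \<Longrightarrow> emeasure lborel (ball (w :: 'a::euclidean_space) r) = ennreal (unit_ball_vol (real DIM('a)) * r ^ DIM('a))"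
  by (simp add: emeasure_ball)

text \<open>
After exchanging the integrals, the inner one runs over those \<open>z\<close> whose Whitney ball contains \<open>u\<close>. For them
\<open>1 - |z|\<close> and \<open>1 - |u|\<close> are comparable, and they lie in a ball of radius \<open>3 (1 - |u|)\<close> around \<open>u\<close>, so the
normalizing factor of the average cancels.
\<close>

lemma integral_whitney_average_le:
  "\<exists>C\<ge>0. \<forall>f \<in> borel_measurable borel.
    (\<integral>\<^sup>+z. indicator unit_ball z * (ennreal ((1 - norm z) powr b) * whitney_average p f z) \<partial>lborel)
     \<le> ennreal C * weighted_integral p b (f :: complex ^ 'n \<Rightarrow> complex)"
proof -
  let ?D = "DIM(complex ^ 'n)"
  define V where "V = unit_ball_vol (real ?D)"
  define K where "K = 4 powr \<bar>b - real ?D\<bar>"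
  have V: "V > 0" by (simp add: V_def)
  have K: "K \<ge> 0" by (simp add: K_def)
  let ?C = "K * V * 3 ^ ?D"
  show ?thesis
  proof (intro exI[of _ ?C] conjI ballI)
    show "0 \<le> ?C" using K V by simp
    fix f :: "complex ^ 'n \<Rightarrow> complex" assume [measurable]: "f \<in> borel_measurable borel"
    let ?R = "{x :: (complex ^ 'n) \<times> (complex ^ 'n). norm (fst x) < 1 \<and> dist (fst x) (snd x) < 3/4 * (1 - norm (fst x))}"
    let ?F = "\<lambda>z u. indicator ?R (z, u) * (ennreal ((1 - norm z) powr (b - real ?D)) * ennreal (norm (f u) powr p))"
    have [measurable]: "?R \<in> sets (borel \<Otimes>\<^sub>M borel)"
      unfolding borel_prod by (intro borel_open open_Collect_conj open_Collect_less continuous_intros)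
    have [measurable]: "unit_ball \<in> sets (borel :: (complex ^ 'n) measure)" by simp
    have meas: "(\<lambda>(z, u). ?F z u) \<in> borel_measurable (lborel \<Otimes>\<^sub>M lborel)" by measurable
    have [measurable]: "{u. dist z u < 3/4 * (1 - norm z)} \<in> sets borel" for z :: "complex ^ 'n"
      by (intro borel_open open_Collect_less continuous_intros)
    have "(\<integral>\<^sup>+z. indicator unit_ball z * (ennreal ((1 - norm z) powr b) * whitney_average p f z) \<partial>lborel) = (\<integral>\<^sup>+z. \<integral>\<^sup>+u. ?F z u \<partial>lborel \<partial>lborel)"
    proof (rule nn_integral_cong)
      fix z :: "complex ^ 'n"
      show "indicator unit_ball z * (ennreal ((1 - norm z) powr b) * whitney_average p f z) = (\<integral>\<^sup>+u. ?F z u \<partial>lborel)"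
      proof (cases "z \<in> unit_ball")
        case True
        then have d: "1 - norm z > 0" by simp
        have "(1 - norm z) powr b * (1 / (1 - norm z) ^ ?D) = (1 - norm z) powr (b - real ?D)"
          unfolding powr_diff_nat[OF d] by simp
        then have eq: "ennreal ((1 - norm z) powr b) * ennreal (1 / (1 - norm z) ^ ?D) = ennreal ((1 - norm z) powr (b - real ?D))"
          using d by (subst ennreal_mult[symmetric]) auto
        have "(\<integral>\<^sup>+u. ?F z u \<partial>lborel) = (\<integral>\<^sup>+u. ennreal ((1 - norm z) powr (b - real ?D)) * (indicator {u. dist z u < 3/4 * (1 - norm z)} u * ennreal (norm (f u) powr p)) \<partial>lborel)"
          by (rule nn_integral_cong) (use True in \<open>auto simp: indicator_def\<close>)
        also have "\<dots> = ennreal ((1 - norm z) powr (b - real ?D)) * (\<integral>\<^sup>+u. indicator {u. dist z u < 3/4 * (1 - norm z)} u * ennreal (norm (f u) powr p) \<partial>lborel)"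
          by (rule nn_integral_cmult) measurable
        also have "\<dots> = ennreal ((1 - norm z) powr b) * whitney_average p f z"
          unfolding whitney_average_def eq[symmetric] by (simp only: mult.assoc)
        finally show ?thesis using True by simp
      qed (simp add: indicator_def)
    qed
    also have "\<dots> = (\<integral>\<^sup>+u. \<integral>\<^sup>+z. ?F z u \<partial>lborel \<partial>lborel)"
      by (rule lborel_pair.Fubini'[OF meas, symmetric])
    also have "\<dots> \<le> (\<integral>\<^sup>+u. ennreal ?C * (indicator unit_ball u * ennreal ((1 - norm u) powr b * norm (f u) powr p)) \<partial>lborel)"
    proof (rule nn_integral_mono)
      fix u :: "complex ^ 'n"
      let ?d = "1 - norm u"
      have geo: "norm u < 1 \<and> 1 - norm z \<le> 4 * ?d \<and> ?d \<le> 4 * (1 - norm z) \<and> dist u z < 3 * ?d" if "(z, u) \<in> ?R" for z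
      proof -
        have 1: "norm z < 1" "dist z u < 3/4 * (1 - norm z)" using that by auto
        have 2: "norm u \<le> norm z + dist z u" "norm z \<le> norm u + dist z u"
          using norm_triangle_ineq2[of u z] norm_triangle_ineq2[of z u] by (simp_all add: dist_norm norm_minus_commute)
        show ?thesis using 1 2 by (simp add: dist_commute)
      qed
      show "(\<integral>\<^sup>+z. ?F z u \<partial>lborel) \<le> ennreal ?C * (indicator unit_ball u * ennreal ((1 - norm u) powr b * norm (f u) powr p))"
      proof (cases "u \<in> unit_ball")
        case True
        then have d: "?d > 0" by simp
        let ?k = "ennreal (K * ?d powr (b - real ?D)) * ennreal (norm (f u) powr p)"
        have "(\<integral>\<^sup>+z. ?F z u \<partial>lborel) \<le> (\<integral>\<^sup>+z. ?k * indicator (ball u (3 * ?d)) z \<partial>lborel)"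
        proof (rule nn_integral_mono)
          fix z
          show "?F z u \<le> ?k * indicator (ball u (3 * ?d)) z"
          proof (cases "(z, u) \<in> ?R")
            case R: True
            have "(1 - norm z) powr (b - real ?D) \<le> K * ?d powr (b - real ?D)"
              unfolding K_def using geo[OF R] d by (intro powr_comparable) auto
            then show ?thesis using R geo[OF R] by (simp add: mult_right_mono ennreal_leI)
          qed simp
        qed
        also have "\<dots> = ?k * emeasure lborel (ball u (3 * ?d))" by (rule nn_integral_cmult_indicator) simp
        also have "emeasure lborel (ball u (3 * ?d)) = ennreal (V * (3 * ?d) ^ ?D)"
          unfolding V_def using d by (intro emeasure_ball_scale) simp
        also have "?k * ennreal (V * (3 * ?d) ^ ?D) = ennreal (?C * (?d powr b * norm (f u) powr p))"
        proof -
          have "?d powr (b - real ?D) * ?d ^ ?D = ?d powr b" unfolding powr_diff_nat[OF d] using d by simp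
          moreover have "K * ?d powr (b - real ?D) * norm (f u) powr p * (V * (3 * ?d) ^ ?D)
              = ?C * ((?d powr (b - real ?D) * ?d ^ ?D) * norm (f u) powr p)"
            unfolding power_mult_distrib by (simp only: mult_ac)
          ultimately have "K * ?d powr (b - real ?D) * norm (f u) powr p * (V * (3 * ?d) ^ ?D) = ?C * (?d powr b * norm (f u) powr p)"
            by (simp only:)
          then show ?thesis using K V d by (simp only: ennreal_mult[symmetric] powr_ge_zero mult_nonneg_nonneg zero_le_power zero_le_numeral less_imp_le)
        qed
        finally show ?thesis using True K V by (simp add: ennreal_mult)
      next
        case False
        have "?F z u = 0" for z
        proof -
          have "(z, u) \<notin> ?R" using geo[of z] False by auto
          then show ?thesis by (simp only: indicator_simps mult_zero_left not_False_eq_True)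
        qed
        then have "(\<integral>\<^sup>+z. ?F z u \<partial>lborel) = (\<integral>\<^sup>+(z::complex ^ 'n). 0 \<partial>lborel)" by (intro nn_integral_cong) blast
        then show ?thesis by (simp only: nn_integral_const mult_zero_left zero_le)
      qed
    qed
    also have "\<dots> = ennreal ?C * weighted_integral p b f"
      unfolding weighted_integral_def by (rule nn_integral_cmult) measurable
    finally show "(\<integral>\<^sup>+z. indicator unit_ball z * (ennreal ((1 - norm z) powr b) * whitney_average p f z) \<partial>lborel) \<le> ennreal ?C * weighted_integral p b f" .
  qed
qed

section \<open>Integration along rays\<close>

lemma nn_integral_scale:
  fixes G :: "'a::euclidean_space \<Rightarrow> ennreal"
  assumes [measurable]: "G \<in> borel_measurable borel" and x: "x > 0"
  shows "(\<integral>\<^sup>+z. G (x *\<^sub>R z) \<partial>lborel) = ennreal (1 / x ^ DIM('a)) * (\<integral>\<^sup>+u. G u \<partial>lborel)"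
proof -
  have "(\<integral>\<^sup>+u. G u \<partial>lborel) = (\<integral>\<^sup>+u. G u \<partial>density (distr lborel borel (\<lambda>z. 0 + x *\<^sub>R z)) (\<lambda>_. ennreal (\<bar>x\<bar> ^ DIM('a))))"
    using lborel_affine[of x "0::'a"] x by simp
  also have "\<dots> = ennreal (x ^ DIM('a)) * (\<integral>\<^sup>+z. G (x *\<^sub>R z) \<partial>lborel)"
    using x by (simp add: nn_integral_density nn_integral_distr nn_integral_cmult)
  finally have "ennreal (1 / x ^ DIM('a)) * (\<integral>\<^sup>+u. G u \<partial>lborel) = (ennreal (1 / x ^ DIM('a)) * ennreal (x ^ DIM('a))) * (\<integral>\<^sup>+z. G (x *\<^sub>R z) \<partial>lborel)"
    by (simp only: mult.assoc)
  also have "ennreal (1 / x ^ DIM('a)) * ennreal (x ^ DIM('a)) = 1"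
    using x by (simp flip: ennreal_mult)
  finally show ?thesis by simp
qed

lemma nn_integral_powr_from_0:
  assumes "b > -1" "c \<ge> 0"
  shows "(\<integral>\<^sup>+x. indicator {0..c} x * ennreal (x powr b) \<partial>lborel) = ennreal (c powr (b + 1) / (b + 1))"
proof -
  have "(\<integral>\<^sup>+x. ennreal (indicator {0..c} x * x powr b) \<partial>lborel) = ennreal (c powr (b + 1) / (b + 1))"
    by (rule nn_integral_has_integral_lebesgue[OF _ has_integral_powr_from_0[OF assms]]) simp
  then show ?thesis by (simp add: ennreal_mult' ennreal_indicator)
qed

lemma nn_integral_powr_to_inf:
  assumes "e < -1" "c > (0::real)"
  shows "(\<integral>\<^sup>+x. indicator {c..} x * ennreal (x powr e) \<partial>lborel) = ennreal (c powr (e + 1) / - (e + 1))"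
proof -
  have "(\<integral>\<^sup>+x. ennreal (indicator {c..} x * x powr e) \<partial>lborel) = ennreal (- (c powr (e + 1)) / (e + 1))"
    by (rule nn_integral_has_integral_lebesgue[OF _ has_integral_powr_to_inf[OF assms]]) simp
  also have "- (c powr (e + 1)) / (e + 1) = c powr (e + 1) / - (e + 1)" by (metis minus_divide_left minus_divide_right)
  finally show ?thesis by (simp add: ennreal_mult' ennreal_indicator)
qed

text \<open>
For fixed \<open>x\<close> the dilation \<open>u = x z\<close> turns the integral over \<open>z\<close> into an integral of \<open>(1 - |u| / x)^b H u\<close> over
\<open>|u| < x\<close>, and the integral of \<open>(x - |u|)^b\<close> over \<open>x\<close> from \<open>|u|\<close> to \<open>1\<close> is \<open>(1 - |u|)^(b+1) / (b+1)\<close>. The lower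
limit \<open>1/4\<close> keeps the powers of \<open>x\<close> bounded.
\<close>

lemma radial_average_le:
  assumes b: "b > -1"
  shows "\<exists>C\<ge>0. \<forall>H \<in> borel_measurable (borel :: (complex ^ 'n) measure).
    (\<integral>\<^sup>+z. indicator unit_ball z * (ennreal ((1 - norm z) powr b) * (\<integral>\<^sup>+x. indicator {1/4..1} x * H (x *\<^sub>R z) \<partial>lborel)) \<partial>lborel)
    \<le> ennreal C * (\<integral>\<^sup>+u. indicator unit_ball u * (ennreal ((1 - norm u) powr (b + 1)) * H u) \<partial>lborel)"
proof -
  let ?D = "DIM(complex ^ 'n)"
  define K where "K = (4 ^ ?D * 4 powr \<bar>b\<bar> :: real)"
  have K: "K \<ge> 0" by (simp add: K_def)
  show ?thesis
  proof (intro exI[of _ "K / (b + 1)"] conjI ballI)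
    show "0 \<le> K / (b + 1)" using K b by simp
    fix H :: "complex ^ 'n \<Rightarrow> ennreal" assume [measurable]: "H \<in> borel_measurable borel"
    let ?F = "\<lambda>z x. indicator unit_ball z * (ennreal ((1 - norm z) powr b) * (indicator {1/4..1} x * H (x *\<^sub>R z)))"
    let ?R = "{y :: (complex ^ 'n) \<times> real. norm (fst y) < snd y}"
    let ?G = "\<lambda>u x. indicator {1/4..1} x * (indicator ?R (u, x) * (ennreal ((x - norm u) powr b) * H u))"
    have [measurable]: "unit_ball \<in> sets (borel :: (complex ^ 'n) measure)" by simp
    have [measurable]: "?R \<in> sets (borel \<Otimes>\<^sub>M borel)"
      unfolding borel_prod by (intro borel_open open_Collect_less continuous_intros)
    have mF: "(\<lambda>(z, x). ?F z x) \<in> borel_measurable (lborel \<Otimes>\<^sub>M lborel)" by measurable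
    have mG: "(\<lambda>(u, x). ?G u x) \<in> borel_measurable (lborel \<Otimes>\<^sub>M lborel)" by measurable
    have mGu: "(\<lambda>u. ?G u x) \<in> borel_measurable lborel" for x
      using measurable_compose[OF measurable_Pair2' mG, of x] by simp
    have "(\<integral>\<^sup>+z. indicator unit_ball z * (ennreal ((1 - norm z) powr b) * (\<integral>\<^sup>+x. indicator {1/4..1} x * H (x *\<^sub>R z) \<partial>lborel)) \<partial>lborel)
      = (\<integral>\<^sup>+z. \<integral>\<^sup>+x. ?F z x \<partial>lborel \<partial>lborel)"
      by (simp add: nn_integral_cmult)
    also have "\<dots> = (\<integral>\<^sup>+x. \<integral>\<^sup>+z. ?F z x \<partial>lborel \<partial>lborel)"
      by (rule lborel_pair.Fubini'[OF mF, symmetric])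
    also have "\<dots> \<le> (\<integral>\<^sup>+x. \<integral>\<^sup>+u. ennreal K * ?G u x \<partial>lborel \<partial>lborel)"
    proof (rule nn_integral_mono)
      fix x :: real
      show "(\<integral>\<^sup>+z. ?F z x \<partial>lborel) \<le> (\<integral>\<^sup>+u. ennreal K * ?G u x \<partial>lborel)"
      proof (cases "x \<in> {1/4..1}")
        case x: True
        let ?P = "\<lambda>u. indicator unit_ball ((1/x) *\<^sub>R u) * (ennreal ((1 - norm u / x) powr b) * H u)"
        have "(\<integral>\<^sup>+z. ?F z x \<partial>lborel) = (\<integral>\<^sup>+z. ?P (x *\<^sub>R z) \<partial>lborel)"
          by (rule nn_integral_cong) (use x in auto)
        also have "\<dots> = ennreal (1 / x ^ ?D) * (\<integral>\<^sup>+u. ?P u \<partial>lborel)"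
          by (rule nn_integral_scale) (use x in auto)
        also have "\<dots> \<le> ennreal (4 ^ ?D) * (\<integral>\<^sup>+u. ennreal (4 powr \<bar>b\<bar>) * ?G u x \<partial>lborel)"
        proof (rule mult_mono[OF _ nn_integral_mono])
          have "(1/4) ^ ?D \<le> x ^ ?D" using x by (intro power_mono) auto
          then have "1 / x ^ ?D \<le> 4 ^ ?D" using x by (simp add: field_simps power_divide)
          then show "ennreal (1 / x ^ ?D) \<le> ennreal (4 ^ ?D)" by (rule ennreal_leI)
          fix u :: "complex ^ 'n"
          show "?P u \<le> ennreal (4 powr \<bar>b\<bar>) * ?G u x"
          proof (cases "norm u < x")
            case True
            have le: "(1 - norm u / x) powr b \<le> 4 powr \<bar>b\<bar> * (x - norm u) powr b"
            proof (rule powr_comparable)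
              have eq: "1 - norm u / x = (x - norm u) / x" using x by (simp add: field_simps)
              have "x * (x - norm u) \<le> 1 * (x - norm u)" using x True by (intro mult_right_mono) auto
              then show "x - norm u \<le> 4 * (1 - norm u / x)" unfolding eq using x True by (simp add: field_simps)
              have "1 * (x - norm u) \<le> (4 * x) * (x - norm u)" using x True by (intro mult_right_mono) auto
              then show "1 - norm u / x \<le> 4 * (x - norm u)" unfolding eq using x True by (simp add: field_simps)
            qed (use True in simp)
            have "?P u = ennreal ((1 - norm u / x) powr b) * H u" using x True by simp
            also have "\<dots> \<le> ennreal (4 powr \<bar>b\<bar> * (x - norm u) powr b) * H u"
              by (intro mult_right_mono ennreal_leI le) simp
            also have "\<dots> = ennreal (4 powr \<bar>b\<bar>) * ?G u x" using x True by (simp add: ennreal_mult mult.assoc)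
            finally show ?thesis .
          next
            case False
            then have "(1/x) *\<^sub>R u \<notin> unit_ball" using x by (simp add: field_simps)
            then show ?thesis by (simp only: indicator_simps mult_zero_left zero_le not_False_eq_True)
          qed
        qed simp_all
        also have "\<dots> = (\<integral>\<^sup>+u. ennreal (4 ^ ?D) * (ennreal (4 powr \<bar>b\<bar>) * ?G u x) \<partial>lborel)"
          by (rule nn_integral_cmult[symmetric]) (rule borel_measurable_times_ennreal[OF borel_measurable_const mGu])
        also have "\<dots> = (\<integral>\<^sup>+u. ennreal K * ?G u x \<partial>lborel)"
          unfolding K_def by (simp only: ennreal_mult zero_le_power zero_le_numeral powr_ge_zero mult.assoc)
        finally show ?thesis .
      next
        case False
        then have "(\<integral>\<^sup>+z. ?F z x \<partial>lborel) = (\<integral>\<^sup>+(z :: complex ^ 'n). 0 \<partial>lborel)"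
          by (intro nn_integral_cong) (simp only: indicator_simps mult_zero_left mult_zero_right not_False_eq_True)
        then show ?thesis by (simp only: nn_integral_const mult_zero_left zero_le)
      qed
    qed
    also have "\<dots> = (\<integral>\<^sup>+u. \<integral>\<^sup>+x. ennreal K * ?G u x \<partial>lborel \<partial>lborel)"
    proof (rule lborel_pair.Fubini')
      have "(\<lambda>y. ennreal K * (case y of (u, x) \<Rightarrow> ?G u x)) \<in> borel_measurable (lborel \<Otimes>\<^sub>M lborel)"
        by (rule borel_measurable_times_ennreal[OF borel_measurable_const mG])
      then show "(\<lambda>(u, x). ennreal K * ?G u x) \<in> borel_measurable (lborel \<Otimes>\<^sub>M lborel)" unfolding case_prod_unfold .
    qed
    also have "\<dots> \<le> (\<integral>\<^sup>+u. ennreal (K / (b + 1)) * (indicator unit_ball u * (ennreal ((1 - norm u) powr (b + 1)) * H u)) \<partial>lborel)"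
    proof (rule nn_integral_mono)
      fix u :: "complex ^ 'n"
      show "(\<integral>\<^sup>+x. ennreal K * ?G u x \<partial>lborel) \<le> ennreal (K / (b + 1)) * (indicator unit_ball u * (ennreal ((1 - norm u) powr (b + 1)) * H u))"
      proof (cases "norm u < 1")
        case True
        let ?g = "\<lambda>x. indicator {0..1 - norm u} x * ennreal (x powr b)"
        have "(\<integral>\<^sup>+x. ennreal K * ?G u x \<partial>lborel) \<le> (\<integral>\<^sup>+x. (ennreal K * H u) * ?g (- norm u + x) \<partial>lborel)"
          by (rule nn_integral_mono) (auto simp: indicator_def mult_ac)
        also have "\<dots> = (ennreal K * H u) * (\<integral>\<^sup>+x. ?g (- norm u + x) \<partial>lborel)"
          by (rule nn_integral_cmult) measurable
        also have "(\<integral>\<^sup>+x. ?g (- norm u + x) \<partial>lborel) = (\<integral>\<^sup>+x. ?g x \<partial>lborel)"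
          by (rule nn_integral_translate[where h="?g"]) measurable
        also have "\<dots> = ennreal ((1 - norm u) powr (b + 1) / (b + 1))"
          by (rule nn_integral_powr_from_0) (use b True in auto)
        also have "(ennreal K * H u) * \<dots> = ennreal (K / (b + 1)) * (ennreal ((1 - norm u) powr (b + 1)) * H u)"
        proof -
          have "ennreal K * ennreal ((1 - norm u) powr (b + 1) / (b + 1)) = ennreal (K / (b + 1)) * ennreal ((1 - norm u) powr (b + 1))"
            using K b by (simp flip: ennreal_mult)
          then show ?thesis by (metis mult.assoc mult.commute)
        qed
        finally show ?thesis using True by simp
      next
        case False
        have "ennreal K * ?G u x = 0" for x
          using False by (auto simp: indicator_def)
        then have "(\<integral>\<^sup>+x. ennreal K * ?G u x \<partial>lborel) = (\<integral>\<^sup>+(x::real). 0 \<partial>lborel)" by (intro nn_integral_cong) blast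
        then show ?thesis by (simp only: nn_integral_const mult_zero_left zero_le)
      qed
    qed
    also have "\<dots> = ennreal (K / (b + 1)) * (\<integral>\<^sup>+u. indicator unit_ball u * (ennreal ((1 - norm u) powr (b + 1)) * H u) \<partial>lborel)"
      by (rule nn_integral_cmult) measurable
    finally show "(\<integral>\<^sup>+z. indicator unit_ball z * (ennreal ((1 - norm z) powr b) * (\<integral>\<^sup>+x. indicator {1/4..1} x * H (x *\<^sub>R z) \<partial>lborel)) \<partial>lborel)
      \<le> ennreal (K / (b + 1)) * (\<integral>\<^sup>+u. indicator unit_ball u * (ennreal ((1 - norm u) powr (b + 1)) * H u) \<partial>lborel)" .
  qed
qed

text \<open>
The preceding estimate for the indicator of the ball of radius \<open>1/2\<close>, whose average along every ray is at
least \<open>1/4\<close>.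
\<close>

lemma radial_weight_integrable:
  assumes b: "b > -1"
  shows "(\<integral>\<^sup>+(z :: complex ^ 'n). indicator unit_ball z * ennreal ((1 - norm z) powr b) \<partial>lborel) < top"
proof -
  let ?H = "indicator (ball (0 :: complex ^ 'n) (1/2)) :: _ \<Rightarrow> ennreal"
  have H: "?H \<in> borel_measurable borel" by (rule borel_measurable_indicator) simp
  obtain C where C: "C \<ge> 0" "(\<integral>\<^sup>+z. indicator unit_ball z * (ennreal ((1 - norm z) powr b) * (\<integral>\<^sup>+x. indicator {1/4..1} x * ?H (x *\<^sub>R z) \<partial>lborel)) \<partial>lborel)
    \<le> ennreal C * (\<integral>\<^sup>+u. indicator unit_ball u * (ennreal ((1 - norm u) powr (b + 1)) * ?H u) \<partial>lborel)"
    using radial_average_le[OF b, where 'n='n] H by blast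
  have "(\<integral>\<^sup>+(z :: complex ^ 'n). indicator unit_ball z * ennreal ((1 - norm z) powr b) * ennreal (1/4) \<partial>lborel) \<le> ennreal C * (\<integral>\<^sup>+u. ?H u \<partial>lborel)"
  proof -
    have "(\<integral>\<^sup>+(z :: complex ^ 'n). indicator unit_ball z * ennreal ((1 - norm z) powr b) * ennreal (1/4) \<partial>lborel)
        \<le> (\<integral>\<^sup>+z. indicator unit_ball z * (ennreal ((1 - norm z) powr b) * (\<integral>\<^sup>+x. indicator {1/4..1} x * ?H (x *\<^sub>R z) \<partial>lborel)) \<partial>lborel)"
    proof (rule nn_integral_mono)
      fix z :: "complex ^ 'n"
      show "indicator unit_ball z * ennreal ((1 - norm z) powr b) * ennreal (1/4)
        \<le> indicator unit_ball z * (ennreal ((1 - norm z) powr b) * (\<integral>\<^sup>+x. indicator {1/4..1} x * ?H (x *\<^sub>R z) \<partial>lborel))"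
      proof (cases "z \<in> unit_ball")
        case True
        have "ennreal (1/4) = emeasure lborel {1/4..1/2 :: real}" by simp
        also have "\<dots> = (\<integral>\<^sup>+x. indicator {1/4..1/2 :: real} x \<partial>lborel)" by simp
        also have "\<dots> \<le> (\<integral>\<^sup>+x. indicator {1/4..1} x * ?H (x *\<^sub>R z) \<partial>lborel)"
        proof (rule nn_integral_mono)
          fix x :: real
          show "(indicator {1/4..1/2} x :: ennreal) \<le> indicator {1/4..1} x * ?H (x *\<^sub>R z)"
          proof (cases "x \<in> {1/4..1/2}")
            case x: True
            have "x * norm z < 1/2"
            proof -
              have "x * norm z \<le> (1/2) * norm z" using x by (intro mult_right_mono) auto
              then show ?thesis using True by simp
            qed
            then show ?thesis using x by simp
          qed simp
        qed
        finally show ?thesis using True by (simp add: mult_left_mono)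
      qed simp
    qed
    also have "\<dots> \<le> ennreal C * (\<integral>\<^sup>+u. indicator unit_ball u * (ennreal ((1 - norm u) powr (b + 1)) * ?H u) \<partial>lborel)" by (rule C(2))
    also have "\<dots> \<le> ennreal C * (\<integral>\<^sup>+u. ?H u \<partial>lborel)"
    proof (rule mult_left_mono[OF nn_integral_mono])
      fix u :: "complex ^ 'n"
      have "(1 - norm u) powr (b + 1) \<le> 1" if "norm u < 1" using that b by (simp add: powr_le1)
      then have "ennreal ((1 - norm u) powr (b + 1)) \<le> 1" if "norm u < 1" using that by (simp add: ennreal_le_1)
      then show "indicator unit_ball u * (ennreal ((1 - norm u) powr (b + 1)) * ?H u) \<le> ?H u"
        by (auto simp: indicator_def)
    qed simp
    finally show ?thesis .
  qed
  also have "\<dots> < top" using emeasure_ball[of "1/2" "0 :: complex ^ 'n"] H by (simp add: ennreal_mult_less_top)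
  also have "(\<integral>\<^sup>+(z :: complex ^ 'n). indicator unit_ball z * ennreal ((1 - norm z) powr b) * ennreal (1/4) \<partial>lborel)
     = (\<integral>\<^sup>+(z :: complex ^ 'n). indicator unit_ball z * ennreal ((1 - norm z) powr b) \<partial>lborel) * ennreal (1/4)"
  proof (rule nn_integral_multc)
    have [measurable]: "unit_ball \<in> sets (borel :: (complex ^ 'n) measure)" by simp
    show "(\<lambda>z :: complex ^ 'n. indicator unit_ball z * ennreal ((1 - norm z) powr b)) \<in> borel_measurable lborel" by measurable
  qed
  finally show ?thesis by (auto simp: ennreal_mult_less_top)
qed

text \<open>
The factor \<open>1 - x \<rho>\<close> is at least each of \<open>1 - \<rho>\<close> and \<open>1 - x\<close>; the first bound is used for \<open>1 - x \<le> 1 - \<rho>\<close>, the second otherwise.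
\<close>

lemma beta_tail_bound:
  assumes t: "t > 0" and s: "s > t" and \<rho>: "0 \<le> \<rho>" "\<rho> < 1"
  shows "(\<integral>\<^sup>+x. indicator {0..1} x * ennreal ((1 - x) powr (t - 1) * (1 - x * \<rho>) powr - s) \<partial>lborel)
    \<le> ennreal ((1 / t + 1 / (s - t)) * (1 - \<rho>) powr (t - s))"
proof -
  let ?d = "1 - \<rho>"
  have d: "?d > 0" using \<rho> by simp
  let ?g1 = "\<lambda>y. indicator {0..?d} y * ennreal (y powr (t - 1))" and ?g2 = "\<lambda>y. indicator {?d..} y * ennreal (y powr (t - 1 - s))"
  let ?g = "\<lambda>y. ennreal (?d powr - s) * ?g1 y + ?g2 y"
  have "(\<integral>\<^sup>+x. indicator {0..1} x * ennreal ((1 - x) powr (t - 1) * (1 - x * \<rho>) powr - s) \<partial>lborel) \<le> (\<integral>\<^sup>+x. ?g (1 + (-1) * x) \<partial>lborel)"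
  proof (rule nn_integral_mono)
    fix x :: real
    show "indicator {0..1} x * ennreal ((1 - x) powr (t - 1) * (1 - x * \<rho>) powr - s) \<le> ?g (1 + (-1) * x)"
    proof (cases "x \<in> {0..1}")
      case True
      have "x * \<rho> \<le> x * 1" "x * \<rho> \<le> 1 * \<rho>" using True \<rho> by (intro mult_left_mono mult_right_mono; simp)+
      then have 1: "1 - x \<le> 1 - x * \<rho>" "?d \<le> 1 - x * \<rho>" by auto
      show ?thesis
      proof (cases "1 - x \<le> ?d")
        case l: True
        have "(1 - x * \<rho>) powr - s \<le> ?d powr - s" using 1 d s t by (intro powr_mono2') auto
        then have "(1 - x) powr (t - 1) * (1 - x * \<rho>) powr - s \<le> ?d powr - s * (1 - x) powr (t - 1)"
          by (subst mult.commute) (intro mult_right_mono, auto)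
        then have "ennreal ((1 - x) powr (t - 1) * (1 - x * \<rho>) powr - s) \<le> ennreal (?d powr - s) * ennreal ((1 - x) powr (t - 1))"
          by (simp add: ennreal_leI flip: ennreal_mult)
        then show ?thesis using True l by (simp add: add_increasing2)
      next
        case l: False
        then have x1: "1 - x > 0" using d by linarith
        have "(1 - x * \<rho>) powr - s \<le> (1 - x) powr - s" using 1 x1 s t by (intro powr_mono2') auto
        then have "(1 - x) powr (t - 1) * (1 - x * \<rho>) powr - s \<le> (1 - x) powr (t - 1) * (1 - x) powr - s"
          by (intro mult_left_mono) auto
        also have "\<dots> = (1 - x) powr (t - 1 - s)" by (simp flip: powr_add)
        finally show ?thesis using True l by (simp add: add_increasing ennreal_leI)
      qed
    qed simp
  qed
  also have "\<dots> = (\<integral>\<^sup>+y. ?g y \<partial>lborel)"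
    using nn_integral_real_affine[of ?g "-1" 1] by simp
  also have "\<dots> = ennreal (?d powr - s) * (\<integral>\<^sup>+y. ?g1 y \<partial>lborel) + (\<integral>\<^sup>+y. ?g2 y \<partial>lborel)"
    by (simp add: nn_integral_add nn_integral_cmult)
  also have "(\<integral>\<^sup>+y. ?g1 y \<partial>lborel) = ennreal (?d powr t / t)"
    using nn_integral_powr_from_0[of "t - 1" ?d] t d by simp
  also have "(\<integral>\<^sup>+y. ?g2 y \<partial>lborel) = ennreal (?d powr (t - s) / (s - t))"
    using nn_integral_powr_to_inf[of "t - 1 - s" ?d] s d by simp
  also have "ennreal (?d powr - s) * ennreal (?d powr t / t) + ennreal (?d powr (t - s) / (s - t)) = ennreal ((1 / t + 1 / (s - t)) * ?d powr (t - s))"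
  proof -
    have "?d powr - s * (?d powr t / t) = ?d powr (t - s) / t" by (simp flip: powr_add)
    then have "?d powr - s * (?d powr t / t) + ?d powr (t - s) / (s - t) = (1 / t + 1 / (s - t)) * ?d powr (t - s)"
      by (simp add: algebra_simps)
    then show ?thesis using t s by (simp flip: ennreal_mult ennreal_plus)
  qed
  finally show ?thesis .
qed

section \<open>Multipliers between weights: differentiation\<close>

lemma le_powr_inverse:
  fixes a b p :: real
  assumes "a \<ge> 0" "p > 0" "a powr p \<le> b"
  shows "a \<le> b powr (1 / p)"
proof -
  have "(a powr p) powr (1 / p) \<le> b powr (1 / p)" using assms by (intro powr_mono2) auto
  then show ?thesis using assms by (simp add: powr_powr)
qed

lemma powr_add_le: "(x + y) powr p \<le> 2 powr p * (x powr p + y powr p)" if "x \<ge> 0" "y \<ge> 0" "p \<ge> 0" for x y p :: real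
proof -
  have "(x + y) powr p \<le> (2 * max x y) powr p" using that by (intro powr_mono2) auto
  also have "\<dots> = 2 powr p * max x y powr p" by (rule powr_mult)
  also have "\<dots> \<le> 2 powr p * (x powr p + y powr p)" by (intro mult_left_mono) (auto simp: max_def)
  finally show ?thesis .
qed

text \<open>
The multiplier maps the weight exponent \<open>b\<close> to the exponent \<open>b'\<close>. The type argument fixes the dimension, which
the sequence alone does not determine.
\<close>

definition weight_bounded :: "'n::finite itself \<Rightarrow> real \<Rightarrow> (nat \<Rightarrow> complex) \<Rightarrow> real \<Rightarrow> real \<Rightarrow> bool" where
  "weight_bounded _ p \<mu> b b' \<longleftrightarrow> subexponential \<mu> \<and>
    (\<exists>C\<ge>0. \<forall>f \<in> (holomorphic_ball :: (complex ^ 'n \<Rightarrow> complex) set).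
      weighted_integral p b' (multiplier \<mu> f) \<le> ennreal C * weighted_integral p b f)"

lemma weight_boundedE:
  assumes "weight_bounded TYPE('n::finite) p \<mu> b b'"
  obtains C where "C \<ge> 0" "\<And>f :: complex ^ 'n \<Rightarrow> complex. f \<in> holomorphic_ball \<Longrightarrow>
      weighted_integral p b' (multiplier \<mu> f) \<le> ennreal C * weighted_integral p b f"
  using assms unfolding weight_bounded_def by blast

lemma weight_bounded_subexponential: "weight_bounded TYPE('n::finite) p \<mu> b b' \<Longrightarrow> subexponential \<mu>"
  by (simp add: weight_bounded_def)

lemma weight_bounded_one: "weight_bounded TYPE('n::finite) p (\<lambda>_. 1) b b"
  unfolding weight_bounded_def
  by (intro conjI subexponential_const exI[of _ 1]) (simp_all add: multiplier_one)

lemma weight_bounded_mult: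
  assumes \<mu>: "weight_bounded TYPE('n::finite) p \<mu> b b'" and \<nu>: "weight_bounded TYPE('n) p \<nu> b' b''"
  shows "weight_bounded TYPE('n) p (\<lambda>k. \<nu> k * \<mu> k) b b''"
proof -
  note se = weight_bounded_subexponential[OF \<mu>] weight_bounded_subexponential[OF \<nu>]
  obtain C where C: "C \<ge> 0" "\<And>f :: complex ^ 'n \<Rightarrow> complex. f \<in> holomorphic_ball \<Longrightarrow>
      weighted_integral p b' (multiplier \<mu> f) \<le> ennreal C * weighted_integral p b f"
    using \<mu> by (rule weight_boundedE) blast
  obtain D where D: "D \<ge> 0" "\<And>f :: complex ^ 'n \<Rightarrow> complex. f \<in> holomorphic_ball \<Longrightarrow>
      weighted_integral p b'' (multiplier \<nu> f) \<le> ennreal D * weighted_integral p b' f"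
    using \<nu> by (rule weight_boundedE) blast
  have "weighted_integral p b'' (multiplier (\<lambda>k. \<nu> k * \<mu> k) f) \<le> ennreal (D * C) * weighted_integral p b f"
    if f: "f \<in> (holomorphic_ball :: (complex ^ 'n \<Rightarrow> complex) set)" for f
  proof -
    note cf = holomorphic_ball_chol[OF f]
    have "weighted_integral p b'' (multiplier (\<lambda>k. \<nu> k * \<mu> k) f) \<le> ennreal D * weighted_integral p b' (multiplier \<mu> f)"
      unfolding multiplier_multiplier[OF cf se(1), symmetric] by (rule D(2)[OF multiplier_holomorphic_ball[OF cf se(1)]])
    also have "\<dots> \<le> ennreal D * (ennreal C * weighted_integral p b f)" by (rule mult_left_mono[OF C(2)[OF f]]) simp
    finally show ?thesis using C(1) D(1) by (simp add: ennreal_mult mult.assoc)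
  qed
  then show ?thesis unfolding weight_bounded_def
    using C(1) D(1) se by (intro conjI subexponential_mult exI[of _ "D * C"]) auto
qed

lemma weight_bounded_cmult:
  assumes \<mu>: "weight_bounded TYPE('n::finite) p \<mu> b b'"
  shows "weight_bounded TYPE('n) p (\<lambda>k. c * \<mu> k) b b'"
proof -
  note se = weight_bounded_subexponential[OF \<mu>]
  obtain C where C: "C \<ge> 0" "\<And>f :: complex ^ 'n \<Rightarrow> complex. f \<in> holomorphic_ball \<Longrightarrow>
      weighted_integral p b' (multiplier \<mu> f) \<le> ennreal C * weighted_integral p b f"
    using \<mu> by (rule weight_boundedE) blast
  have "weighted_integral p b' (multiplier (\<lambda>k. c * \<mu> k) f) \<le> ennreal (norm c powr p * C) * weighted_integral p b f"
    if f: "f \<in> (holomorphic_ball :: (complex ^ 'n \<Rightarrow> complex) set)" for f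
  proof -
    note cf = holomorphic_ball_chol[OF f]
    note [measurable] = holomorphic_ball_measurable[OF multiplier_holomorphic_ball[OF cf se]]
    have [measurable]: "unit_ball \<in> sets (borel :: (complex ^ 'n) measure)" by simp
    have "weighted_integral p b' (multiplier (\<lambda>k. c * \<mu> k) f) = (\<integral>\<^sup>+z. ennreal (norm c powr p) *
        (indicator unit_ball z * ennreal ((1 - norm z) powr b' * norm (multiplier \<mu> f z) powr p)) \<partial>lborel)"
      unfolding weighted_integral_def multiplier_cmult[OF cf se]
    proof (rule nn_integral_cong)
      fix z
      have "(1 - norm z) powr b' * norm (c * multiplier \<mu> f z) powr p = norm c powr p * ((1 - norm z) powr b' * norm (multiplier \<mu> f z) powr p)"
        by (simp add: norm_mult powr_mult)
      then have "ennreal ((1 - norm z) powr b' * norm (c * multiplier \<mu> f z) powr p)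
          = ennreal (norm c powr p) * ennreal ((1 - norm z) powr b' * norm (multiplier \<mu> f z) powr p)"
        by (simp only: ennreal_mult powr_ge_zero mult_nonneg_nonneg)
      then show "indicator unit_ball z * ennreal ((1 - norm z) powr b' * norm (c * multiplier \<mu> f z) powr p)
          = ennreal (norm c powr p) * (indicator unit_ball z * ennreal ((1 - norm z) powr b' * norm (multiplier \<mu> f z) powr p))"
        by (simp only: mult.left_commute)
    qed
    also have "\<dots> = ennreal (norm c powr p) * weighted_integral p b' (multiplier \<mu> f)"
      unfolding weighted_integral_def by (rule nn_integral_cmult) measurable
    also have "\<dots> \<le> ennreal (norm c powr p) * (ennreal C * weighted_integral p b f)" by (rule mult_left_mono[OF C(2)[OF f]]) simp
    finally show ?thesis using C(1) by (simp add: ennreal_mult mult.assoc)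
  qed
  then show ?thesis unfolding weight_bounded_def
    using C(1) se by (intro conjI subexponential_mult subexponential_const exI[of _ "norm c powr p * C"]) auto
qed

text \<open>
The multiplier is \<open>R + c\<close>, and Cauchy's estimate on the ball of radius \<open>(1 - |z|) / 2\<close> bounds \<open>(1 - |z|) |R f z|\<close> by the
supremum of \<open>|f|\<close> there, hence its \<open>p\<close>-th power by the Whitney average.
\<close>

lemma weight_bounded_shift:
  assumes p: "p > 0"
  shows "weight_bounded TYPE('n::finite) p (\<lambda>k. of_nat k + c) b (b + p)"
proof -
  obtain C1 where C1: "C1 \<ge> 0" "\<And>(f :: complex ^ 'n \<Rightarrow> complex) z w. f \<in> holomorphic_ball \<Longrightarrow> z \<in> unit_ball \<Longrightarrow> dist z w \<le> (1 - norm z) / 2 \<Longrightarrow>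
      ennreal (norm (f w) powr p) \<le> ennreal C1 * whitney_average p f z"
    using pointwise_le_whitney_average[OF p, where 'n='n] by blast
  obtain C2 where C2: "C2 \<ge> 0" "\<And>f :: complex ^ 'n \<Rightarrow> complex. f \<in> borel_measurable borel \<Longrightarrow>
    (\<integral>\<^sup>+z. indicator unit_ball z * (ennreal ((1 - norm z) powr b) * whitney_average p f z) \<partial>lborel) \<le> ennreal C2 * weighted_integral p b f"
    using integral_whitney_average_le[where 'n='n and p=p and b=b] by blast
  define K where "K = (2 + norm c) powr p * (C1 + 1)"
  have c2: "2 + norm c > 0" by (simp add: add_pos_nonneg)
  have K: "K > 0" unfolding K_def using C1(1) c2 by (intro mult_pos_pos) auto
  show ?thesis unfolding weight_bounded_def
  proof (intro exI[of _ "K * C2"] conjI ballI subexponential_shift)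
    show "0 \<le> K * C2" using K C2 by simp
    fix f :: "complex ^ 'n \<Rightarrow> complex" assume f: "f \<in> holomorphic_ball"
    note cf = holomorphic_ball_chol[OF f]
    note [measurable] = holomorphic_ball_measurable[OF f]
    let ?g = "multiplier (\<lambda>k. of_nat k + c) f"
    have pt: "ennreal ((1 - norm z) powr p * norm (?g z) powr p) \<le> ennreal K * whitney_average p f z" if z: "z \<in> unit_ball" for z
    proof (cases "whitney_average p f z")
      case (real \<omega>)
      let ?d = "1 - norm z"
      have d: "?d > 0" "?d \<le> 1" using z by auto
      define B where "B = ((C1 + 1) * \<omega>) powr (1 / p)"
      have fB: "norm (f w) \<le> B" if "dist z w \<le> ?d / 2" for w
        unfolding B_def
      proof (rule le_powr_inverse)
        have "ennreal (norm (f w) powr p) \<le> ennreal (C1 * \<omega>)"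
          using C1(2)[OF f z that] real C1(1) by (simp add: ennreal_mult)
        then have "norm (f w) powr p \<le> C1 * \<omega>" using real C1(1) by (subst (asm) ennreal_le_iff) auto
        then show "norm (f w) powr p \<le> (C1 + 1) * \<omega>" using real by (simp add: distrib_right)
      qed (use p in auto)
      have B0: "B \<ge> 0" by (simp add: B_def)
      have "norm (cderiv f z z) \<le> B / (?d / 2) * norm z"
        by (rule cderiv_bound[OF cf]) (use d fB in \<open>auto simp: subset_iff dist_norm intro: order_le_less_trans[OF norm_triangle_sub[of _ z]] simp: norm_minus_commute\<close>)
      also have "\<dots> \<le> B / (?d / 2) * 1" using z B0 d by (intro mult_left_mono) auto
      finally have 1: "norm (cderiv f z z) \<le> 2 * B / ?d" by (simp add: mult.commute)
      have "norm (f z) \<le> B" using fB[of z] d by simp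
      also have "B \<le> B / ?d" using d B0 by (simp add: field_simps mult_left_le)
      finally have "norm c * norm (f z) \<le> norm c * (B / ?d)" by (rule mult_left_mono) simp
      then have "norm (?g z) \<le> 2 * B / ?d + norm c * (B / ?d)"
        using norm_triangle_ineq[of "cderiv f z z" "c * f z"] 1 by (simp add: multiplier_shift[OF cf z] norm_mult)
      also have "2 * B / ?d + norm c * (B / ?d) = (2 + norm c) * B / ?d"
        by (simp only: distrib_right add_divide_distrib times_divide_eq_right)
      finally have "norm (?g z) * ?d \<le> (2 + norm c) * B" using d(1) by (simp only: pos_le_divide_eq)
      then have "?d * norm (?g z) \<le> (2 + norm c) * B" by (simp only: mult.commute)
      then have "(?d * norm (?g z)) powr p \<le> ((2 + norm c) * B) powr p" using p d by (intro powr_mono2) auto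
      also have "\<dots> = (2 + norm c) powr p * B powr p" by (rule powr_mult)
      also have "B powr p = (C1 + 1) * \<omega>" using p C1(1) real by (simp add: B_def powr_powr)
      finally have "?d powr p * norm (?g z) powr p \<le> K * \<omega>" by (simp add: K_def powr_mult mult.assoc)
      then have "ennreal (?d powr p * norm (?g z) powr p) \<le> ennreal (K * \<omega>)" by (rule ennreal_leI)
      also have "\<dots> = ennreal K * whitney_average p f z" using real K by (simp add: ennreal_mult)
      finally show ?thesis .
    next
      case top
      have "ennreal K \<noteq> 0" using K by (simp add: ennreal_eq_0_iff)
      then show ?thesis unfolding top by (simp add: ennreal_mult_top)
    qed
    have [measurable]: "unit_ball \<in> sets (borel :: (complex ^ 'n) measure)" by simp
    note [measurable] = whitney_average_measurable
    have "weighted_integral p (b + p) ?g \<le> (\<integral>\<^sup>+z. ennreal K * (indicator unit_ball z * (ennreal ((1 - norm z) powr b) * whitney_average p f z)) \<partial>lborel)"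
      unfolding weighted_integral_def
    proof (rule nn_integral_mono)
      fix z
      show "indicator unit_ball z * ennreal ((1 - norm z) powr (b + p) * norm (?g z) powr p) \<le> ennreal K * (indicator unit_ball z * (ennreal ((1 - norm z) powr b) * whitney_average p f z))"
      proof (cases "z \<in> unit_ball")
        case True
        have "ennreal ((1 - norm z) powr (b + p) * norm (?g z) powr p) = ennreal ((1 - norm z) powr b) * ennreal ((1 - norm z) powr p * norm (?g z) powr p)"
          by (simp add: powr_add mult.assoc flip: ennreal_mult)
        also have "\<dots> \<le> ennreal ((1 - norm z) powr b) * (ennreal K * whitney_average p f z)"
          by (intro mult_left_mono pt True) simp
        finally show ?thesis using True by (simp add: mult_ac)
      qed simp
    qed
    also have "\<dots> = ennreal K * (\<integral>\<^sup>+z. indicator unit_ball z * (ennreal ((1 - norm z) powr b) * whitney_average p f z) \<partial>lborel)"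
      by (rule nn_integral_cmult) measurable
    also have "\<dots> \<le> ennreal K * (ennreal C2 * weighted_integral p b f)"
      by (rule mult_left_mono[OF C2(2)[OF holomorphic_ball_measurable[OF f]]]) simp
    also have "\<dots> = ennreal (K * C2) * weighted_integral p b f"
      using K C2(1) by (simp add: ennreal_mult mult.assoc)
    finally show "weighted_integral p (b + p) ?g \<le> ennreal (K * C2) * weighted_integral p b f" .
  qed
qed

lemma weight_bounded_shifts:
  assumes p: "p > 0"
  shows "weight_bounded TYPE('n::finite) p (\<lambda>k. \<Prod>i<M. of_nat k + c i) b (b + p * real M)"
proof (induction M)
  case 0
  show ?case using weight_bounded_one[where 'n='n] by simp
next
  case (Suc M)
  have b: "b + p * real (Suc M) = b + p * real M + p" by (simp add: algebra_simps)
  show ?case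
    using weight_bounded_mult[OF Suc weight_bounded_shift[OF p]] unfolding b by (simp add: mult.commute)
qed

text \<open>
The ball of radius \<open>1/8\<close> around \<open>u\<close> lies in the ball of radius \<open>7/8\<close> around \<open>0\<close>, where every weight is bounded
below by a positive constant.
\<close>

lemma interior_sup_le_weighted_integral:
  assumes p: "p > 0"
  shows "\<exists>C\<ge>0. \<forall>f \<in> (holomorphic_ball :: (complex ^ 'n \<Rightarrow> complex) set). \<forall>u \<in> cball 0 (3/4).
    ennreal (norm (f u) powr p) \<le> ennreal C * weighted_integral p b f"
proof -
  let ?D = "DIM(complex ^ 'n)"
  obtain C where C: "C \<ge> 0" "\<And>(f :: complex ^ 'n \<Rightarrow> complex) w r. f \<in> holomorphic_ball \<Longrightarrow> r > 0 \<Longrightarrow> cball w r \<subseteq> unit_ball \<Longrightarrow>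
      ennreal (norm (f w) powr p * r ^ ?D) \<le> ennreal C * ball_integral p f w r"
    using sub_mean_value_powr[OF p, where 'n='n] by blast
  define m where "m = (1/8 :: real) powr \<bar>b\<bar>"
  have m: "m > 0" by (simp add: m_def)
  have wt: "m \<le> x powr b" if "1/8 \<le> x" "x \<le> 1" for x :: real
  proof -
    have "(1/8 :: real) powr \<bar>b\<bar> \<le> x powr \<bar>b\<bar>" using that by (intro powr_mono2) auto
    also have "\<dots> \<le> x powr b" using that by (intro powr_mono') auto
    finally show ?thesis by (simp add: m_def)
  qed
  show ?thesis
  proof (intro exI[of _ "8 ^ ?D * C / m"] conjI ballI)
    show "0 \<le> 8 ^ ?D * C / m" using C m by simp
    fix f :: "complex ^ 'n \<Rightarrow> complex" and u :: "complex ^ 'n" assume f: "f \<in> holomorphic_ball" and u: "u \<in> cball 0 (3/4)"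
    note [measurable] = holomorphic_ball_measurable[OF f]
    have [measurable]: "unit_ball \<in> sets (borel :: (complex ^ 'n) measure)" by simp
    have near: "norm v \<le> norm u + dist u v" for v using norm_triangle_ineq2[of v u] by (simp add: dist_norm norm_minus_commute)
    have sub: "cball u (1/8) \<subseteq> unit_ball"
    proof
      fix v assume "v \<in> cball u (1/8)"
      then show "v \<in> unit_ball" using near[of v] u by simp
    qed
    have "ennreal (norm (f u) powr p) = ennreal (8 ^ ?D) * ennreal (norm (f u) powr p * (1/8) ^ ?D)"
      by (simp add: power_one_over flip: ennreal_mult)
    also have "ennreal (norm (f u) powr p * (1/8) ^ ?D) \<le> ennreal C * (\<integral>\<^sup>+v. indicator (ball u (1/8)) v * ennreal (norm (f v) powr p) \<partial>lborel)"
      by (rule C(2)[OF f _ sub]) simp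
    also have "(\<integral>\<^sup>+v. indicator (ball u (1/8)) v * ennreal (norm (f v) powr p) \<partial>lborel)
        \<le> (\<integral>\<^sup>+v. ennreal (1 / m) * (indicator unit_ball v * ennreal ((1 - norm v) powr b * norm (f v) powr p)) \<partial>lborel)"
    proof (rule nn_integral_mono)
      fix v :: "complex ^ 'n"
      show "indicator (ball u (1/8)) v * ennreal (norm (f v) powr p) \<le> ennreal (1 / m) * (indicator unit_ball v * ennreal ((1 - norm v) powr b * norm (f v) powr p))"
      proof (cases "v \<in> ball u (1/8)")
        case True
        have v: "norm v \<le> 7/8" using near[of v] u True by simp
        have "m * norm (f v) powr p \<le> (1 - norm v) powr b * norm (f v) powr p" using v by (intro mult_right_mono wt) auto
        then have "norm (f v) powr p \<le> 1 / m * ((1 - norm v) powr b * norm (f v) powr p)" using m by (simp add: field_simps)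
        then show ?thesis using True v m by (simp add: ennreal_leI flip: ennreal_mult)
      qed simp
    qed
    also have "\<dots> = ennreal (1 / m) * weighted_integral p b f"
      unfolding weighted_integral_def by (rule nn_integral_cmult) measurable
    finally have "ennreal (norm (f u) powr p) \<le> ennreal (8 ^ ?D) * (ennreal C * (ennreal (1 / m) * weighted_integral p b f))"
      by (simp add: mult_left_mono)
    also have "\<dots> = ennreal (8 ^ ?D * C / m) * weighted_integral p b f"
    proof -
      have "ennreal (8 ^ ?D * C / m) = ennreal (8 ^ ?D) * (ennreal C * ennreal (1 / m))" using C m by (simp flip: ennreal_mult)
      then show ?thesis by (simp only: mult.assoc)
    qed
    finally show "ennreal (norm (f u) powr p) \<le> ennreal (8 ^ ?D * C / m) * weighted_integral p b f" .
  qed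
qed

section \<open>The beta integral with complex parameters\<close>

definition gamma_kernel :: "complex \<Rightarrow> real \<Rightarrow> complex" where
  "gamma_kernel z x = indicator {0<..} x *\<^sub>R (of_real x powr (z - 1) / of_real (exp x))"

definition beta_kernel :: "complex \<Rightarrow> complex \<Rightarrow> real \<Rightarrow> complex" where
  "beta_kernel a b x = indicator {0<..<1} x *\<^sub>R (of_real x powr (a - 1) * of_real (1 - x) powr (b - 1))"

text \<open>
The complex power has a jump across the negative axis, so measurability is read off from explicit formulas
on the two half-lines.
\<close>

lemma of_real_powr_measurable [measurable]: "(\<lambda>x. of_real x powr z) \<in> borel_measurable (borel :: real measure)" for z :: complex
proof -
  have "(\<lambda>x::real. indicator {0<..} x *\<^sub>R exp (z * of_real (ln x)) + indicator {..<0} x *\<^sub>R exp (z * (of_real (ln (- x)) + \<i> * of_real pi))) \<in> borel_measurable borel"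
    by measurable
  also have "(\<lambda>x::real. indicator {0<..} x *\<^sub>R exp (z * of_real (ln x)) + indicator {..<0} x *\<^sub>R exp (z * (of_real (ln (- x)) + \<i> * of_real pi))) = (\<lambda>x. of_real x powr z)"
  proof
    fix x :: real
    consider "x > 0" | "x = 0" | "x < 0" by linarith
    then show "indicator {0<..} x *\<^sub>R exp (z * of_real (ln x)) + indicator {..<0} x *\<^sub>R exp (z * (of_real (ln (- x)) + \<i> * of_real pi)) = of_real x powr z"
    proof cases
      case 3
      then have "Ln (of_real x) = of_real (ln (- x)) + \<i> * of_real pi"
        using Ln_of_real'[of x] by simp
      then show ?thesis using 3 by (simp add: powr_def)
    qed (simp_all add: powr_def Ln_of_real)
  qed
  finally show ?thesis .
qed

lemma gamma_kernel_measurable [measurable]: "gamma_kernel z \<in> borel_measurable borel"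
  unfolding gamma_kernel_def[abs_def] by measurable

lemma beta_kernel_measurable [measurable]: "beta_kernel a b \<in> borel_measurable borel"
  unfolding beta_kernel_def[abs_def] by measurable

lemma gamma_kernel_integral:
  assumes "Re z > 0"
  shows "integrable lborel (gamma_kernel z)" "(\<integral>x. gamma_kernel z x \<partial>lborel) = Gamma z"
proof -
  have "set_integrable lebesgue {0<..} (\<lambda>t. complex_of_real t powr (z - 1) / of_real (exp t))"
    by (rule absolutely_integrable_Gamma_integral'[OF assms])
  then have "integrable lebesgue (gamma_kernel z)"
    unfolding set_integrable_def gamma_kernel_def[abs_def] .
  then show I: "integrable lborel (gamma_kernel z)" by (subst (asm) integrable_completion) measurable
  have "((\<lambda>t. if t \<in> {0<..} then of_real t powr (z - 1) / of_real (exp t) else 0) has_integral Gamma z) UNIV"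
    using Gamma_integral_complex'[OF assms] by (subst has_integral_restrict_UNIV)
  also have "(\<lambda>t. if t \<in> {0<..} then of_real t powr (z - 1) / of_real (exp t) else 0) = gamma_kernel z"
    by (auto simp: gamma_kernel_def fun_eq_iff)
  finally show "(\<integral>x. gamma_kernel z x \<partial>lborel) = Gamma z"
    using has_integral_integral_lborel[OF I] has_integral_unique by blast
qed

lemma norm_beta_kernel:
  "norm (beta_kernel a b x) = indicator {0<..<1} x * (x powr (Re a - 1) * (1 - x) powr (Re b - 1))"
proof (cases "x \<in> {0<..<1}")
  case True
  then have "norm (of_real x powr (a - 1)) = x powr (Re a - 1)"
    using norm_powr_real_powr[of "of_real x" "a - 1"] by simp
  moreover have "norm (of_real (1 - x) powr (b - 1)) = (1 - x) powr (Re b - 1)"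
    using norm_powr_real_powr[of "of_real (1 - x)" "b - 1"] True by simp
  ultimately show ?thesis using True by (simp only: beta_kernel_def norm_scaleR norm_mult indicator_simps abs_one mult_1)
qed (simp add: beta_kernel_def)

lemma integrable_beta_kernel:
  assumes "Re a > 0" "Re b > 0"
  shows "integrable lborel (beta_kernel a b)"
proof (rule Bochner_Integration.integrable_bound)
  show "integrable lborel (\<lambda>x. indicator {0..1} x *\<^sub>R (x powr (Re a - 1) * (1 - x) powr (Re b - 1)))"
    using integrable_Beta[OF assms] unfolding set_integrable_def .
  show "AE x in lborel. norm (beta_kernel a b x) \<le> norm (indicator {0..1} x *\<^sub>R (x powr (Re a - 1) * (1 - x) powr (Re b - 1)))"
    by (rule AE_I2) (auto simp: norm_beta_kernel indicator_def)
qed measurable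

text \<open>
The substitution \<open>x = u v\<close> makes the convolution of two kernels a multiple of the kernel of the sum, the
factor being the beta integral.
\<close>

lemma gamma_kernel_convolution:
  "(\<integral>x. gamma_kernel a x * gamma_kernel b (u - x) \<partial>lborel) = gamma_kernel (a + b) u * (\<integral>v. beta_kernel a b v \<partial>lborel)"
proof (cases "u > 0")
  case u: True
  have "(\<integral>x. gamma_kernel a x * gamma_kernel b (u - x) \<partial>lborel)
      = \<bar>u\<bar> *\<^sub>R (\<integral>v. gamma_kernel a (0 + u * v) * gamma_kernel b (u - (0 + u * v)) \<partial>lborel)"
    by (rule lborel_integral_real_affine[where f="\<lambda>x. gamma_kernel a x * gamma_kernel b (u - x)"]) (use u in simp)
  also have "\<dots> = (\<integral>v. \<bar>u\<bar> *\<^sub>R (gamma_kernel a (u * v) * gamma_kernel b (u - u * v)) \<partial>lborel)" by simp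
  also have "\<dots> = (\<integral>v. gamma_kernel (a + b) u * beta_kernel a b v \<partial>lborel)"
  proof (rule Bochner_Integration.integral_cong)
    fix v :: real
    show "\<bar>u\<bar> *\<^sub>R (gamma_kernel a (u * v) * gamma_kernel b (u - u * v)) = gamma_kernel (a + b) u * beta_kernel a b v"
    proof (cases "v \<in> {0<..<1}")
      case True
      have 1: "u * v > 0" "u - u * v > 0" using u True by (auto simp: algebra_simps)
      have e: "u - u * v = u * (1 - v)" by (simp add: algebra_simps)
      have p: "of_real (u * w) powr z = of_real u powr z * of_real w powr z" if "w > 0" for w and z :: complex
        using powr_times_real[of "of_real u" "of_real w" z] u that by simp
      have uu: "of_real u * (of_real u powr (a - 1) * of_real u powr (b - 1)) = (of_real u powr (a + b - 1) :: complex)"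
      proof -
        have "of_real u = (of_real u powr 1 :: complex)" using u by simp
        then have "of_real u * (of_real u powr (a - 1) * of_real u powr (b - 1)) = (of_real u powr 1 * (of_real u powr (a - 1) * of_real u powr (b - 1)) :: complex)"
          by simp
        also have "\<dots> = of_real u powr (1 + ((a - 1) + (b - 1)))" by (simp only: powr_add)
        finally show ?thesis by (simp add: algebra_simps)
      qed
      have ee: "complex_of_real (exp (u * v)) * of_real (exp (u - u * v)) = of_real (exp u)"
        by (simp flip: of_real_mult exp_add)
      have "\<bar>u\<bar> *\<^sub>R (gamma_kernel a (u * v) * gamma_kernel b (u - u * v))
        = of_real u * ((of_real (u * v) powr (a - 1) * of_real (u - u * v) powr (b - 1)) / (of_real (exp (u * v)) * of_real (exp (u - u * v))))"
        using 1 u by (simp add: gamma_kernel_def scaleR_conv_of_real)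
      also have "\<dots> = of_real u * ((of_real (u * v) powr (a - 1) * of_real (u * (1 - v)) powr (b - 1)) / of_real (exp u))"
        by (subst ee) (simp only: e)
      also have "\<dots> = (of_real u * (of_real u powr (a - 1) * of_real u powr (b - 1))) * (of_real v powr (a - 1) * of_real (1 - v) powr (b - 1)) / of_real (exp u)"
        using True by (subst (1 2) p) auto
      also have "\<dots> = gamma_kernel (a + b) u * beta_kernel a b v"
        using True u unfolding uu by (simp add: gamma_kernel_def beta_kernel_def)
      finally show ?thesis .
    next
      case False
      then have "u * v \<le> 0 \<or> u - u * v \<le> 0" using u by (auto simp: mult_le_0_iff)
      then have "gamma_kernel a (u * v) * gamma_kernel b (u - u * v) = 0" by (auto simp: gamma_kernel_def)
      moreover have "beta_kernel a b v = 0" using False by (simp only: beta_kernel_def indicator_simps scaleR_zero_left not_False_eq_True)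
      ultimately show ?thesis by simp
    qed
  qed simp
  finally show ?thesis by simp
next
  case False
  have "gamma_kernel a x * gamma_kernel b (u - x) = 0" for x
    using False by (auto simp: gamma_kernel_def indicator_def)
  then have "(\<lambda>x. gamma_kernel a x * gamma_kernel b (u - x)) = (\<lambda>x. 0)" by blast
  moreover have "gamma_kernel (a + b) u = 0" using False by (simp add: gamma_kernel_def)
  ultimately show ?thesis by (simp only: mult_zero_left Bochner_Integration.integral_zero)
qed

text \<open>
Euler's argument: the product of two Gamma integrals is the total integral of the convolution.
\<close>

lemma beta_kernel_integral:
  assumes a: "Re a > 0" and b: "Re b > 0"
  shows "(\<integral>v. beta_kernel a b v \<partial>lborel) = Gamma a * Gamma b / Gamma (a + b)"
proof -
  let ?K = "\<lambda>x u. gamma_kernel a x * gamma_kernel b (u - x)"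
  note Ia = gamma_kernel_integral[OF a] and Ib = gamma_kernel_integral[OF b]
  have shift: "integrable lborel (\<lambda>u. gamma_kernel b (u - x))" "(\<integral>u. gamma_kernel b (u - x) \<partial>lborel) = Gamma b"
    "(\<integral>u. norm (gamma_kernel b (u - x)) \<partial>lborel) = (\<integral>u. norm (gamma_kernel b u) \<partial>lborel)" for x
    using lborel_integrable_real_affine[OF Ib(1), of 1 "- x"] lborel_integral_real_affine[of 1 "gamma_kernel b" "- x"]
      lborel_integral_real_affine[of 1 "\<lambda>u. norm (gamma_kernel b u)" "- x"] Ib(2) by simp_all
  have K: "integrable (lborel \<Otimes>\<^sub>M lborel) (\<lambda>(x, u). ?K x u)"
  proof (rule lborel_pair.Fubini_integrable)
    show "(\<lambda>(x, u). ?K x u) \<in> borel_measurable (lborel \<Otimes>\<^sub>M lborel)" by measurable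
    show "integrable lborel (\<lambda>x. \<integral>u. norm (case (x, u) of (x, u) \<Rightarrow> ?K x u) \<partial>lborel)"
      using Ia(1) by (simp add: norm_mult shift)
    show "AE x in lborel. integrable lborel (\<lambda>u. case (x, u) of (x, u) \<Rightarrow> ?K x u)"
      by (rule AE_I2) (simp add: shift)
  qed
  have "Gamma a * Gamma b = (\<integral>x. \<integral>u. ?K x u \<partial>lborel \<partial>lborel)"
    using Ia by (simp add: shift)
  also have "\<dots> = (\<integral>u. \<integral>x. ?K x u \<partial>lborel \<partial>lborel)"
    using lborel_pair.Fubini_integral[OF K] by simp
  also have "\<dots> = (\<integral>u. gamma_kernel (a + b) u * (\<integral>v. beta_kernel a b v \<partial>lborel) \<partial>lborel)"
    by (simp only: gamma_kernel_convolution)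
  also have "\<dots> = Gamma (a + b) * (\<integral>v. beta_kernel a b v \<partial>lborel)"
    using gamma_kernel_integral[of "a + b"] a b by simp
  finally have "Gamma a * Gamma b = Gamma (a + b) * (\<integral>v. beta_kernel a b v \<partial>lborel)" .
  moreover have "Gamma (a + b) \<noteq> 0" using a b by (simp add: Gamma_eq_zero_iff Re_pos_not_nonpos_Int)
  ultimately show ?thesis by simp
qed

section \<open>Multipliers between weights: fractional integration\<close>

definition expansion_tail :: "(complex ^ 'n \<Rightarrow> complex) \<Rightarrow> nat \<Rightarrow> complex ^ 'n \<Rightarrow> real \<Rightarrow> complex" where
  "expansion_tail f m z x = f (x *\<^sub>R z) - (\<Sum>k<m. hom_part f k z * of_real x ^ k)"

lemma expansion_tail_sums:
  assumes f: "f chol_on unit_ball" and z: "z \<in> unit_ball" and x: "x \<in> {0..1}"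
  shows "(\<lambda>k. if k < m then 0 else hom_part f k z * of_real x ^ k) sums expansion_tail f m z x"
proof -
  have "norm (of_real x :: complex) * norm z \<le> 1 * norm z" using x by (intro mult_right_mono) auto
  then have "(\<lambda>k. hom_part f k z * of_real x ^ k) sums f (of_real x *s z)"
    using z by (intro hom_part_sums_slice[OF f]) auto
  moreover have "(\<lambda>k. if k \<in> {..<m} then hom_part f k z * of_real x ^ k else 0) sums (\<Sum>k<m. hom_part f k z * of_real x ^ k)"
    by (rule sums_If_finite_set) simp
  ultimately have "(\<lambda>k. hom_part f k z * of_real x ^ k - (if k \<in> {..<m} then hom_part f k z * of_real x ^ k else 0)) sums expansion_tail f m z x"
    unfolding expansion_tail_def of_real_smult_vec by (rule sums_diff)
  moreover have "(\<lambda>k. hom_part f k z * of_real x ^ k - (if k \<in> {..<m} then hom_part f k z * of_real x ^ k else 0))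
      = (\<lambda>k. if k < m then 0 else hom_part f k z * of_real x ^ k)" by auto
  ultimately show ?thesis by simp
qed

lemma beta_kernel_shift:
  "beta_kernel (a + of_nat k) b x = of_real x ^ k * beta_kernel a b x"
proof (cases "x \<in> {0<..<1}")
  case True
  have "of_real x powr (a + of_nat k - 1) = (of_real x powr (a - 1) * of_real x ^ k :: complex)"
  proof -
    have "of_real x powr (a + of_nat k - 1) = (of_real x powr ((a - 1) + of_nat k) :: complex)" by (simp add: algebra_simps)
    also have "\<dots> = of_real x powr (a - 1) * of_real x powr of_nat k" by (rule powr_add)
    finally show ?thesis using True by (simp add: powr_nat)
  qed
  then show ?thesis by (simp add: beta_kernel_def)
qed (simp add: beta_kernel_def)

lemma norm_beta_kernel_mono:
  assumes "m \<le> k"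
  shows "norm (beta_kernel (a + of_nat k) b x) \<le> norm (beta_kernel (a + of_nat m) b x)"
proof (cases "x \<in> {0<..<1}")
  case True
  have "x ^ k \<le> x ^ m" using True assms by (intro power_decreasing) auto
  then have "x ^ k * norm (beta_kernel a b x) \<le> x ^ m * norm (beta_kernel a b x)" by (rule mult_right_mono) simp
  then show ?thesis using True unfolding beta_kernel_shift by (simp add: norm_mult norm_power)
qed (simp add: beta_kernel_def)

abbreviation ray_integral :: "real \<Rightarrow> (complex ^ 'n \<Rightarrow> complex) \<Rightarrow> complex ^ 'n \<Rightarrow> ennreal" where
  "ray_integral t f z \<equiv> (\<integral>\<^sup>+x. indicator {1/2..1} x * ennreal ((1 - x) powr (t - 1) * norm (f (x *\<^sub>R z))) \<partial>lborel)"

abbreviation ray_average :: "real \<Rightarrow> real \<Rightarrow> (complex ^ 'n \<Rightarrow> complex) \<Rightarrow> complex ^ 'n \<Rightarrow> ennreal" where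
  "ray_average p q f z \<equiv> (\<integral>\<^sup>+y. indicator {1/4..1} y *
     (ennreal ((1 - norm (y *\<^sub>R z)) powr (q - 1)) * whitney_average p f (y *\<^sub>R z)) \<partial>lborel)"

text \<open>
By the beta integral, \<open>\<Gamma>(a + k) \<Gamma>(t) / \<Gamma>(a + k + t)\<close> is the integral of \<open>x^(a+k-1) (1-x)^(t-1)\<close>. Summation under the
integral sign gives the tail of the expansion on the segment from \<open>0\<close> to \<open>z\<close>. Omitting the terms of degree
below \<open>m\<close> makes the integral converge at \<open>0\<close> when \<open>Re a \<le> 0\<close>.
\<close>

lemma fractional_integral_bound:
  fixes t :: real
  assumes f: "f chol_on unit_ball" and z: "z \<in> unit_ball" and t: "t > 0" and am: "Re a + real m > 0"
  defines "\<nu> \<equiv> \<lambda>k. if k < m then 0 else Gamma (a + of_nat k) / Gamma (a + of_nat k + of_real t)"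
  shows "ennreal (norm (\<Sum>k. \<nu> k * hom_part f k z) * Gamma t)
    \<le> (\<integral>\<^sup>+x. indicator {0<..<1} x * ennreal (x powr (Re a - 1) * (1 - x) powr (t - 1) * norm (expansion_tail f m z x)) \<partial>lborel)"
proof -
  let ?b = "of_real t :: complex"
  define g where "g = (\<lambda>k x. (if k < m then 0 else hom_part f k z) * beta_kernel (a + of_nat k) ?b x)"
  have Re: "Re (a + of_nat k) > 0" if "m \<le> k" for k
  proof -
    have "real m \<le> real k" using that by simp
    then show ?thesis using am by simp
  qed
  have int: "integrable lborel (g k)" for k
  proof (cases "k < m")
    case False
    have "integrable lborel (\<lambda>x. hom_part f k z * beta_kernel (a + of_nat k) ?b x)"
      by (rule integrable_mult_right, rule integrable_beta_kernel) (use Re False t in auto)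
    then show ?thesis using False by (simp add: g_def)
  qed (simp add: g_def)
  have val: "(\<integral>x. g k x \<partial>lborel) = \<nu> k * hom_part f k z * Gamma ?b" for k
  proof (cases "k < m")
    case False
    then have "(\<integral>x. g k x \<partial>lborel) = hom_part f k z * (\<integral>x. beta_kernel (a + of_nat k) ?b x \<partial>lborel)"
      by (simp add: g_def)
    also have "(\<integral>x. beta_kernel (a + of_nat k) ?b x \<partial>lborel) = Gamma (a + of_nat k) * Gamma ?b / Gamma (a + of_nat k + ?b)"
      by (rule beta_kernel_integral) (use Re False t in auto)
    finally show ?thesis using False by (simp add: \<nu>_def)
  qed (simp add: g_def \<nu>_def)
  let ?h = "\<lambda>x. norm (beta_kernel (a + of_nat m) ?b x)"
  have Ih: "integrable lborel ?h" by (intro integrable_norm integrable_beta_kernel) (use Re t in auto)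
  have le: "norm (g k x) \<le> norm (hom_part f k z) * ?h x" for k x
    unfolding g_def norm_mult by (cases "k < m") (auto intro!: mult_left_mono norm_beta_kernel_mono)
  have S: "summable (\<lambda>k. norm (hom_part f k z))"
    using multiplier_summable_norm[OF f subexponential_const[of 1] z] by simp
  have s1: "AE x in lborel. summable (\<lambda>k. norm (g k x))"
    by (intro AE_I2 summable_comparison_test'[OF summable_mult2[OF S]]) (use le in auto)
  have s2: "summable (\<lambda>k. \<integral>x. norm (g k x) \<partial>lborel)"
  proof (rule summable_comparison_test')
    show "summable (\<lambda>k. norm (hom_part f k z) * (\<integral>x. ?h x \<partial>lborel))" by (rule summable_mult2[OF S])
    fix k :: nat
    have "(\<integral>x. norm (g k x) \<partial>lborel) \<le> (\<integral>x. norm (hom_part f k z) * ?h x \<partial>lborel)"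
      by (intro integral_mono integrable_norm int integrable_mult_right Ih le)
    then show "norm (\<integral>x. norm (g k x) \<partial>lborel) \<le> norm (hom_part f k z) * (\<integral>x. ?h x \<partial>lborel)"
      by (simp add: abs_of_nonneg integral_nonneg_AE)
  qed
  have sum: "(\<Sum>k. g k x) = beta_kernel a ?b x * expansion_tail f m z x" for x
  proof (cases "x \<in> {0<..<1}")
    case True
    have "(\<lambda>k. beta_kernel a ?b x * (if k < m then 0 else hom_part f k z * of_real x ^ k)) sums (beta_kernel a ?b x * expansion_tail f m z x)"
      by (intro sums_mult expansion_tail_sums f z) (use True in auto)
    moreover have "(\<lambda>k. beta_kernel a ?b x * (if k < m then 0 else hom_part f k z * of_real x ^ k)) = (\<lambda>k. g k x)"
      by (auto simp: g_def beta_kernel_shift)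
    ultimately show ?thesis by (simp add: sums_iff)
  qed (simp add: g_def beta_kernel_def)
  have sm: "summable (\<lambda>k. \<nu> k * hom_part f k z)"
  proof -
    have "(\<lambda>k. \<nu> k * hom_part f k z * Gamma ?b) sums (\<integral>x. (\<Sum>k. g k x) \<partial>lborel)"
      using sums_integral[OF int s1 s2] unfolding val .
    moreover have "Gamma ?b \<noteq> 0" using t by (simp add: Gamma_eq_zero_iff Re_pos_not_nonpos_Int)
    ultimately show ?thesis using summable_mult2[of "\<lambda>k. \<nu> k * hom_part f k z * Gamma ?b" "1 / Gamma ?b"] by (simp add: sums_iff)
  qed
  have "norm (\<Sum>k. \<nu> k * hom_part f k z) * Gamma t = norm ((\<Sum>k. \<nu> k * hom_part f k z) * Gamma ?b)"
    using t Gamma_real_pos[of t] by (simp add: norm_mult Gamma_complex_of_real)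
  also have "(\<Sum>k. \<nu> k * hom_part f k z) * Gamma ?b = (\<Sum>k. \<integral>x. g k x \<partial>lborel)"
    unfolding val by (rule suminf_mult2[OF sm])
  also have "\<dots> = (\<integral>x. (\<Sum>k. g k x) \<partial>lborel)" by (rule integral_suminf[OF int s1 s2, symmetric])
  finally have "ennreal (norm (\<Sum>k. \<nu> k * hom_part f k z) * Gamma t) = ennreal (norm (\<integral>x. (\<Sum>k. g k x) \<partial>lborel))" by simp
  also have "\<dots> \<le> (\<integral>\<^sup>+x. ennreal (norm (\<Sum>k. g k x)) \<partial>lborel)"
    by (rule integral_norm_bound_ennreal[OF integrable_suminf[OF int s1 s2]])
  also have "\<dots> = (\<integral>\<^sup>+x. indicator {0<..<1} x * ennreal (x powr (Re a - 1) * (1 - x) powr (t - 1) * norm (expansion_tail f m z x)) \<partial>lborel)"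
    unfolding sum norm_mult norm_beta_kernel by (intro nn_integral_cong) (auto simp: indicator_def)
  finally show ?thesis .
qed

text \<open>
Only the values of \<open>f\<close> near the end of the segment matter. The terms of low degree, and the tail for
\<open>x < 1/2\<close>, which is \<open>O(x^m)\<close>, are bounded by the supremum \<open>B\<close> of \<open>|f|\<close> on a smaller ball.
\<close>

lemma multiplier_pointwise_bound:
  fixes \<mu> :: "nat \<Rightarrow> complex" and t :: real
  assumes t: "t > 0" and am: "Re a + real m > 0" and se: "subexponential \<mu>"
    and \<mu>: "\<And>k. k \<ge> m \<Longrightarrow> \<mu> k = Gamma (a + of_nat k) / Gamma (a + of_nat k + of_real t)"
  shows "\<exists>K\<ge>0. \<forall>f \<in> (holomorphic_ball :: (complex ^ 'n \<Rightarrow> complex) set). \<forall>B. (\<forall>u\<in>cball 0 (3/4). norm (f u) \<le> B) \<longrightarrow> (\<forall>z\<in>unit_ball.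
     ennreal (norm (multiplier \<mu> f z)) \<le> ennreal (K * B) + ennreal K * ray_integral t f z)"
proof -
  define A1 where "A1 = (\<Sum>k<m. norm (\<mu> k) * (4/3) ^ k)"
  let ?e = "\<lambda>x::real. x powr (Re a + real m - 1) * (1 - x) powr (t - 1)"
  have "(\<integral>\<^sup>+x. ennreal (norm (indicator {0..1} x *\<^sub>R ?e x)) \<partial>lborel) < \<infinity>"
    using integrable_Beta[OF am t] unfolding set_integrable_def integrable_iff_bounded by simp
  moreover have "(\<integral>\<^sup>+x. ennreal (norm (indicator {0..1} x *\<^sub>R ?e x)) \<partial>lborel) = (\<integral>\<^sup>+x. indicator {0..1} x * ennreal (?e x) \<partial>lborel)"
    by (rule nn_integral_cong) (auto simp: indicator_def)
  ultimately obtain A2 where A2: "A2 \<ge> 0" "(\<integral>\<^sup>+x. indicator {0..1} x * ennreal (?e x) \<partial>lborel) = ennreal A2"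
    by (cases "\<integral>\<^sup>+x. indicator {0..1} x * ennreal (?e x) \<partial>lborel") auto
  define A3 where "A3 = 4 powr \<bar>Re a - 1\<bar>"
  define A4 where "A4 = (\<Sum>k<m. (4/3 :: real) ^ k)"
  define A5 where "A5 = 1 / t + 1"
  define A where "A = 3 * (4/3) ^ m * A2 + A3 * A4 * A5"
  have nn: "A1 \<ge> 0" "A3 \<ge> 0" "A4 \<ge> 0" "A5 \<ge> 0"
    using t by (auto simp: A1_def A3_def A4_def A5_def intro!: sum_nonneg)
  then have A0: "A \<ge> 0" using A2 by (simp add: A_def)
  have G: "Gamma t > 0" using t by (rule Gamma_real_pos)
  let ?K = "A1 + (A + A3) / Gamma t"
  show ?thesis
  proof (intro exI[of _ ?K] conjI ballI allI impI)
    show "0 \<le> ?K" using nn A0 G by simp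
    fix f :: "complex ^ 'n \<Rightarrow> complex" and B and z :: "complex ^ 'n"
    assume f: "f \<in> holomorphic_ball" and B: "\<forall>u\<in>cball 0 (3/4). norm (f u) \<le> B" and z: "z \<in> unit_ball"
    note cf = holomorphic_ball_chol[OF f]
    note [measurable] = holomorphic_ball_measurable[OF f]
    have B0: "B \<ge> 0" using B norm_ge_zero[of "f 0"] by (meson centre_in_cball divide_nonneg_nonneg order_trans zero_le_numeral)
    have hb: "norm (hom_part f k z) \<le> B * (4/3) ^ k" for k
    proof -
      have "norm (hom_part f k z) \<le> B * (norm z / (3/4)) ^ k"
        by (rule hom_part_bound[OF cf]) (use B in auto)
      also have "\<dots> \<le> B * (4/3) ^ k" by (intro mult_left_mono power_mono) (use z B0 in auto)
      finally show ?thesis .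
    qed
    let ?\<nu> = "\<lambda>k. if k < m then 0 else Gamma (a + of_nat k) / Gamma (a + of_nat k + of_real t)"
    let ?T = "\<Sum>k. ?\<nu> k * hom_part f k z"
    let ?I = "ray_integral t f z"
    have split: "multiplier \<mu> f z = (\<Sum>k<m. \<mu> k * hom_part f k z) + ?T"
    proof -
      have "(\<lambda>k. if k \<in> {..<m} then \<mu> k * hom_part f k z else 0) sums (\<Sum>k<m. \<mu> k * hom_part f k z)"
        by (rule sums_If_finite_set) simp
      from sums_diff[OF multiplier_sums[OF cf se z] this]
      have "(\<lambda>k. \<mu> k * hom_part f k z - (if k \<in> {..<m} then \<mu> k * hom_part f k z else 0)) sums (multiplier \<mu> f z - (\<Sum>k<m. \<mu> k * hom_part f k z))" .
      moreover have "(\<lambda>k. \<mu> k * hom_part f k z - (if k \<in> {..<m} then \<mu> k * hom_part f k z else 0)) = (\<lambda>k. ?\<nu> k * hom_part f k z)"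
        using \<mu> by auto
      ultimately show ?thesis by (simp add: sums_iff)
    qed
    have head: "norm (\<Sum>k<m. \<mu> k * hom_part f k z) \<le> A1 * B"
    proof -
      have "norm (\<Sum>k<m. \<mu> k * hom_part f k z) \<le> (\<Sum>k<m. norm (\<mu> k) * (B * (4/3) ^ k))"
        by (rule sum_norm_le) (auto simp: norm_mult intro!: mult_left_mono hb)
      then show ?thesis by (simp add: A1_def sum_distrib_left mult_ac)
    qed
    have tail_small: "norm (expansion_tail f m z x) \<le> 3 * (4/3) ^ m * B * x ^ m" if x: "x \<in> {0<..<1/2}" for x
    proof -
      let ?q = "4/3 * x"
      have q: "0 \<le> ?q" "?q < 1" using x by auto
      have b: "norm (if k < m then 0 else hom_part f k z * of_real x ^ k) \<le> (if k < m then 0 else B * ?q ^ k)" for k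
      proof -
        have "norm (hom_part f k z) * x ^ k \<le> (B * (4/3) ^ k) * x ^ k" using x by (intro mult_right_mono hb) auto
        also have "\<dots> = B * ?q ^ k" by (simp only: power_mult_distrib mult.assoc)
        finally show ?thesis using x by (simp add: norm_mult norm_power)
      qed
      have "(\<lambda>j. B * ?q ^ m * ?q ^ j) sums (B * ?q ^ m * (1 / (1 - ?q)))" using q by (intro sums_mult geometric_sums) simp
      then have "(\<lambda>j. if j + m < m then 0 else B * ?q ^ (j + m)) sums (B * ?q ^ m * (1 / (1 - ?q)))" by (simp add: power_add mult_ac)
      then have gs: "(\<lambda>k. if k < m then 0 else B * ?q ^ k) sums (B * ?q ^ m * (1 / (1 - ?q)))"
        using sums_iff_shift[of "\<lambda>k. if k < m then 0 else B * ?q ^ k" m] by simp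
      have ts: "(\<lambda>k. if k < m then 0 else hom_part f k z * of_real x ^ k) sums expansion_tail f m z x"
        by (rule expansion_tail_sums[OF cf z]) (use x in auto)
      have "norm (expansion_tail f m z x) \<le> (\<Sum>k. if k < m then 0 else B * ?q ^ k)"
        unfolding sums_unique[OF ts] by (rule norm_suminf_le[OF b sums_summable[OF gs]])
      also have "\<dots> = B * ?q ^ m * (1 / (1 - ?q))" using gs by (simp add: sums_iff)
      also have "\<dots> \<le> B * ?q ^ m * 3" using q x B0 by (intro mult_left_mono) (auto simp: field_simps)
      finally show ?thesis by (simp only: power_mult_distrib mult_ac)
    qed
    have tail_large: "norm (expansion_tail f m z x) \<le> norm (f (x *\<^sub>R z)) + A4 * B" if x: "x \<in> {1/2..1}" for x
    proof -
      have "norm (\<Sum>k<m. hom_part f k z * of_real x ^ k) \<le> (\<Sum>k<m. B * (4/3) ^ k)"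
      proof (rule sum_norm_le)
        fix k
        have "norm (hom_part f k z) * x ^ k \<le> (B * (4/3) ^ k) * 1" using x B0 by (intro mult_mono hb power_le_one) auto
        then show "norm (hom_part f k z * of_real x ^ k) \<le> B * (4/3) ^ k" using x by (simp add: norm_mult norm_power)
      qed
      also have "\<dots> = A4 * B" by (simp add: A4_def sum_distrib_left mult.commute)
      finally show ?thesis unfolding expansion_tail_def
        using norm_triangle_ineq4[of "f (x *\<^sub>R z)" "\<Sum>k<m. hom_part f k z * of_real x ^ k"] by linarith
    qed
    let ?J1 = "\<lambda>x::real. indicator {0..1} x * ennreal (?e x)"
    let ?J2 = "\<lambda>x::real. indicator {0..1} x * ennreal ((1 - x) powr (t - 1))"
    let ?J3 = "\<lambda>x::real. indicator {1/2..1} x * ennreal ((1 - x) powr (t - 1) * norm (f (x *\<^sub>R z)))"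
    have "ennreal (norm ?T * Gamma t) \<le> (\<integral>\<^sup>+x. indicator {0<..<1} x * ennreal (x powr (Re a - 1) * (1 - x) powr (t - 1) * norm (expansion_tail f m z x)) \<partial>lborel)"
      by (rule fractional_integral_bound[OF cf z t am])
    also have "\<dots> \<le> (\<integral>\<^sup>+x. ennreal (3 * (4/3) ^ m * B) * ?J1 x + (ennreal (A3 * A4 * B) * ?J2 x + ennreal A3 * ?J3 x) \<partial>lborel)"
    proof (rule nn_integral_mono)
      fix x :: real
      consider "x \<notin> {0<..<1}" | "x \<in> {0<..<1/2}" | "x \<in> {1/2..<1}" by force
      then show "indicator {0<..<1} x * ennreal (x powr (Re a - 1) * (1 - x) powr (t - 1) * norm (expansion_tail f m z x))
          \<le> ennreal (3 * (4/3) ^ m * B) * ?J1 x + (ennreal (A3 * A4 * B) * ?J2 x + ennreal A3 * ?J3 x)"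
      proof cases
        case 1
        then show ?thesis by (simp only: indicator_simps mult_zero_left zero_le not_False_eq_True)
      next
        case 2
        have "x powr (Re a - 1) * (1 - x) powr (t - 1) * norm (expansion_tail f m z x)
            \<le> x powr (Re a - 1) * (1 - x) powr (t - 1) * (3 * (4/3) ^ m * B * x ^ m)"
          by (intro mult_left_mono tail_small 2) auto
        also have "\<dots> = 3 * (4/3) ^ m * B * ((x powr (Re a - 1) * x ^ m) * (1 - x) powr (t - 1))" by (simp only: mult_ac)
        also have "x powr (Re a - 1) * x ^ m = x powr (Re a + real m - 1)"
        proof -
          have "x powr (Re a + real m - 1) = x powr ((Re a - 1) + real m)" by (simp add: algebra_simps)
          then show ?thesis using 2 by (simp add: powr_add powr_realpow)
        qed
        finally have "ennreal (x powr (Re a - 1) * (1 - x) powr (t - 1) * norm (expansion_tail f m z x)) \<le> ennreal (3 * (4/3) ^ m * B) * ennreal (?e x)"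
          using B0 by (subst ennreal_mult[symmetric]) (auto intro!: ennreal_leI)
        then show ?thesis using 2 by (simp add: add_increasing2)
      next
        case 3
        have "x powr (Re a - 1) \<le> 4 powr \<bar>Re a - 1\<bar> * 1 powr (Re a - 1)" using 3 by (intro powr_comparable) auto
        then have xa: "x powr (Re a - 1) \<le> A3" by (simp add: A3_def)
        have "x powr (Re a - 1) * (1 - x) powr (t - 1) * norm (expansion_tail f m z x)
            \<le> A3 * (1 - x) powr (t - 1) * (norm (f (x *\<^sub>R z)) + A4 * B)"
          using 3 nn by (intro mult_mono xa tail_large mult_right_mono) (auto intro!: mult_nonneg_nonneg add_nonneg_nonneg B0)
        also have "\<dots> = A3 * A4 * B * (1 - x) powr (t - 1) + A3 * ((1 - x) powr (t - 1) * norm (f (x *\<^sub>R z)))" by (simp add: algebra_simps)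
        finally have "ennreal (x powr (Re a - 1) * (1 - x) powr (t - 1) * norm (expansion_tail f m z x))
            \<le> ennreal (A3 * A4 * B) * ennreal ((1 - x) powr (t - 1)) + ennreal A3 * ennreal ((1 - x) powr (t - 1) * norm (f (x *\<^sub>R z)))"
          using nn B0 by (simp add: ennreal_leI flip: ennreal_mult ennreal_plus)
        then show ?thesis using 3 by (simp add: add_increasing)
      qed
    qed
    also have "\<dots> = ennreal (3 * (4/3) ^ m * B) * (\<integral>\<^sup>+x. ?J1 x \<partial>lborel) + (ennreal (A3 * A4 * B) * (\<integral>\<^sup>+x. ?J2 x \<partial>lborel) + ennreal A3 * ?I)"
      by (simp add: nn_integral_add nn_integral_cmult)
    also have "\<dots> \<le> ennreal (3 * (4/3) ^ m * B) * ennreal A2 + (ennreal (A3 * A4 * B) * ennreal A5 + ennreal A3 * ?I)"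
    proof -
      have "(\<integral>\<^sup>+x. ?J2 x \<partial>lborel) \<le> ennreal A5"
        using beta_tail_bound[of t "t + 1" 0] t by (simp add: A5_def)
      then show ?thesis unfolding A2(2) by (intro add_mono mult_left_mono order_refl) auto
    qed
    also have "\<dots> = ennreal (A * B) + ennreal A3 * ?I"
    proof -
      have "ennreal (3 * (4/3) ^ m * B) * ennreal A2 + ennreal (A3 * A4 * B) * ennreal A5 = ennreal (A * B)"
        using B0 A2(1) nn by (simp add: A_def algebra_simps flip: ennreal_mult ennreal_plus)
      then show ?thesis by (simp only: add.assoc[symmetric])
    qed
    finally have T: "ennreal (norm ?T * Gamma t) \<le> ennreal (A * B) + ennreal A3 * ?I" .
    have "ennreal (norm ?T) = ennreal (1 / Gamma t) * ennreal (norm ?T * Gamma t)"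
      using G by (simp flip: ennreal_mult)
    also have "\<dots> \<le> ennreal (1 / Gamma t) * (ennreal (A * B) + ennreal A3 * ?I)" by (intro mult_left_mono T) simp
    also have "\<dots> = ennreal (A * B / Gamma t) + ennreal (A3 / Gamma t) * ?I"
    proof -
      have "ennreal (1 / Gamma t) * ennreal (A * B) = ennreal (A * B / Gamma t)" "ennreal (1 / Gamma t) * ennreal A3 = ennreal (A3 / Gamma t)"
        using G A0 B0 nn by (simp_all flip: ennreal_mult)
      then show ?thesis by (simp only: distrib_left mult.assoc[symmetric])
    qed
    finally have T': "ennreal (norm ?T) \<le> ennreal (A * B / Gamma t) + ennreal (A3 / Gamma t) * ?I" .
    have "ennreal (norm (multiplier \<mu> f z)) \<le> ennreal (A1 * B + norm ?T)"
      unfolding split by (intro ennreal_leI order_trans[OF norm_triangle_ineq] add_right_mono head)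
    also have "\<dots> = ennreal (A1 * B) + ennreal (norm ?T)" using nn B0 by (intro ennreal_plus) auto
    also have "\<dots> \<le> ennreal (A1 * B) + (ennreal (A * B / Gamma t) + ennreal (A3 / Gamma t) * ?I)"
      by (intro add_left_mono T')
    also have "\<dots> = ennreal (A1 * B + A * B / Gamma t) + ennreal (A3 / Gamma t) * ?I"
      using nn B0 A0 G by (simp add: add.assoc)
    also have "\<dots> \<le> ennreal (?K * B) + ennreal ?K * ?I"
      using nn A0 G B0 by (intro add_mono ennreal_leI mult_right_mono) (auto simp: field_simps add_nonneg_nonneg)
    finally show "ennreal (norm (multiplier \<mu> f z)) \<le> ennreal (?K * B) + ennreal ?K * ?I" .
  qed
qed

text \<open>
The value at \<open>x z\<close> is bounded by the Whitney averages at all points \<open>y z\<close> with \<open>y\<close> in an interval of length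
\<open>(1 - x|z|) / 4\<close> ending at \<open>x\<close>. Integration over this interval produces the extra factor \<open>1 - x|z|\<close>.
\<close>

lemma ray_pointwise_bound:
  assumes p: "p > 0"
  shows "\<exists>C\<ge>0. \<forall>f \<in> (holomorphic_ball :: (complex ^ 'n \<Rightarrow> complex) set). \<forall>z\<in>unit_ball. \<forall>x\<in>{1/2..1}.
    ennreal (norm (f (x *\<^sub>R z)) powr p * (1 - x * norm z) powr q)
      \<le> ennreal C * ray_average p q f z"
proof -
  obtain C1 where C1: "C1 \<ge> 0" "\<And>(f :: complex ^ 'n \<Rightarrow> complex) z w. f \<in> holomorphic_ball \<Longrightarrow> z \<in> unit_ball \<Longrightarrow> dist z w \<le> (1 - norm z) / 2 \<Longrightarrow>
      ennreal (norm (f w) powr p) \<le> ennreal C1 * whitney_average p f z"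
    using pointwise_le_whitney_average[OF p, where 'n='n] by blast
  let ?K = "4 powr \<bar>q - 1\<bar> :: real"
  show ?thesis
  proof (intro exI[of _ "4 * ?K * C1"] conjI ballI)
    show "0 \<le> 4 * ?K * C1" using C1 by simp
    fix f :: "complex ^ 'n \<Rightarrow> complex" and z :: "complex ^ 'n" and x :: real
    assume f: "f \<in> holomorphic_ball" and z: "z \<in> unit_ball" and x: "x \<in> {1/2..1}"
    let ?e = "1 - x * norm z"
    let ?W = "\<lambda>y. ennreal ((1 - norm (y *\<^sub>R z)) powr (q - 1)) * whitney_average p f (y *\<^sub>R z)"
    have Wm: "whitney_average p f \<in> borel_measurable borel"
      by (rule whitney_average_measurable[OF holomorphic_ball_measurable[OF f]])
    have sm: "(\<lambda>y::real. y *\<^sub>R z) \<in> borel_measurable borel" by simp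
    have Wm': "?W \<in> borel_measurable borel"
      by (rule borel_measurable_times_ennreal[OF _ measurable_compose[OF sm Wm]]) simp
    have "indicator {1/4..1::real} \<in> borel_measurable borel" by (rule borel_measurable_indicator) simp
    from borel_measurable_times_ennreal[OF this Wm']
    have m: "(\<lambda>y. indicator {1/4..1} y * ?W y) \<in> borel_measurable lborel"
      by (simp only: measurable_cong_sets[OF sets_lborel refl])
    have "x * norm z \<le> 1 * norm z" using x by (intro mult_right_mono) auto
    then have e: "?e > 0" "?e \<le> 1" using z x by auto
    \<comment> \<open>on this interval \<open>1 - y|z|\<close> is comparable to \<open>1 - x|z|\<close>\<close>
    let ?I = "{x - ?e / 4..x}"
    have pt: "ennreal (norm (f (x *\<^sub>R z)) powr p * ?e powr (q - 1)) * indicator ?I y \<le> ennreal (?K * C1) * (indicator {1/4..1} y * ?W y)" for y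
    proof (cases "y \<in> ?I")
      case True
      have "x - ?e / 4 \<le> y" "y \<le> x" "1/2 \<le> x" "x \<le> 1" using True x by simp_all
      moreover have "1/4 \<le> y \<and> y \<le> 1 \<and> y \<le> x \<and> x - y \<le> d / 4"
        if "x - d / 4 \<le> y" "y \<le> x" "1/2 \<le> x" "x \<le> 1" "d \<le> 1" for d
        using that by auto
      ultimately have y: "1/4 \<le> y" "y \<le> 1" "y \<le> x" "x - y \<le> ?e / 4" using e(2) by blast+
      have "y * norm z \<le> x * norm z" "y * norm z \<le> 1 * norm z" using y by (intro mult_right_mono; simp)+
      moreover have ny: "norm (y *\<^sub>R z) = y * norm z" using y by simp
      ultimately have yz: "?e \<le> 1 - norm (y *\<^sub>R z)" "y *\<^sub>R z \<in> unit_ball" using z by auto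
      have "(x - y) * norm z \<le> (?e / 4) * 1" using y z e by (intro mult_mono) auto
      then have xyz: "(x - y) * norm z \<le> ?e / 4" by (simp only: mult_1_right)
      moreover have "dist (y *\<^sub>R z) (x *\<^sub>R z) = (x - y) * norm z" using y by (simp add: dist_norm flip: scaleR_left_diff_distrib)
      ultimately have close: "dist (y *\<^sub>R z) (x *\<^sub>R z) \<le> ?e / 4" by (simp only:)
      have "norm (f (x *\<^sub>R z)) powr p * ?e powr (q - 1) \<le> norm (f (x *\<^sub>R z)) powr p * (?K * (1 - norm (y *\<^sub>R z)) powr (q - 1))"
      proof (intro mult_left_mono powr_comparable)
        have "1 - norm (y *\<^sub>R z) = ?e + (x - y) * norm z" unfolding ny by (simp add: algebra_simps)
        also note xyz
        finally have "1 - norm (y *\<^sub>R z) \<le> ?e + ?e / 4" by simp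
        moreover have "v \<le> 4 * d" if "v \<le> d + d / 4" "0 < d" for v d :: real
          using that by linarith
        ultimately show "1 - norm (y *\<^sub>R z) \<le> 4 * ?e" using e(1) by blast
      qed (use yz e in auto)
      then have "ennreal (norm (f (x *\<^sub>R z)) powr p * ?e powr (q - 1)) \<le> ennreal (norm (f (x *\<^sub>R z)) powr p) * (ennreal ?K * ennreal ((1 - norm (y *\<^sub>R z)) powr (q - 1)))"
        by (simp add: ennreal_leI flip: ennreal_mult)
      also have "\<dots> \<le> (ennreal C1 * whitney_average p f (y *\<^sub>R z)) * (ennreal ?K * ennreal ((1 - norm (y *\<^sub>R z)) powr (q - 1)))"
        by (intro mult_right_mono C1(2)[OF f yz(2)]) (use close yz e in auto)
      also have "\<dots> = ennreal (?K * C1) * ?W y" using C1(1) by (simp add: ennreal_mult mult_ac)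
      finally have "ennreal (norm (f (x *\<^sub>R z)) powr p * ?e powr (q - 1)) \<le> ennreal (?K * C1) * ?W y" .
      moreover have "indicator ?I y = (1 :: ennreal)" by (rule indicator_simps(1)[OF True])
      moreover have "indicator {1/4..1} y = (1 :: ennreal)" using y by simp
      ultimately show ?thesis by (simp only: mult_1_left mult_1_right)
    qed (simp only: indicator_simps mult_zero_right zero_le not_False_eq_True)
    have "ennreal (norm (f (x *\<^sub>R z)) powr p * ?e powr (q - 1)) * ennreal (?e / 4)
        = (\<integral>\<^sup>+y. ennreal (norm (f (x *\<^sub>R z)) powr p * ?e powr (q - 1)) * indicator ?I y \<partial>lborel)"
      using e by (subst nn_integral_cmult_indicator) auto
    also have "\<dots> \<le> (\<integral>\<^sup>+y. ennreal (?K * C1) * (indicator {1/4..1} y * ?W y) \<partial>lborel)"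
      by (rule nn_integral_mono) (rule pt)
    also have "\<dots> = ennreal (?K * C1) * (\<integral>\<^sup>+y. indicator {1/4..1} y * ?W y \<partial>lborel)"
      by (rule nn_integral_cmult[OF m])
    finally have inner: "ennreal (norm (f (x *\<^sub>R z)) powr p * ?e powr (q - 1)) * ennreal (?e / 4)
        \<le> ennreal (?K * C1) * (\<integral>\<^sup>+y. indicator {1/4..1} y * ?W y \<partial>lborel)" .
    have "ennreal (norm (f (x *\<^sub>R z)) powr p * ?e powr q) = ennreal 4 * (ennreal (norm (f (x *\<^sub>R z)) powr p * ?e powr (q - 1)) * ennreal (?e / 4))"
    proof -
      have "?e powr q = ?e powr (q - 1) * ?e" using e by (simp add: powr_diff)
      then have "norm (f (x *\<^sub>R z)) powr p * ?e powr q = 4 * (norm (f (x *\<^sub>R z)) powr p * ?e powr (q - 1) * (?e / 4))" by simp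
      then show ?thesis using e by (simp only: ennreal_mult powr_ge_zero mult_nonneg_nonneg zero_le_numeral divide_nonneg_nonneg less_imp_le)
    qed
    also have "\<dots> \<le> ennreal 4 * (ennreal (?K * C1) * (\<integral>\<^sup>+y. indicator {1/4..1} y * ?W y \<partial>lborel))"
      by (rule mult_left_mono[OF inner]) simp
    also have "\<dots> = ennreal (4 * ?K * C1) * (\<integral>\<^sup>+y. indicator {1/4..1} y * ?W y \<partial>lborel)"
      using C1(1) by (simp only: ennreal_mult mult_nonneg_nonneg powr_ge_zero zero_le_numeral mult.assoc)
    finally show "ennreal (norm (f (x *\<^sub>R z)) powr p * ?e powr q) \<le> ennreal (4 * ?K * C1) * (\<integral>\<^sup>+y. indicator {1/4..1} y * ?W y \<partial>lborel)" .
  qed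
qed

text \<open>
The pointwise bound is inserted in the integral. Although it discards the decay of \<open>f\<close> along the ray, nothing
is lost in the power of \<open>1 - |z|\<close>, because \<open>q / p > t\<close>.
\<close>

lemma ray_integral_bound:
  assumes p: "p > 0" and t: "t > 0" and q: "q > t * p"
  shows "\<exists>C\<ge>0. \<forall>f \<in> (holomorphic_ball :: (complex ^ 'n \<Rightarrow> complex) set). \<forall>z\<in>unit_ball. \<forall>\<gamma>\<ge>0.
    ray_average p q f z = ennreal \<gamma> \<longrightarrow>
    ray_integral t f z
      \<le> ennreal (C * (\<gamma> powr (1 / p) * (1 - norm z) powr (t - q / p)))"
proof -
  obtain C where C: "C \<ge> 0" "\<And>(f :: complex ^ 'n \<Rightarrow> complex) z x. f \<in> holomorphic_ball \<Longrightarrow> z \<in> unit_ball \<Longrightarrow> x \<in> {1/2..1} \<Longrightarrow>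
    ennreal (norm (f (x *\<^sub>R z)) powr p * (1 - x * norm z) powr q)
      \<le> ennreal C * ray_average p q f z"
    using ray_pointwise_bound[OF p, where 'n='n] by blast
  have qt: "q / p > t" using q p by (simp add: field_simps)
  define A where "A = 1 / t + 1 / (q / p - t)"
  have A: "A \<ge> 0" using t qt by (simp add: A_def)
  show ?thesis
  proof (intro exI[of _ "C powr (1 / p) * A"] conjI ballI allI impI)
    show "0 \<le> C powr (1 / p) * A" using A by simp
    fix f :: "complex ^ 'n \<Rightarrow> complex" and z :: "complex ^ 'n" and \<gamma> :: real
    assume f: "f \<in> holomorphic_ball" and z: "z \<in> unit_ball" and \<gamma>: "0 \<le> \<gamma>"
      and I: "ray_average p q f z = ennreal \<gamma>"
    let ?G = "(C * \<gamma>) powr (1 / p)"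
    have pt: "norm (f (x *\<^sub>R z)) \<le> ?G * (1 - x * norm z) powr - (q / p)" if x: "x \<in> {1/2..1}" for x
    proof -
      have "x * norm z \<le> 1 * norm z" using x by (intro mult_right_mono) auto
      then have e: "1 - x * norm z > 0" using z by simp
      have "ennreal (norm (f (x *\<^sub>R z)) powr p * (1 - x * norm z) powr q) \<le> ennreal (C * \<gamma>)"
        using C(2)[OF f z x] unfolding I ennreal_mult[OF C(1) \<gamma>] .
      then have "norm (f (x *\<^sub>R z)) powr p * (1 - x * norm z) powr q \<le> C * \<gamma>"
        using C(1) \<gamma> by (subst (asm) ennreal_le_iff) auto
      moreover have "(norm (f (x *\<^sub>R z)) * (1 - x * norm z) powr (q / p)) powr p = norm (f (x *\<^sub>R z)) powr p * (1 - x * norm z) powr q"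
        using p by (simp add: powr_mult powr_powr)
      ultimately have "norm (f (x *\<^sub>R z)) * (1 - x * norm z) powr (q / p) \<le> ?G"
        using p by (intro le_powr_inverse) auto
      then show ?thesis using e by (simp add: powr_minus field_simps)
    qed
    have "ray_integral t f z
      \<le> (\<integral>\<^sup>+x. ennreal ?G * (indicator {0..1} x * ennreal ((1 - x) powr (t - 1) * (1 - x * norm z) powr - (q / p))) \<partial>lborel)"
    proof (rule nn_integral_mono)
      fix x :: real
      show "indicator {1/2..1} x * ennreal ((1 - x) powr (t - 1) * norm (f (x *\<^sub>R z)))
        \<le> ennreal ?G * (indicator {0..1} x * ennreal ((1 - x) powr (t - 1) * (1 - x * norm z) powr - (q / p)))"
      proof (cases "x \<in> {1/2..1}")
        case True
        have "(1 - x) powr (t - 1) * norm (f (x *\<^sub>R z)) \<le> (1 - x) powr (t - 1) * (?G * (1 - x * norm z) powr - (q / p))"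
          by (intro mult_left_mono pt True) simp
        also have "\<dots> = ?G * ((1 - x) powr (t - 1) * (1 - x * norm z) powr - (q / p))" by (simp only: mult_ac)
        finally have "ennreal ((1 - x) powr (t - 1) * norm (f (x *\<^sub>R z))) \<le> ennreal ?G * ennreal ((1 - x) powr (t - 1) * (1 - x * norm z) powr - (q / p))"
          by (simp add: ennreal_leI flip: ennreal_mult)
        then show ?thesis using True by simp
      qed (simp only: indicator_simps mult_zero_left zero_le not_False_eq_True)
    qed
    also have "\<dots> = ennreal ?G * (\<integral>\<^sup>+x. indicator {0..1} x * ennreal ((1 - x) powr (t - 1) * (1 - x * norm z) powr - (q / p)) \<partial>lborel)"
      by (rule nn_integral_cmult) measurable
    also have "\<dots> \<le> ennreal ?G * ennreal (A * (1 - norm z) powr (t - q / p))"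
      unfolding A_def by (rule mult_left_mono[OF beta_tail_bound[OF t qt]]) (use z in auto)
    also have "\<dots> = ennreal (C powr (1 / p) * A * (\<gamma> powr (1 / p) * (1 - norm z) powr (t - q / p)))"
      using A C(1) \<gamma> by (simp add: powr_mult mult_ac flip: ennreal_mult)
    finally show "ray_integral t f z
      \<le> ennreal (C powr (1 / p) * A * (\<gamma> powr (1 / p) * (1 - norm z) powr (t - q / p)))" .
  qed
qed

text \<open>
The bounds along rays give \<open>|\<mu> f|^p \<le> C (B^p + (1 - |z|)^(tp-q) G)\<close>, where \<open>G\<close> is the integral of the Whitney
averages over the ray. Multiplied by \<open>(1 - |z|)^b\<close>, the second summand carries the exponent
\<open>b' = b + t p - q\<close>; with \<open>-1 < b' < b\<close> it can be integrated over the ball, and the ray integral then restores the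
exponent \<open>b + t p\<close>.
\<close>

lemma weight_bounded_fractional:
  fixes \<mu> :: "nat \<Rightarrow> complex" and t :: real
  assumes p: "p > 0" and t: "t > 0" and b: "b > -1" and am: "Re a + real m > 0" and se: "subexponential \<mu>"
    and \<mu>: "\<And>k. k \<ge> m \<Longrightarrow> \<mu> k = Gamma (a + of_nat k) / Gamma (a + of_nat k + of_real t)"
  shows "weight_bounded TYPE('n::finite) p \<mu> (b + t * p) b"
proof -
  let ?\<beta> = "b + t * p"
  \<comment> \<open>any exponent strictly between \<open>-1\<close> and \<open>b\<close>\<close>
  define b' where "b' = (b - 1) / 2"
  have b': "b' > -1" "b' < b" using b by (auto simp: b'_def)
  define q where "q = ?\<beta> - b'"
  have q: "q > t * p" using b' by (simp add: q_def)
  obtain K where K: "K \<ge> 0" "\<And>(f :: complex ^ 'n \<Rightarrow> complex) B z. f \<in> holomorphic_ball \<Longrightarrow> (\<And>u. u \<in> cball 0 (3/4) \<Longrightarrow> norm (f u) \<le> B) \<Longrightarrow> z \<in> unit_ball \<Longrightarrow>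
     ennreal (norm (multiplier \<mu> f z)) \<le> ennreal (K * B) + ennreal K * ray_integral t f z"
    using multiplier_pointwise_bound[OF t am se \<mu>, where 'n='n] by blast
  obtain C1 where C1: "C1 \<ge> 0" "\<And>(f :: complex ^ 'n \<Rightarrow> complex) z \<gamma>. f \<in> holomorphic_ball \<Longrightarrow> z \<in> unit_ball \<Longrightarrow> \<gamma> \<ge> 0 \<Longrightarrow>
    ray_average p q f z = ennreal \<gamma> \<Longrightarrow>
    ray_integral t f z
      \<le> ennreal (C1 * (\<gamma> powr (1 / p) * (1 - norm z) powr (t - q / p)))"
    using ray_integral_bound[OF p t q, where 'n='n] by blast
  obtain C2 where C2: "C2 \<ge> 0" "\<And>H :: complex ^ 'n \<Rightarrow> ennreal. H \<in> borel_measurable borel \<Longrightarrow>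
    (\<integral>\<^sup>+z. indicator unit_ball z * (ennreal ((1 - norm z) powr b') * (\<integral>\<^sup>+x. indicator {1/4..1} x * H (x *\<^sub>R z) \<partial>lborel)) \<partial>lborel)
    \<le> ennreal C2 * (\<integral>\<^sup>+u. indicator unit_ball u * (ennreal ((1 - norm u) powr (b' + 1)) * H u) \<partial>lborel)"
    using radial_average_le[OF b'(1), where 'n='n] by blast
  obtain C3 where C3: "C3 \<ge> 0" "\<And>f :: complex ^ 'n \<Rightarrow> complex. f \<in> borel_measurable borel \<Longrightarrow>
    (\<integral>\<^sup>+z. indicator unit_ball z * (ennreal ((1 - norm z) powr ?\<beta>) * whitney_average p f z) \<partial>lborel) \<le> ennreal C3 * weighted_integral p ?\<beta> f"
    using integral_whitney_average_le[where 'n='n and p=p and b="?\<beta>"] by blast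
  obtain C4 where C4: "C4 \<ge> 0" "\<And>(f :: complex ^ 'n \<Rightarrow> complex) u. f \<in> holomorphic_ball \<Longrightarrow> u \<in> cball 0 (3/4) \<Longrightarrow>
    ennreal (norm (f u) powr p) \<le> ennreal C4 * weighted_integral p ?\<beta> f"
    using interior_sup_le_weighted_integral[OF p, where 'n='n and b="?\<beta>"] by blast
  obtain V where V: "V \<ge> 0" "(\<integral>\<^sup>+(z :: complex ^ 'n). indicator unit_ball z * ennreal ((1 - norm z) powr b) \<partial>lborel) = ennreal V"
    using radial_weight_integrable[OF b, where 'n='n]
    by (cases "\<integral>\<^sup>+(z :: complex ^ 'n). indicator unit_ball z * ennreal ((1 - norm z) powr b) \<partial>lborel") auto
  define L where "L = 2 powr p * K powr p"
  define M where "M = C1 powr p + 1"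
  have L: "L \<ge> 0" and M: "M > 0" by (simp_all add: L_def M_def add_nonneg_pos)
  show ?thesis unfolding weight_bounded_def
  proof (intro exI[of _ "(L + 1) * (C4 * V + M * (C2 * C3)) + 1"] conjI ballI se)
    show "0 \<le> (L + 1) * (C4 * V + M * (C2 * C3)) + 1" using L M C2(1) C3(1) C4(1) V(1) by simp
    fix f :: "complex ^ 'n \<Rightarrow> complex" assume f: "f \<in> holomorphic_ball"
    note [measurable] = holomorphic_ball_measurable[OF f]
    have Wm [measurable]: "whitney_average p f \<in> borel_measurable borel"
      by (rule whitney_average_measurable[OF holomorphic_ball_measurable[OF f]])
    have [measurable]: "unit_ball \<in> sets (borel :: (complex ^ 'n) measure)" by simp
    let ?H = "\<lambda>u. ennreal ((1 - norm u) powr (q - 1)) * whitney_average p f u"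
    have Hm [measurable]: "?H \<in> borel_measurable borel" by measurable
    let ?G = "\<lambda>z. \<integral>\<^sup>+y. indicator {1/4..1} y * ?H (y *\<^sub>R z) \<partial>lborel"
    have Gm [measurable]: "?G \<in> borel_measurable borel" by measurable
    let ?C = "(L + 1) * (C4 * V + M * (C2 * C3)) + 1"
    show "weighted_integral p b (multiplier \<mu> f) \<le> ennreal ?C * weighted_integral p ?\<beta> f"
    proof (cases "weighted_integral p ?\<beta> f")
      case (real \<omega>)
      define B where "B = (C4 * \<omega>) powr (1 / p)"
      have B0: "B \<ge> 0" by (simp add: B_def)
      have Bp: "B powr p = C4 * \<omega>" using p C4(1) real by (simp add: B_def powr_powr)
      have fB: "norm (f u) \<le> B" if "u \<in> cball 0 (3/4)" for u
        unfolding B_def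
      proof (rule le_powr_inverse)
        have "ennreal (norm (f u) powr p) \<le> ennreal (C4 * \<omega>)" using C4(2)[OF f that] real C4(1) by (simp add: ennreal_mult)
        then show "norm (f u) powr p \<le> C4 * \<omega>" using real C4(1) by (subst (asm) ennreal_le_iff) auto
      qed (use p in auto)
      have pt: "ennreal (norm (multiplier \<mu> f z) powr p) \<le> ennreal (L + 1) * (ennreal (C4 * \<omega>) + ennreal (M * (1 - norm z) powr (t * p - q)) * ?G z)"
        if z: "z \<in> unit_ball" for z
      proof (cases "?G z")
        case (real \<gamma>)
        let ?X = "C1 * (\<gamma> powr (1 / p) * (1 - norm z) powr (t - q / p))"
        have X0: "?X \<ge> 0" using C1(1) by simp
        have "ennreal (norm (multiplier \<mu> f z)) \<le> ennreal (K * B) + ennreal K * ray_integral t f z"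
          by (rule K(2)[OF f fB z])
        also have "\<dots> \<le> ennreal (K * B) + ennreal K * ennreal ?X"
          by (intro add_left_mono mult_left_mono C1(2)[OF f z _ real(2)]) (use real in auto)
        also have "\<dots> = ennreal (K * B + K * ?X)" using K(1) B0 X0 by (simp flip: ennreal_mult ennreal_plus)
        finally have "norm (multiplier \<mu> f z) \<le> K * (B + ?X)"
          using K(1) B0 X0 by (subst (asm) ennreal_le_iff) (auto simp: distrib_left)
        then have "norm (multiplier \<mu> f z) powr p \<le> (K * (B + ?X)) powr p" using p by (intro powr_mono2) auto
        also have "\<dots> = K powr p * (B + ?X) powr p" by (rule powr_mult)
        also have "\<dots> \<le> K powr p * (2 powr p * (B powr p + ?X powr p))"
          using B0 X0 p by (intro mult_left_mono powr_add_le) auto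
        also have "\<dots> = L * (B powr p + ?X powr p)" by (simp add: L_def)
        also have "\<dots> \<le> (L + 1) * (C4 * \<omega> + M * (1 - norm z) powr (t * p - q) * \<gamma>)"
        proof (rule mult_mono)
          have "?X powr p = C1 powr p * (\<gamma> * (1 - norm z) powr (t * p - q))"
          proof -
            have "(t - q / p) * p = t * p - q" using p by (simp add: field_simps)
            then show ?thesis using p real by (simp add: powr_mult powr_powr)
          qed
          also have "\<dots> \<le> M * (\<gamma> * (1 - norm z) powr (t * p - q))" using real by (intro mult_right_mono) (auto simp: M_def)
          finally show "B powr p + ?X powr p \<le> C4 * \<omega> + M * (1 - norm z) powr (t * p - q) * \<gamma>"
            unfolding Bp by (simp add: mult_ac)
        qed (use L in auto)
        finally have "ennreal (norm (multiplier \<mu> f z) powr p) \<le> ennreal ((L + 1) * (C4 * \<omega> + M * (1 - norm z) powr (t * p - q) * \<gamma>))" by (rule ennreal_leI)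
        also have "\<dots> = ennreal (L + 1) * (ennreal (C4 * \<omega>) + ennreal (M * (1 - norm z) powr (t * p - q)) * ennreal \<gamma>)"
          using L M C4(1) real \<open>0 \<le> \<omega>\<close> by (simp add: ennreal_mult ennreal_plus)
        finally show ?thesis unfolding real(2) .
      next
        case top
        have "M * (1 - norm z) powr (t * p - q) > 0" using M z by simp
        then have "ennreal (M * (1 - norm z) powr (t * p - q)) \<noteq> 0" "ennreal (L + 1) \<noteq> 0" using L by (simp_all add: ennreal_eq_0_iff)
        then show ?thesis unfolding top by (simp add: ennreal_mult_top)
      qed
      have "weighted_integral p b (multiplier \<mu> f)
        \<le> (\<integral>\<^sup>+z. ennreal (L + 1) * (ennreal (C4 * \<omega>) * (indicator unit_ball z * ennreal ((1 - norm z) powr b)) + ennreal M * (indicator unit_ball z * (ennreal ((1 - norm z) powr b') * ?G z))) \<partial>lborel)"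
        unfolding weighted_integral_def
      proof (rule nn_integral_mono)
        fix z :: "complex ^ 'n"
        show "indicator unit_ball z * ennreal ((1 - norm z) powr b * norm (multiplier \<mu> f z) powr p)
          \<le> ennreal (L + 1) * (ennreal (C4 * \<omega>) * (indicator unit_ball z * ennreal ((1 - norm z) powr b)) + ennreal M * (indicator unit_ball z * (ennreal ((1 - norm z) powr b') * ?G z)))"
        proof (cases "z \<in> unit_ball")
          case True
          have e: "ennreal ((1 - norm z) powr b) * ennreal (M * (1 - norm z) powr (t * p - q)) = ennreal M * ennreal ((1 - norm z) powr b')"
          proof -
            have "(1 - norm z) powr b * (1 - norm z) powr (t * p - q) = (1 - norm z) powr b'"
              by (simp add: q_def flip: powr_add)
            then have "(1 - norm z) powr b * (M * (1 - norm z) powr (t * p - q)) = M * (1 - norm z) powr b'" by (simp add: mult.left_commute)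
            then show ?thesis using M by (simp flip: ennreal_mult)
          qed
          have "ennreal ((1 - norm z) powr b * norm (multiplier \<mu> f z) powr p) = ennreal ((1 - norm z) powr b) * ennreal (norm (multiplier \<mu> f z) powr p)"
            by (simp add: ennreal_mult)
          also have "\<dots> \<le> ennreal ((1 - norm z) powr b) * (ennreal (L + 1) * (ennreal (C4 * \<omega>) + ennreal (M * (1 - norm z) powr (t * p - q)) * ?G z))"
            by (rule mult_left_mono[OF pt[OF True]]) simp
          also have "\<dots> = ennreal (L + 1) * (ennreal (C4 * \<omega>) * ennreal ((1 - norm z) powr b) + (ennreal ((1 - norm z) powr b) * ennreal (M * (1 - norm z) powr (t * p - q))) * ?G z)"
            by (simp only: distrib_left mult_ac)
          also have "\<dots> = ennreal (L + 1) * (ennreal (C4 * \<omega>) * ennreal ((1 - norm z) powr b) + ennreal M * (ennreal ((1 - norm z) powr b') * ?G z))"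
            unfolding e by (simp only: mult.assoc)
          finally show ?thesis using True by simp
        qed (simp only: indicator_simps mult_zero_left zero_le not_False_eq_True)
      qed
      also have "\<dots> = ennreal (L + 1) * (ennreal (C4 * \<omega>) * ennreal V + ennreal M * (\<integral>\<^sup>+z. indicator unit_ball z * (ennreal ((1 - norm z) powr b') * ?G z) \<partial>lborel))"
      proof -
        have m1: "(\<lambda>z :: complex ^ 'n. indicator unit_ball z * ennreal ((1 - norm z) powr b)) \<in> borel_measurable lborel"
          and m2: "(\<lambda>z. indicator unit_ball z * (ennreal ((1 - norm z) powr b') * ?G z)) \<in> borel_measurable lborel" by measurable
        note ma = borel_measurable_times_ennreal[OF measurable_const[of "ennreal (C4 * \<omega>)"] m1] borel_measurable_times_ennreal[OF measurable_const[of "ennreal M"] m2]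
        show ?thesis
          by (simp only: nn_integral_cmult[OF borel_measurable_add[OF ma]] nn_integral_add[OF ma] nn_integral_cmult[OF m1] nn_integral_cmult[OF m2] V(2)
              UNIV_I space_borel)
      qed
      also have "(\<integral>\<^sup>+z. indicator unit_ball z * (ennreal ((1 - norm z) powr b') * ?G z) \<partial>lborel)
          \<le> ennreal C2 * (\<integral>\<^sup>+u. indicator unit_ball u * (ennreal ((1 - norm u) powr (b' + 1)) * ?H u) \<partial>lborel)"
        by (rule C2(2)[OF Hm])
      also have "(\<integral>\<^sup>+u. indicator unit_ball u * (ennreal ((1 - norm u) powr (b' + 1)) * ?H u) \<partial>lborel)
          = (\<integral>\<^sup>+u. indicator unit_ball u * (ennreal ((1 - norm u) powr ?\<beta>) * whitney_average p f u) \<partial>lborel)"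
      proof (rule nn_integral_cong)
        fix u :: "complex ^ 'n"
        have "(1 - norm u) powr (b' + 1) * (1 - norm u) powr (q - 1) = (1 - norm u) powr ?\<beta>"
          by (simp add: q_def flip: powr_add)
        then have "ennreal ((1 - norm u) powr (b' + 1)) * ennreal ((1 - norm u) powr (q - 1)) = ennreal ((1 - norm u) powr ?\<beta>)"
          by (simp flip: ennreal_mult)
        then show "indicator unit_ball u * (ennreal ((1 - norm u) powr (b' + 1)) * ?H u) = indicator unit_ball u * (ennreal ((1 - norm u) powr ?\<beta>) * whitney_average p f u)"
          by (simp only: mult.assoc[symmetric])
      qed
      also have "\<dots> \<le> ennreal C3 * weighted_integral p ?\<beta> f" by (rule C3(2)) measurable
      finally have "weighted_integral p b (multiplier \<mu> f) \<le> ennreal (L + 1) * (ennreal (C4 * \<omega>) * ennreal V + ennreal M * (ennreal C2 * (ennreal C3 * ennreal \<omega>)))"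
        unfolding real(2) by (simp add: mult_left_mono add_left_mono)
      also have "\<dots> = ennreal ((L + 1) * (C4 * V + M * (C2 * C3)) * \<omega>)"
        using L M C2(1) C3(1) C4(1) V(1) real(1) by (simp add: algebra_simps flip: ennreal_mult ennreal_plus)
      also have "\<dots> \<le> ennreal (?C * \<omega>)" using real(1) by (intro ennreal_leI mult_right_mono) auto
      also have "\<dots> = ennreal ?C * weighted_integral p ?\<beta> f"
        unfolding real(2) using L M C2(1) C3(1) C4(1) V(1) real(1) by (intro ennreal_mult) auto
      finally show ?thesis .
    next
      case top
      have "?C > 0" using L M C2(1) C3(1) C4(1) V(1) by (intro add_nonneg_pos) auto
      then have "ennreal ?C \<noteq> 0" by (simp add: ennreal_eq_0_iff)
      then show ?thesis unfolding top by (simp add: ennreal_mult_top)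
    qed
  qed
qed

section \<open>Quotients of Gamma values as multipliers\<close>

lemma exists_shift_Re_pos: "\<exists>m::nat. Re a + real m > 0"
  by (rule exI[of _ "nat \<lceil>\<bar>Re a\<bar>\<rceil> + 1"]) linarith

lemma weight_bounded_Gamma_ratio:
  fixes t :: real
  assumes "p > 0" "t > 0" "b > -1"
  shows "weight_bounded TYPE('n::finite) p (\<lambda>k. Gamma (a + of_nat k) / Gamma (a + of_nat k + of_real t)) (b + t * p) b"
proof -
  obtain m where m: "Re a + real m > 0" using exists_shift_Re_pos by blast
  have se: "subexponential (\<lambda>k. Gamma (a + of_nat k) / Gamma (a + of_nat k + of_real t))"
    using subexponential_Gamma_ratio[of a "a + of_real t"] by (simp add: add_ac)
  show ?thesis by (rule weight_bounded_fractional[OF assms m se]) simp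
qed

text \<open>
\<open>1 / k = \<Gamma>(k) / \<Gamma>(k + 1)\<close> for \<open>k \<ge> 1\<close>, so division by \<open>k\<close> is a fractional integral of order \<open>1\<close>.
\<close>

lemma weight_bounded_inverse_power:
  assumes p: "p > 0"
  shows "b > -1 \<Longrightarrow> weight_bounded TYPE('n::finite) p (\<lambda>j. (1 / of_nat j) ^ k) (b + p * real k) b"
proof (induction k)
  case 0
  show ?case using weight_bounded_one[where 'n='n] by simp
next
  case (Suc k)
  let ?\<nu> = "\<lambda>j. (1 / of_nat j :: complex)"
  have se: "subexponential ?\<nu>"
  proof (rule subexponential_bounded)
    show "norm (?\<nu> j) \<le> 1" for j by (cases j) (simp_all add: norm_divide del: of_nat_Suc)
  qed
  have b: "b + p * real k > -1"
  proof -
    have "p * real k \<ge> 0" using p by simp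
    then show ?thesis using Suc.prems by linarith
  qed
  \<comment> \<open>index \<open>0\<close> is exempt: there \<open>1 / 0 = 0\<close> and \<open>\<Gamma>\<close> has a pole\<close>
  have ratio: "?\<nu> j = Gamma (0 + of_nat j) / Gamma (0 + of_nat j + of_real 1)" if "1 \<le> j" for j
  proof -
    have n: "(of_nat j :: complex) \<notin> \<int>\<^sub>\<le>\<^sub>0" using that by (intro Re_pos_not_nonpos_Int) simp
    then show ?thesis using Gamma_plus1[OF n] Gamma_eq_zero_iff[of "of_nat j :: complex"] by simp
  qed
  have am: "Re 0 + real 1 > 0" by simp
  have e: "b + p * real (Suc k) = b + p * real k + 1 * p" by (simp add: algebra_simps)
  have "weight_bounded TYPE('n) p ?\<nu> (b + p * real k + 1 * p) (b + p * real k)"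
    by (rule weight_bounded_fractional[OF p zero_less_one b am se ratio])
  from weight_bounded_mult[OF this Suc.IH[OF Suc.prems]] show ?case
    unfolding e by (simp add: mult.commute)
qed

lemma weighted_integral_lincomb_le:
  fixes u v :: "complex ^ 'n \<Rightarrow> complex"
  assumes p: "p > 0" and [measurable]: "u \<in> borel_measurable borel" "v \<in> borel_measurable borel"
  shows "weighted_integral p b (\<lambda>z. c * u z + v z)
    \<le> ennreal (2 powr p * norm c powr p) * weighted_integral p b u + ennreal (2 powr p) * weighted_integral p b v"
proof -
  have ub [measurable]: "unit_ball \<in> sets (borel :: (complex ^ 'n) measure)" by simp
  let ?I = "\<lambda>g z. indicator unit_ball z * ennreal ((1 - norm z) powr b * norm (g z) powr p)"
  have m: "?I u \<in> borel_measurable lborel" "?I v \<in> borel_measurable lborel" by measurable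
  have "weighted_integral p b (\<lambda>z. c * u z + v z) \<le> (\<integral>\<^sup>+z. ennreal (2 powr p * norm c powr p) * ?I u z + ennreal (2 powr p) * ?I v z \<partial>lborel)"
    unfolding weighted_integral_def
  proof (rule nn_integral_mono)
    fix z :: "complex ^ 'n"
    have "norm (c * u z + v z) powr p \<le> (norm c * norm (u z) + norm (v z)) powr p"
      using p norm_triangle_ineq[of "c * u z" "v z"] by (intro powr_mono2) (auto simp: norm_mult)
    also have "\<dots> \<le> 2 powr p * ((norm c * norm (u z)) powr p + norm (v z) powr p)"
      using p by (intro powr_add_le) auto
    finally have "(1 - norm z) powr b * norm (c * u z + v z) powr p \<le> (1 - norm z) powr b * (2 powr p * ((norm c * norm (u z)) powr p + norm (v z) powr p))"
      by (rule mult_left_mono) simp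
    also have "\<dots> = 2 powr p * norm c powr p * ((1 - norm z) powr b * norm (u z) powr p) + 2 powr p * ((1 - norm z) powr b * norm (v z) powr p)"
      by (simp add: powr_mult algebra_simps)
    finally have "ennreal ((1 - norm z) powr b * norm (c * u z + v z) powr p)
      \<le> ennreal (2 powr p * norm c powr p * ((1 - norm z) powr b * norm (u z) powr p) + 2 powr p * ((1 - norm z) powr b * norm (v z) powr p))"
      by (rule ennreal_leI)
    then have le: "ennreal ((1 - norm z) powr b * norm (c * u z + v z) powr p)
      \<le> ennreal (2 powr p * norm c powr p) * ennreal ((1 - norm z) powr b * norm (u z) powr p) + ennreal (2 powr p) * ennreal ((1 - norm z) powr b * norm (v z) powr p)"
      by (simp only: ennreal_mult ennreal_plus powr_ge_zero mult_nonneg_nonneg)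
    show "indicator unit_ball z * ennreal ((1 - norm z) powr b * norm (c * u z + v z) powr p) \<le> ennreal (2 powr p * norm c powr p) * ?I u z + ennreal (2 powr p) * ?I v z"
    proof (cases "z \<in> unit_ball")
      case True
      then show ?thesis using le by (simp only: indicator_simps mult_1_left)
    qed (simp only: indicator_simps mult_zero_left zero_le not_False_eq_True)
  qed
  also have "\<dots> = (\<integral>\<^sup>+z. ennreal (2 powr p * norm c powr p) * ?I u z \<partial>lborel) + (\<integral>\<^sup>+z. ennreal (2 powr p) * ?I v z \<partial>lborel)"
    by (rule nn_integral_add) (intro borel_measurable_times_ennreal[OF measurable_const] m UNIV_I; simp)+
  also have "\<dots> = ennreal (2 powr p * norm c powr p) * weighted_integral p b u + ennreal (2 powr p) * weighted_integral p b v"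
    unfolding weighted_integral_def by (simp only: nn_integral_cmult[OF m(1)] nn_integral_cmult[OF m(2)])
  finally show ?thesis .
qed

lemma Gamma_add_of_nat:
  fixes z :: complex
  assumes "z \<notin> \<int>\<^sub>\<le>\<^sub>0"
  shows "Gamma (z + of_nat M) = (\<Prod>i<M. z + of_nat i) * Gamma z"
  using pochhammer_Gamma[OF assms, of M] Gamma_eq_zero_iff[of z] assms
  by (simp add: pochhammer_prod atLeast0LessThan)

lemma add_of_nat_nonpos_Int: "a \<notin> \<int>\<^sub>\<le>\<^sub>0 \<Longrightarrow> a + of_nat k \<notin> \<int>\<^sub>\<le>\<^sub>0" for a :: complex
proof (rule contrapos_nn)
  assume "a + of_nat k \<in> \<int>\<^sub>\<le>\<^sub>0"
  then obtain i where i: "a + of_nat k = of_int i" "i \<le> 0" by (rule nonpos_Ints_cases)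
  have "a = of_int (i - int k)" using i(1) by (simp add: algebra_simps)
  then show "a \<in> \<int>\<^sub>\<le>\<^sub>0" using i(2) by (simp only: of_int_in_nonpos_Ints_iff)
qed

lemma shift_prod_nonzero:
  fixes a :: complex
  assumes "a \<notin> \<int>\<^sub>\<le>\<^sub>0"
  shows "(\<Prod>i<M. of_nat j + (a + of_nat i)) \<noteq> (0 :: complex)"
proof -
  have "of_nat j + (a + of_nat i) \<noteq> 0" for i
  proof
    assume "of_nat j + (a + of_nat i) = 0"
    then have "a + of_nat (i + j) = 0" by (simp add: add_ac)
    then show False using add_of_nat_nonpos_Int[OF assms, of "i + j"] by simp
  qed
  then show ?thesis by simp
qed

lemma Gamma_shift_eq:
  fixes a :: complex
  assumes "a \<notin> \<int>\<^sub>\<le>\<^sub>0"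
  shows "Gamma (a + of_nat j + of_nat M) = (\<Prod>i<M. of_nat j + (a + of_nat i)) * Gamma (a + of_nat j)"
  using Gamma_add_of_nat[OF add_of_nat_nonpos_Int[OF assms], of j M] by (simp add: add_ac)

text \<open>
\<open>M + k\<close> differentiations raise the exponent from \<open>0\<close> to \<open>p (M + k)\<close>, and a fractional integral of order \<open>M - t\<close> lowers it to the
required value.
\<close>

lemma weight_bounded_frac_inverse:
  fixes t :: real
  assumes p: "p > 0" and a: "a \<notin> \<int>\<^sub>\<le>\<^sub>0" and kt: "p * real k + t * p > -1"
  shows "weight_bounded TYPE('n::finite) p
    (\<lambda>j. of_nat j ^ k * (c * (Gamma (a + of_real t + of_nat j) / Gamma (a + of_nat j)))) 0 (p * real k + t * p)"
proof -
  define M where "M = nat \<lceil>\<bar>t\<bar>\<rceil> + 1"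
  \<comment> \<open>order of the fractional integral that compensates \<open>M\<close> differentiations\<close>
  define s where "s = real M - t"
  have s: "s > 0" unfolding s_def M_def by linarith
  let ?\<nu> = "\<lambda>j. Gamma (a + of_real t + of_nat j) / Gamma (a + of_real t + of_nat j + of_real s)"
  let ?P = "\<lambda>j. \<Prod>i<M. of_nat j + (a + of_nat i)" and ?Q = "\<lambda>j. \<Prod>i<k. of_nat j + (0 :: complex)"
  have e: "p * real k + t * p + s * p = 0 + p * real M + p * real k" by (simp add: s_def algebra_simps)
  have P: "weight_bounded TYPE('n) p ?P 0 (0 + p * real M)"
    by (rule weight_bounded_shifts[OF p, where c="\<lambda>i. a + of_nat i"])
  have Q: "weight_bounded TYPE('n) p ?Q (0 + p * real M) (0 + p * real M + p * real k)"
    by (rule weight_bounded_shifts[OF p, where c="\<lambda>_. 0"])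
  have \<nu>: "weight_bounded TYPE('n) p ?\<nu> (0 + p * real M + p * real k) (p * real k + t * p)"
    using weight_bounded_Gamma_ratio[OF p s kt] unfolding e .
  have seq: "of_nat j ^ k * (c * (Gamma (a + of_real t + of_nat j) / Gamma (a + of_nat j))) = c * (?\<nu> j * (?Q j * ?P j))" for j
  proof -
    have "a + of_real t + of_nat j + of_real s = a + of_nat j + of_nat M" by (simp add: s_def)
    then have "Gamma (a + of_real t + of_nat j + of_real s) = ?P j * Gamma (a + of_nat j)"
      by (simp only: Gamma_shift_eq[OF a])
    then show ?thesis using shift_prod_nonzero[OF a, of j M] by simp
  qed
  show ?thesis unfolding seq
    by (rule weight_bounded_cmult[OF weight_bounded_mult[OF weight_bounded_mult[OF P Q] \<nu>]])
qed

text \<open>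
Up to the constant term, the multiplier is recovered from \<open>R^k f\<close> by \<open>M\<close> differentiations, a fractional integral of
order \<open>M + t\<close> and \<open>k\<close> divisions by the degree. The exponents along the way are \<open>p k + t p + p M\<close>, \<open>p k\<close>, \<open>0\<close>. The constant
term is lost in \<open>R^k f\<close> and is controlled by \<open>f 0\<close>.
\<close>

lemma weighted_integral_frac_le:
  fixes t :: real
  assumes p: "p > 0" and at: "a + of_real t \<notin> \<int>\<^sub>\<le>\<^sub>0" and kt: "p * real k + t * p > -1"
  shows "\<exists>C\<ge>0. \<forall>f \<in> (holomorphic_ball :: (complex ^ 'n \<Rightarrow> complex) set).
    weighted_integral p 0 (multiplier (\<lambda>j. c * (Gamma (a + of_nat j) / Gamma (a + of_real t + of_nat j))) f)
      \<le> ennreal C * (ennreal (norm (f 0) powr p) + weighted_integral p (p * real k + t * p) (multiplier (\<lambda>j. of_nat j ^ k) f))"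
proof -
  define M where "M = nat \<lceil>\<bar>t\<bar>\<rceil> + 1"
  define s where "s = real M + t"
  have s: "s > 0" unfolding s_def M_def by linarith
  let ?\<nu> = "\<lambda>j. Gamma (a + of_nat j) / Gamma (a + of_nat j + of_real s)"
  let ?P = "\<lambda>j. \<Prod>i<M. of_nat j + (a + of_real t + of_nat i)" and ?Q = "\<lambda>j. (1 / of_nat j :: complex) ^ k"
  let ?H = "\<lambda>j. of_nat j ^ k :: complex"
  let ?\<mu> = "\<lambda>j. c * (Gamma (a + of_nat j) / Gamma (a + of_real t + of_nat j))"
  let ?\<beta> = "p * real k + t * p"
  have pk: "p * real k > -1" using p by (simp add: less_le_trans[of "-1" 0])
  have e: "p * real k + s * p = ?\<beta> + p * real M" by (simp add: s_def algebra_simps)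
  have P: "weight_bounded TYPE('n) p ?P ?\<beta> (?\<beta> + p * real M)"
    by (rule weight_bounded_shifts[OF p, where c="\<lambda>i. a + of_real t + of_nat i"])
  have \<nu>: "weight_bounded TYPE('n) p ?\<nu> (?\<beta> + p * real M) (p * real k)"
    using weight_bounded_Gamma_ratio[OF p s pk] unfolding e .
  have Q: "weight_bounded TYPE('n) p ?Q (p * real k) 0"
    using weight_bounded_inverse_power[OF p, of 0 k] by simp
  let ?w = "\<lambda>j. c * (?Q j * (?\<nu> j * ?P j))"
  have w: "weight_bounded TYPE('n) p ?w ?\<beta> 0"
    by (rule weight_bounded_cmult[OF weight_bounded_mult[OF weight_bounded_mult[OF P \<nu>] Q]])
  obtain C where C: "C \<ge> 0" "\<And>f :: complex ^ 'n \<Rightarrow> complex. f \<in> holomorphic_ball \<Longrightarrow>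
      weighted_integral p 0 (multiplier ?w f) \<le> ennreal C * weighted_integral p ?\<beta> f"
    using w by (rule weight_boundedE) blast
  obtain V where V: "V \<ge> 0" "(\<integral>\<^sup>+(z :: complex ^ 'n). indicator unit_ball z * ennreal ((1 - norm z) powr 0) \<partial>lborel) = ennreal V"
    using radial_weight_integrable[of 0, where 'n='n]
    by (cases "\<integral>\<^sup>+(z :: complex ^ 'n). indicator unit_ball z * ennreal ((1 - norm z) powr 0) \<partial>lborel") auto
  have sH: "subexponential ?H" by (intro subexponential_power subexponential_of_nat)
  have s\<mu>: "subexponential ?\<mu>" by (intro subexponential_mult subexponential_const subexponential_Gamma_ratio)
  note sw = subexponential_mult[OF weight_bounded_subexponential[OF w] sH]
  \<comment> \<open>\<open>\<mu>\<close> and \<open>w H\<close> can differ at index \<open>0\<close> only, where \<open>1 / 0 = 0\<close>.\<close>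
  define \<kappa> where "\<kappa> = (\<lambda>j. ?\<mu> j + - 1 * (?w j * ?H j))"
  have s\<kappa>: "subexponential \<kappa>" unfolding \<kappa>_def
    by (intro subexponential_add subexponential_mult[OF subexponential_const sw] s\<mu>)
  have \<kappa>0: "\<kappa> j = 0" if "j > 0" for j
  proof -
    have "a + of_nat j + of_real s = a + of_real t + of_nat j + of_nat M" by (simp add: s_def)
    then have G: "Gamma (a + of_nat j + of_real s) = ?P j * Gamma (a + of_real t + of_nat j)"
      by (simp only: Gamma_shift_eq[OF at])
    have "?\<nu> j * ?P j = Gamma (a + of_nat j) / Gamma (a + of_real t + of_nat j)"
      unfolding G using shift_prod_nonzero[OF at, of j M] by simp
    moreover have "?Q j * ?H j = 1" using that by (simp add: power_one_over)
    moreover have "?w j * ?H j = c * ((?\<nu> j * ?P j) * (?Q j * ?H j))" by (simp only: mult_ac)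
    ultimately have "?w j * ?H j = ?\<mu> j" by (simp only: mult_1_right)
    then show ?thesis unfolding \<kappa>_def by simp
  qed
  define A where "A = 2 powr p * C + 2 powr p * (norm (\<kappa> 0) powr p * V)"
  show ?thesis
  proof (intro exI[of _ A] conjI ballI)
    show "0 \<le> A" using C V by (simp add: A_def)
    fix f :: "complex ^ 'n \<Rightarrow> complex" assume f: "f \<in> holomorphic_ball"
    note cf = holomorphic_ball_chol[OF f]
    let ?f0 = "multiplier ?H f"
    let ?f1 = "multiplier ?w ?f0"
    have h0: "?f0 \<in> holomorphic_ball" by (rule multiplier_holomorphic_ball[OF cf sH])
    have h1: "?f1 \<in> holomorphic_ball"
      by (rule multiplier_holomorphic_ball[OF holomorphic_ball_chol[OF h0] weight_bounded_subexponential[OF w]])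
    have h2: "multiplier \<kappa> f \<in> holomorphic_ball" by (rule multiplier_holomorphic_ball[OF cf s\<kappa>])
    have split: "multiplier ?\<mu> f = (\<lambda>z. 1 * ?f1 z + multiplier \<kappa> f z)"
    proof
      fix z
      have "?\<mu> = (\<lambda>j. ?w j * ?H j + \<kappa> j)" by (simp add: \<kappa>_def)
      then have "multiplier ?\<mu> f z = multiplier (\<lambda>j. ?w j * ?H j + \<kappa> j) f z" by (simp only:)
      also have "\<dots> = multiplier (\<lambda>j. ?w j * ?H j) f z + multiplier \<kappa> f z"
        by (rule multiplier_add_sequences[OF cf sw s\<kappa>])
      also have "multiplier (\<lambda>j. ?w j * ?H j) f z = 1 * ?f1 z" unfolding multiplier_multiplier[OF cf sH] by simp
      finally show "multiplier ?\<mu> f z = 1 * ?f1 z + multiplier \<kappa> f z" .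
    qed
    let ?X = "ennreal (norm (f 0) powr p)" and ?Y = "weighted_integral p ?\<beta> ?f0"
    have b4: "weighted_integral p 0 (multiplier \<kappa> f) = ennreal (norm (\<kappa> 0) powr p * V) * ?X"
    proof -
      have ub: "unit_ball \<in> sets (borel :: (complex ^ 'n) measure)" by simp
      have "weighted_integral p 0 (multiplier \<kappa> f) = (\<integral>\<^sup>+(z :: complex ^ 'n). (indicator unit_ball z * ennreal ((1 - norm z) powr 0)) * ennreal (norm (\<kappa> 0 * f 0) powr p) \<partial>lborel)"
        unfolding weighted_integral_def
      proof (rule nn_integral_cong)
        fix z :: "complex ^ 'n"
        show "indicator unit_ball z * ennreal ((1 - norm z) powr 0 * norm (multiplier \<kappa> f z) powr p)
          = (indicator unit_ball z * ennreal ((1 - norm z) powr 0)) * ennreal (norm (\<kappa> 0 * f 0) powr p)"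
        proof (cases "z \<in> unit_ball")
          case True
          then show ?thesis by (simp only: multiplier_supported_at_0[OF cf \<kappa>0 True] ennreal_mult powr_ge_zero mult.assoc)
        qed (simp only: indicator_simps mult_zero_left not_False_eq_True)
      qed
      also have "\<dots> = ennreal V * ennreal (norm (\<kappa> 0 * f 0) powr p)"
        unfolding V(2)[symmetric] by (rule nn_integral_multc) (use ub in measurable)
      also have "\<dots> = ennreal (norm (\<kappa> 0) powr p * V) * ?X"
        using V(1) by (simp add: norm_mult powr_mult mult_ac flip: ennreal_mult)
      finally show ?thesis .
    qed
    have "weighted_integral p 0 (multiplier ?\<mu> f) \<le> ennreal (2 powr p * norm (1 :: complex) powr p) * weighted_integral p 0 ?f1 + ennreal (2 powr p) * weighted_integral p 0 (multiplier \<kappa> f)"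
      unfolding split by (rule weighted_integral_lincomb_le[OF p holomorphic_ball_measurable[OF h1] holomorphic_ball_measurable[OF h2]])
    also have "\<dots> \<le> ennreal (2 powr p * norm (1 :: complex) powr p) * (ennreal C * ?Y) + ennreal (2 powr p) * (ennreal (norm (\<kappa> 0) powr p * V) * ?X)"
      unfolding b4 by (intro add_right_mono mult_left_mono C(2)[OF h0]) simp
    also have "\<dots> = ennreal (2 powr p * C) * ?Y + ennreal (2 powr p * (norm (\<kappa> 0) powr p * V)) * ?X"
      using C(1) V(1) by (simp add: ennreal_mult mult.assoc)
    also have "\<dots> \<le> ennreal A * ?Y + ennreal A * ?X"
      using C(1) V(1) by (intro add_mono mult_right_mono ennreal_leI) (auto simp: A_def)
    also have "\<dots> = ennreal A * (?X + ?Y)" by (simp add: distrib_left add.commute)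
    finally show "weighted_integral p 0 (multiplier ?\<mu> f) \<le> ennreal A * (?X + ?Y)" .
  qed
qed

section \<open>Weighted Bergman spaces\<close>

lemma weight_comparable:
  fixes z :: "complex ^ 'n"
  assumes "norm z < 1"
  shows "(1 - (norm z)\<^sup>2) powr b \<le> 4 powr \<bar>b\<bar> * (1 - norm z) powr b"
    and "(1 - norm z) powr b \<le> 4 powr \<bar>b\<bar> * (1 - (norm z)\<^sup>2) powr b"
    and "1 - (norm z)\<^sup>2 > 0"
proof -
  have e: "1 - (norm z)\<^sup>2 = (1 - norm z) * (1 + norm z)" by (simp add: power2_eq_square algebra_simps)
  have "(1 - norm z) * 1 \<le> (1 - norm z) * (1 + norm z)" "(1 - norm z) * (1 + norm z) \<le> (1 - norm z) * 2"
    using assms by (intro mult_left_mono; simp)+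
  then have b: "1 - norm z \<le> 1 - (norm z)\<^sup>2" "1 - (norm z)\<^sup>2 \<le> 2 * (1 - norm z)" "1 - norm z > 0" using assms unfolding e by simp_all
  then show w: "1 - (norm z)\<^sup>2 > 0" by linarith
  have mult4: "d \<le> 4 * v" if "d \<le> v" "0 < v" for d v :: real using that by linarith
  have mult4': "v \<le> 4 * d" if "v \<le> 2 * d" "0 < d" for d v :: real using that by linarith
  have c1: "1 - norm z \<le> 4 * (1 - (norm z)\<^sup>2)" by (rule mult4[OF b(1) w])
  have c2: "1 - (norm z)\<^sup>2 \<le> 4 * (1 - norm z)" by (rule mult4'[OF b(2,3)])
  show "(1 - (norm z)\<^sup>2) powr b \<le> 4 powr \<bar>b\<bar> * (1 - norm z) powr b" by (rule powr_comparable[OF b(3) c1 c2])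
  show "(1 - norm z) powr b \<le> 4 powr \<bar>b\<bar> * (1 - (norm z)\<^sup>2) powr b" by (rule powr_comparable[OF w c2 c1])
qed

text \<open>
Positivity makes the normalization harmless: for \<open>\<alpha> > -1\<close> the integral of the weight is finite and not zero.
\<close>

lemma weight_const_pos: "weight_const TYPE('n::finite) \<alpha> > 0"
proof (cases "\<alpha> > -1")
  case True
  let ?g = "\<lambda>z :: complex ^ 'n. indicator unit_ball z * (1 - (norm z)\<^sup>2) powr \<alpha>"
  let ?I = "\<integral>\<^sup>+z. ennreal (?g z) \<partial>lborel"
  have ub [measurable]: "unit_ball \<in> sets (borel :: (complex ^ 'n) measure)" by simp
  have m: "?g \<in> borel_measurable lborel" by measurable
  have "?I \<le> (\<integral>\<^sup>+(z :: complex ^ 'n). ennreal (4 powr \<bar>\<alpha>\<bar>) * (indicator unit_ball z * ennreal ((1 - norm z) powr \<alpha>)) \<partial>lborel)"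
  proof (rule nn_integral_mono)
    fix z :: "complex ^ 'n"
    show "ennreal (?g z) \<le> ennreal (4 powr \<bar>\<alpha>\<bar>) * (indicator unit_ball z * ennreal ((1 - norm z) powr \<alpha>))"
      using weight_comparable(1)[of z \<alpha>] by (cases "z \<in> unit_ball") (simp_all add: ennreal_leI flip: ennreal_mult)
  qed
  also have "\<dots> = ennreal (4 powr \<bar>\<alpha>\<bar>) * (\<integral>\<^sup>+(z :: complex ^ 'n). indicator unit_ball z * ennreal ((1 - norm z) powr \<alpha>) \<partial>lborel)"
    by (rule nn_integral_cmult) measurable
  also have "\<dots> < top" using radial_weight_integrable[OF True, where 'n='n] by (simp add: ennreal_mult_less_top)
  finally have fin: "?I < top" .
  have "?I \<noteq> 0"
  proof
    assume "?I = 0"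
    then have "AE z in lborel. ennreal (?g z) = 0" using m by (subst (asm) nn_integral_0_iff_AE) auto
    then have "AE z in lborel. z \<notin> unit_ball \<or> (z :: complex ^ 'n) \<notin> unit_ball"
    proof eventually_elim
      case (elim z)
      show ?case
      proof (cases "z \<in> unit_ball")
        case z: True
        then have "1 - (norm z)\<^sup>2 > 0" using weight_comparable(3)[of z] by simp
        then show ?thesis using elim z by (simp add: ennreal_eq_0_iff powr_gt_zero order.not_eq_order_implies_strict)
      qed simp
    qed
    then have "AE z in lborel. (z :: complex ^ 'n) \<notin> unit_ball" by simp
    then have "emeasure lborel (unit_ball :: (complex ^ 'n) set) = 0"
      by (subst (asm) AE_iff_measurable[of unit_ball]) (auto simp: space_lborel)
    then have "unit_ball_vol (real CARD('n) * 2) \<le> 0" by (simp add: emeasure_ball ennreal_eq_0_iff)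
    moreover have "unit_ball_vol (real CARD('n) * 2) > 0" by (rule unit_ball_vol_pos) simp
    ultimately show False by (rule leD[THEN notE])
  qed
  then have "enn2real ?I > 0" using fin by (simp add: enn2real_positive_iff zero_less_iff_neq_zero)
  moreover have "(LINT z:(unit_ball :: (complex ^ 'n) set)|lborel. (1 - (norm z)\<^sup>2) powr \<alpha>) = enn2real ?I"
    unfolding set_lebesgue_integral_def real_scaleR_def by (rule integral_eq_nn_integral[OF m]) simp
  ultimately show ?thesis using True by (simp add: weight_const_def)
qed (simp add: weight_const_def)

lemma space_weighted_volume: "space (weighted_volume \<alpha> :: (complex ^ 'n) measure) = unit_ball"
  by (simp add: weighted_volume_def space_restrict_space)

lemma measurable_weighted_volume:
  fixes g :: "complex ^ 'n \<Rightarrow> 'b::topological_space"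
  assumes "g \<in> borel_measurable borel"
  shows "g \<in> borel_measurable (weighted_volume \<alpha>)" "g \<in> borel_measurable (restrict_space lborel unit_ball)"
proof -
  show 1: "g \<in> borel_measurable (restrict_space lborel unit_ball)"
    by (rule measurable_restrict_space1) (use assms in simp)
  then show "g \<in> borel_measurable (weighted_volume \<alpha>)" by (simp add: weighted_volume_def)
qed

lemma nn_integral_weighted_volume:
  fixes g :: "complex ^ 'n \<Rightarrow> real"
  assumes [measurable]: "g \<in> borel_measurable borel"
  shows "(\<integral>\<^sup>+z. ennreal (g z) \<partial>weighted_volume \<alpha>)
    = (\<integral>\<^sup>+z. indicator unit_ball z * (ennreal (weight_const TYPE('n) \<alpha> * (1 - (norm z)\<^sup>2) powr \<alpha>) * ennreal (g z)) \<partial>lborel)"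
proof -
  have w: "(\<lambda>z :: complex ^ 'n. ennreal (weight_const TYPE('n) \<alpha> * (1 - (norm z)\<^sup>2) powr \<alpha>)) \<in> borel_measurable borel" by measurable
  have "(\<lambda>z. ennreal (g z)) \<in> borel_measurable borel" by measurable
  note m = measurable_weighted_volume(2)[OF w] measurable_weighted_volume(2)[OF this]
  show ?thesis
    unfolding weighted_volume_def nn_integral_density[OF m]
    by (subst nn_integral_restrict_space) (simp_all add: mult.commute)
qed

lemma radial_deriv_lift:
  assumes "f \<in> holomorphic_ball"
  shows "multiplier (\<lambda>j. of_nat j ^ k) f \<in> holomorphic_ball"
  by (intro multiplier_holomorphic_ball holomorphic_ball_chol assms subexponential_power subexponential_of_nat)

definition bergman_integral :: "real \<Rightarrow> real \<Rightarrow> nat \<Rightarrow> (complex ^ 'n \<Rightarrow> complex) \<Rightarrow> ennreal" where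
  "bergman_integral p \<alpha> k f =
     (\<integral>\<^sup>+z. ennreal (norm (of_real ((1 - (norm z)\<^sup>2) ^ k) * (radial_deriv ^^ k) f z) powr p) \<partial>weighted_volume \<alpha>)"

lemma bergman_integral_comparable:
  assumes p: "p > 0"
  shows "\<exists>C>0. \<forall>f \<in> (holomorphic_ball :: (complex ^ 'n \<Rightarrow> complex) set).
    bergman_integral p \<alpha> k f \<le> ennreal C * weighted_integral p (p * real k + \<alpha>) (multiplier (\<lambda>j. of_nat j ^ k) f) \<and>
    weighted_integral p (p * real k + \<alpha>) (multiplier (\<lambda>j. of_nat j ^ k) f) \<le> ennreal C * bergman_integral p \<alpha> k f"
proof -
  let ?b = "p * real k + \<alpha>"
  define W where "W = weight_const TYPE('n) \<alpha>"
  have W: "W > 0" unfolding W_def by (rule weight_const_pos)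
  define K where "K = (4 :: real) powr \<bar>?b\<bar>"
  have K: "K > 0" by (simp add: K_def)
  have ub [measurable]: "unit_ball \<in> sets (borel :: (complex ^ 'n) measure)" by simp
  show ?thesis
  proof (intro exI[of _ "W * K + K / W"] conjI ballI)
    show "0 < W * K + K / W" using W K by (intro add_pos_pos) auto
    fix f :: "complex ^ 'n \<Rightarrow> complex" assume f: "f \<in> holomorphic_ball"
    let ?H = "multiplier (\<lambda>j. of_nat j ^ k) f"
    have [measurable]: "?H \<in> borel_measurable borel" by (rule holomorphic_ball_measurable[OF radial_deriv_lift[OF f]])
    have "bergman_integral p \<alpha> k f = (\<integral>\<^sup>+z. ennreal (norm (of_real ((1 - (norm z)\<^sup>2) ^ k) * ?H z) powr p) \<partial>weighted_volume \<alpha>)"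
      unfolding bergman_integral_def
      by (rule nn_integral_cong) (simp only: space_weighted_volume radial_deriv_power_multiplier[OF f])
    also have "\<dots> = (\<integral>\<^sup>+z. indicator unit_ball z * (ennreal (W * (1 - (norm z)\<^sup>2) powr \<alpha>) * ennreal (norm (of_real ((1 - (norm z)\<^sup>2) ^ k) * ?H z) powr p)) \<partial>lborel)"
      unfolding W_def by (rule nn_integral_weighted_volume) measurable
    also have "\<dots> = (\<integral>\<^sup>+z. indicator unit_ball z * ennreal (W * (1 - (norm z)\<^sup>2) powr ?b * norm (?H z) powr p) \<partial>lborel)"
    proof (rule nn_integral_cong)
      fix z :: "complex ^ 'n"
      show "indicator unit_ball z * (ennreal (W * (1 - (norm z)\<^sup>2) powr \<alpha>) * ennreal (norm (of_real ((1 - (norm z)\<^sup>2) ^ k) * ?H z) powr p))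
        = indicator unit_ball z * ennreal (W * (1 - (norm z)\<^sup>2) powr ?b * norm (?H z) powr p)"
      proof (cases "z \<in> unit_ball")
        case True
        define w where "w = 1 - (norm z)\<^sup>2"
        have w: "w > 0" using True weight_comparable(3)[of z] by (simp add: w_def)
        have "norm (of_real (w ^ k) * ?H z) = w powr (real k) * norm (?H z)"
          using w by (simp add: norm_mult norm_power powr_realpow)
        then have "norm (of_real (w ^ k) * ?H z) powr p = w powr (p * real k) * norm (?H z) powr p"
          by (simp add: powr_mult powr_powr mult.commute)
        then have "W * w powr \<alpha> * norm (of_real (w ^ k) * ?H z) powr p = W * w powr ?b * norm (?H z) powr p"
          by (simp add: powr_add mult_ac)
        then have "ennreal (W * w powr \<alpha>) * ennreal (norm (of_real (w ^ k) * ?H z) powr p) = ennreal (W * w powr ?b * norm (?H z) powr p)"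
          using W by (subst ennreal_mult[symmetric]) auto
        then show ?thesis unfolding w_def by (simp only:)
      qed (simp only: indicator_simps mult_zero_left not_False_eq_True)
    qed
    finally have eq: "bergman_integral p \<alpha> k f = (\<integral>\<^sup>+z. indicator unit_ball z * ennreal (W * (1 - (norm z)\<^sup>2) powr ?b * norm (?H z) powr p) \<partial>lborel)" .
    let ?L = "\<lambda>z. indicator unit_ball z * ennreal (W * (1 - (norm z)\<^sup>2) powr ?b * norm (?H z) powr p)"
    let ?R = "\<lambda>z. indicator unit_ball z * ennreal ((1 - norm z) powr ?b * norm (?H z) powr p)"
    have m: "?L \<in> borel_measurable lborel" "?R \<in> borel_measurable lborel" by measurable
    have "bergman_integral p \<alpha> k f \<le> (\<integral>\<^sup>+z. ennreal (W * K) * ?R z \<partial>lborel)"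
      unfolding eq
    proof (rule nn_integral_mono)
      fix z :: "complex ^ 'n"
      show "?L z \<le> ennreal (W * K) * ?R z"
      proof (cases "z \<in> unit_ball")
        case True
        have "W * (1 - (norm z)\<^sup>2) powr ?b * norm (?H z) powr p \<le> W * (K * (1 - norm z) powr ?b) * norm (?H z) powr p"
          unfolding K_def using W True by (intro mult_right_mono mult_left_mono weight_comparable(1)) auto
        also have "\<dots> = W * K * ((1 - norm z) powr ?b * norm (?H z) powr p)" by (simp only: mult_ac)
        finally show ?thesis using True W K by (simp add: ennreal_leI flip: ennreal_mult)
      qed (simp only: indicator_simps mult_zero_left zero_le not_False_eq_True)
    qed
    also have "\<dots> = ennreal (W * K) * weighted_integral p ?b ?H"
      unfolding weighted_integral_def by (rule nn_integral_cmult[OF m(2)])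
    also have "\<dots> \<le> ennreal (W * K + K / W) * weighted_integral p ?b ?H"
      using W K by (intro mult_right_mono ennreal_leI) auto
    finally show "bergman_integral p \<alpha> k f \<le> ennreal (W * K + K / W) * weighted_integral p ?b ?H" .
    have "weighted_integral p ?b ?H \<le> (\<integral>\<^sup>+z. ennreal (K / W) * ?L z \<partial>lborel)"
      unfolding weighted_integral_def
    proof (rule nn_integral_mono)
      fix z :: "complex ^ 'n"
      show "?R z \<le> ennreal (K / W) * ?L z"
      proof (cases "z \<in> unit_ball")
        case True
        have "(1 - norm z) powr ?b * norm (?H z) powr p \<le> (K * (1 - (norm z)\<^sup>2) powr ?b) * norm (?H z) powr p"
          unfolding K_def using True by (intro mult_right_mono weight_comparable(2)) auto
        also have "\<dots> = K / W * (W * (1 - (norm z)\<^sup>2) powr ?b * norm (?H z) powr p)" using W by simp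
        finally show ?thesis using True W K by (simp add: ennreal_leI flip: ennreal_mult)
      qed (simp only: indicator_simps mult_zero_left zero_le not_False_eq_True)
    qed
    also have "\<dots> = ennreal (K / W) * bergman_integral p \<alpha> k f"
      unfolding eq by (rule nn_integral_cmult[OF m(1)])
    also have "\<dots> \<le> ennreal (W * K + K / W) * bergman_integral p \<alpha> k f"
      using W K by (intro mult_right_mono ennreal_leI) auto
    finally show "weighted_integral p ?b ?H \<le> ennreal (W * K + K / W) * bergman_integral p \<alpha> k f" .
  qed
qed

lemma bergman_integrand_measurable:
  assumes f: "f \<in> (holomorphic_ball :: (complex ^ 'n \<Rightarrow> complex) set)"
  shows "(\<lambda>z. of_real ((1 - (norm z)\<^sup>2) ^ k) * (radial_deriv ^^ k) f z) \<in> borel_measurable (weighted_volume \<alpha>)"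
proof -
  have [measurable]: "multiplier (\<lambda>j. of_nat j ^ k) f \<in> borel_measurable borel"
    by (rule holomorphic_ball_measurable[OF radial_deriv_lift[OF f]])
  have "(\<lambda>z. of_real ((1 - (norm z)\<^sup>2) ^ k) * multiplier (\<lambda>j. of_nat j ^ k) f z) \<in> borel_measurable borel" by measurable
  from measurable_weighted_volume(1)[OF this] show ?thesis
    by (subst measurable_cong) (simp_all only: space_weighted_volume radial_deriv_power_multiplier[OF f])
qed

lemma in_Lp_bergman_integral:
  assumes f: "f \<in> (holomorphic_ball :: (complex ^ 'n \<Rightarrow> complex) set)"
  shows "in_Lp (weighted_volume \<alpha>) p (\<lambda>z. of_real ((1 - (norm z)\<^sup>2) ^ k) * (radial_deriv ^^ k) f z) \<longleftrightarrow> bergman_integral p \<alpha> k f < top"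
proof -
  let ?F = "\<lambda>z. of_real ((1 - (norm z)\<^sup>2) ^ k) * (radial_deriv ^^ k) f z"
  have [measurable]: "?F \<in> borel_measurable (weighted_volume \<alpha>)" by (rule bergman_integrand_measurable[OF f])
  have "(\<lambda>z. norm (?F z) powr p) \<in> borel_measurable (weighted_volume \<alpha>)" by measurable
  then show ?thesis
    unfolding in_Lp_def integrable_iff_bounded bergman_integral_def using \<open>?F \<in> _\<close> by simp
qed

lemma bergman_norm_eq:
  assumes f: "f \<in> (holomorphic_ball :: (complex ^ 'n \<Rightarrow> complex) set)"
  shows "bergman_norm p \<alpha> f = norm (f 0) + enn2real (bergman_integral p \<alpha> (bergman_order p \<alpha>) f) powr (1 / p)"
proof -
  let ?k = "bergman_order p \<alpha>"
  let ?F = "\<lambda>z. of_real ((1 - (norm z)\<^sup>2) ^ ?k) * (radial_deriv ^^ ?k) f z"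
  have [measurable]: "?F \<in> borel_measurable (weighted_volume \<alpha>)" by (rule bergman_integrand_measurable[OF f])
  have m: "(\<lambda>z. norm (?F z) powr p) \<in> borel_measurable (weighted_volume \<alpha>)" by measurable
  have "(LINT z|weighted_volume \<alpha>. (1 - (norm z)\<^sup>2) powr (p * real ?k) * norm ((radial_deriv ^^ ?k) f z) powr p)
    = (LINT z|weighted_volume \<alpha>. norm (?F z) powr p)"
  proof (rule Bochner_Integration.integral_cong)
    fix z :: "complex ^ 'n" assume "z \<in> space (weighted_volume \<alpha>)"
    then have w: "1 - (norm z)\<^sup>2 > 0" using weight_comparable(3)[of z] by (simp add: space_weighted_volume)
    define v where "v = 1 - (norm z)\<^sup>2"
    have v: "v > 0" using w by (simp add: v_def)
    have "norm (of_real (v ^ ?k) * (radial_deriv ^^ ?k) f z) = v powr (real ?k) * norm ((radial_deriv ^^ ?k) f z)"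
      using v by (simp add: norm_mult norm_power powr_realpow)
    then have "norm (of_real (v ^ ?k) * (radial_deriv ^^ ?k) f z) powr p = v powr (p * real ?k) * norm ((radial_deriv ^^ ?k) f z) powr p"
      by (simp add: powr_mult powr_powr mult.commute)
    then show "(1 - (norm z)\<^sup>2) powr (p * real ?k) * norm ((radial_deriv ^^ ?k) f z) powr p = norm (?F z) powr p"
      unfolding v_def by (simp only:)
  qed simp
  also have "\<dots> = enn2real (bergman_integral p \<alpha> ?k f)"
    unfolding bergman_integral_def by (rule integral_eq_nn_integral[OF m]) simp
  finally show ?thesis unfolding bergman_norm_def by (simp only:)
qed

lemma bergman_iff:
  "f \<in> bergman p \<longleftrightarrow> f \<in> holomorphic_ball \<and> weighted_integral p 0 f < top"
proof -
  have "in_Lp (restrict_space lborel unit_ball) p f \<longleftrightarrow> weighted_integral p 0 f < top" if f: "f \<in> holomorphic_ball"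
  proof -
    have b: "f \<in> borel_measurable borel" by (rule holomorphic_ball_measurable[OF f])
    have m: "f \<in> borel_measurable (restrict_space lborel unit_ball)" by (rule measurable_weighted_volume(2)[OF b])
    have "(\<integral>\<^sup>+z. ennreal (norm (f z) powr p) \<partial>restrict_space lborel unit_ball) = (\<integral>\<^sup>+z. ennreal (norm (f z) powr p) * indicator unit_ball z \<partial>lborel)"
      by (rule nn_integral_restrict_space) simp
    also have "\<dots> = weighted_integral p 0 f"
      unfolding weighted_integral_def by (rule nn_integral_cong) (auto simp: indicator_def)
    finally have e: "(\<integral>\<^sup>+z. ennreal (norm (f z) powr p) \<partial>restrict_space lborel unit_ball) = weighted_integral p 0 f" .
    have "(\<lambda>z. norm (f z) powr p) \<in> borel_measurable (restrict_space lborel unit_ball)"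
      by (rule measurable_weighted_volume(2)) (use b in measurable)
    then show ?thesis unfolding in_Lp_def integrable_iff_bounded using m e by simp
  qed
  then show ?thesis unfolding bergman_def by blast
qed

text \<open>
Up to constants \<open>1 - |z|^2\<close> may be replaced by \<open>1 - |z|\<close> and \<open>R^k\<close> by the multiplier \<open>j^k\<close>.
\<close>

lemma weighted_bergman_iff:
  assumes p: "p > 0"
  shows "f \<in> weighted_bergman p \<alpha> \<longleftrightarrow> f \<in> (holomorphic_ball :: (complex ^ 'n \<Rightarrow> complex) set) \<and>
    (\<exists>k. p * real k + \<alpha> > -1 \<and> weighted_integral p (p * real k + \<alpha>) (multiplier (\<lambda>j. of_nat j ^ k) f) < top)"
proof -
  have "bergman_integral p \<alpha> k f < top \<longleftrightarrow> weighted_integral p (p * real k + \<alpha>) (multiplier (\<lambda>j. of_nat j ^ k) f) < top"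
    if f: "f \<in> (holomorphic_ball :: (complex ^ 'n \<Rightarrow> complex) set)" for k
  proof -
    obtain C where C: "bergman_integral p \<alpha> k f \<le> ennreal C * weighted_integral p (p * real k + \<alpha>) (multiplier (\<lambda>j. of_nat j ^ k) f)"
      "weighted_integral p (p * real k + \<alpha>) (multiplier (\<lambda>j. of_nat j ^ k) f) \<le> ennreal C * bergman_integral p \<alpha> k f"
      using bergman_integral_comparable[OF p, where 'n='n and \<alpha>=\<alpha> and k=k] f by blast
    have fin: "ennreal C * x < top" if "x < top" for x using that by (simp add: ennreal_mult_less_top)
    show ?thesis using order.strict_trans1[OF C(1) fin] order.strict_trans1[OF C(2) fin] by blast
  qed
  then show ?thesis unfolding weighted_bergman_def using in_Lp_bergman_integral[of f \<alpha> p] by blast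
qed

lemma bergman_order_spec:
  assumes "p > 0"
  shows "p * real (bergman_order p \<alpha>) + \<alpha> > -1"
proof -
  obtain N :: nat where "real N > (- 1 - \<alpha>) / p" using reals_Archimedean2 by blast
  then have "p * real N + \<alpha> > -1" using assms by (simp add: field_simps)
  then show ?thesis unfolding bergman_order_def by (rule LeastI)
qed

lemma bergman_order_0: "bergman_order p 0 = 0"
  unfolding bergman_order_def by (rule Least_eq_0) simp

lemma powr_inverse_le_of_le:
  fixes x y z C p :: real
  assumes p: "p > 0" and "x \<ge> 0" "y \<ge> 0" "z \<ge> 0" "C \<ge> 0" and le: "z \<le> C * (x powr p + y)"
  shows "z powr (1 / p) \<le> C powr (1 / p) * 2 powr (1 / p) * (x + y powr (1 / p))"
proof -
  have "z powr (1 / p) \<le> (C * (x powr p + y)) powr (1 / p)" using assms by (intro powr_mono2) auto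
  also have "\<dots> = C powr (1 / p) * (x powr p + y) powr (1 / p)" by (rule powr_mult)
  also have "\<dots> \<le> C powr (1 / p) * (2 powr (1 / p) * ((x powr p) powr (1 / p) + y powr (1 / p)))"
    using assms by (intro mult_left_mono powr_add_le) auto
  also have "(x powr p) powr (1 / p) = x" using p assms(2) by (simp add: powr_powr)
  finally show ?thesis by (simp only: mult.assoc)
qed

lemma not_negative_integer_imp:
  assumes "\<not> negative_integer w"
  shows "w + 1 \<notin> \<int>\<^sub>\<le>\<^sub>0"
proof
  assume "w + 1 \<in> \<int>\<^sub>\<le>\<^sub>0"
  then obtain i where i: "w + 1 = of_int i" "i \<le> 0" by (rule nonpos_Ints_cases)
  have "w = of_int (i - 1)" using i(1) by (simp add: algebra_simps)
  then have "negative_integer w" unfolding negative_integer_def using i(2) by (intro exI[of _ "i - 1"]) simp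
  then show False using assms by simp
qed

theorem theorem10:
  fixes p \<alpha> :: real and s :: complex
  assumes "p > 0"
    and "\<not> negative_integer (of_nat CARD('n::finite) + s)"
    and "\<not> negative_integer (of_nat CARD('n) + s + of_real (\<alpha> / p))"
  shows "(\<forall>f \<in> (holomorphic_ball :: (complex ^ 'n \<Rightarrow> complex) set).
            f \<in> weighted_bergman p \<alpha> \<longleftrightarrow> frac_radial s (of_real (\<alpha> / p)) f \<in> bergman p) \<and>
         invertible_operator
           (weighted_bergman p \<alpha> :: (complex ^ 'n \<Rightarrow> complex) set) (bergman_norm p \<alpha>)
           (bergman p) (bergman_norm p 0)
           (frac_radial s (of_real (\<alpha> / p)))"
proof -
  note p = assms(1)
  define t where "t = \<alpha> / p"
  have tp: "t * p = \<alpha>" using p by (simp add: t_def)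
  define a where "a = of_nat CARD('n) + s + 1"
  have a: "a \<notin> \<int>\<^sub>\<le>\<^sub>0" unfolding a_def by (rule not_negative_integer_imp[OF assms(2)])
  have at: "a + of_real t \<notin> \<int>\<^sub>\<le>\<^sub>0"
    using not_negative_integer_imp[OF assms(3)] by (simp add: a_def t_def add_ac)
  define c where "c = Gamma (a + of_real t) / Gamma a"
  have c: "c \<noteq> 0" using a at by (simp add: c_def Gamma_eq_zero_iff)
  \<comment> \<open>coefficients of the operator and of its inverse\<close>
  define \<mu> where "\<mu> = (\<lambda>j. c * (Gamma (a + of_nat j) / Gamma (a + of_real t + of_nat j)))"
  define \<nu> where "\<nu> = (\<lambda>j. (1 / c) * (Gamma (a + of_real t + of_nat j) / Gamma (a + of_nat j)))"
  have se: "subexponential \<mu>" "subexponential \<nu>" unfolding \<mu>_def \<nu>_def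
    by (intro subexponential_mult subexponential_const subexponential_Gamma_ratio)+
  have \<mu>\<nu>: "\<mu> j * \<nu> j = 1" "\<nu> j * \<mu> j = 1" for j
    using c add_of_nat_nonpos_Int[OF a, of j] add_of_nat_nonpos_Int[OF at, of j]
    by (simp_all add: \<mu>_def \<nu>_def Gamma_eq_zero_iff)
  have \<mu>0: "\<mu> 0 = 1" using a at by (simp add: \<mu>_def c_def Gamma_eq_zero_iff)
  let ?T = "frac_radial s (of_real (\<alpha> / p)) :: (complex ^ 'n \<Rightarrow> complex) \<Rightarrow> complex ^ 'n \<Rightarrow> complex"
  let ?hol = "holomorphic_ball :: (complex ^ 'n \<Rightarrow> complex) set"
  let ?X = "weighted_bergman p \<alpha> :: (complex ^ 'n \<Rightarrow> complex) set" and ?Y = "bergman p :: (complex ^ 'n \<Rightarrow> complex) set"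
  have T: "?T f = multiplier \<mu> f" if f: "f \<in> ?hol" for f
  proof
    fix z
    have "(Gamma (of_nat CARD('n) + 1 + s + of_real (\<alpha> / p)) * Gamma (of_nat CARD('n) + 1 + of_nat k + s)) /
        (Gamma (of_nat CARD('n) + 1 + s) * Gamma (of_nat CARD('n) + 1 + of_nat k + s + of_real (\<alpha> / p))) = \<mu> k" for k
      by (simp add: \<mu>_def c_def a_def t_def add_ac)
    then show "?T f z = multiplier \<mu> f z"
      unfolding frac_radial_def multiplier_def homogeneous_expansion_eq[OF holomorphic_ball_chol[OF f]] by simp
  qed
  have Thol: "multiplier \<mu> f \<in> ?hol" if "f \<in> ?hol" for f
    by (rule multiplier_holomorphic_ball[OF holomorphic_ball_chol[OF that] se(1)])
  have Shol: "multiplier \<nu> g \<in> ?hol" if "g \<in> ?hol" for g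
    by (rule multiplier_holomorphic_ball[OF holomorphic_ball_chol[OF that] se(2)])
  have ST: "multiplier \<nu> (multiplier \<mu> f) = f" if "f \<in> ?hol" for f
    unfolding multiplier_multiplier[OF holomorphic_ball_chol[OF that] se(1)] \<mu>\<nu> by (rule multiplier_one[OF that])
  have TS: "multiplier \<mu> (multiplier \<nu> g) = g" if "g \<in> ?hol" for g
    unfolding multiplier_multiplier[OF holomorphic_ball_chol[OF that] se(2)] \<mu>\<nu> by (rule multiplier_one[OF that])
  let ?N = "\<lambda>k f. weighted_integral p (p * real k + \<alpha>) (multiplier (\<lambda>j. of_nat j ^ k) f)"
  have up: "\<exists>C\<ge>0. \<forall>f\<in>?hol. weighted_integral p 0 (multiplier \<mu> f) \<le> ennreal C * (ennreal (norm (f 0) powr p) + ?N k f)"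
    if "p * real k + \<alpha> > -1" for k
    unfolding \<mu>_def using weighted_integral_frac_le[OF p at, of k c, where 'n='n] that unfolding tp by blast
  have down: "\<exists>C\<ge>0. \<forall>f\<in>?hol. ?N k f \<le> ennreal C * weighted_integral p 0 (multiplier \<mu> f)"
    if k: "p * real k + \<alpha> > -1" for k
  proof -
    have "weight_bounded TYPE('n) p (\<lambda>j. of_nat j ^ k * \<nu> j) 0 (p * real k + \<alpha>)"
      using weight_bounded_frac_inverse[OF p a, of k t] k unfolding \<nu>_def tp by blast
    then obtain C where C: "C \<ge> 0" "\<And>g. g \<in> ?hol \<Longrightarrow> weighted_integral p (p * real k + \<alpha>) (multiplier (\<lambda>j. of_nat j ^ k * \<nu> j) g) \<le> ennreal C * weighted_integral p 0 g"
      by (rule weight_boundedE) blast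
    have "?N k f \<le> ennreal C * weighted_integral p 0 (multiplier \<mu> f)" if f: "f \<in> ?hol" for f
      using C(2)[OF Thol[OF f]]
      unfolding multiplier_multiplier[OF holomorphic_ball_chol[OF Thol[OF f]] se(2), symmetric] ST[OF f] .
    then show ?thesis using C(1) by blast
  qed
  have fin: "ennreal C * x < top" if "x < top" for x C using that by (simp add: ennreal_mult_less_top)
  have iff: "f \<in> ?X \<longleftrightarrow> ?T f \<in> ?Y" if f: "f \<in> ?hol" for f
  proof
    assume "f \<in> ?X"
    then obtain k where k: "p * real k + \<alpha> > -1" "?N k f < top" unfolding weighted_bergman_iff[OF p] by blast
    obtain C where "weighted_integral p 0 (multiplier \<mu> f) \<le> ennreal C * (ennreal (norm (f 0) powr p) + ?N k f)"
      using up[OF k(1)] f by blast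
    then have "weighted_integral p 0 (multiplier \<mu> f) < top"
      by (rule order.strict_trans1) (use k(2) in \<open>intro fin, simp add: ennreal_add_less_top\<close>)
    then show "?T f \<in> ?Y" unfolding T[OF f] bergman_iff using Thol[OF f] by blast
  next
    assume "?T f \<in> ?Y"
    then have "weighted_integral p 0 (multiplier \<mu> f) < top" unfolding T[OF f] bergman_iff by blast
    moreover obtain C where "?N (bergman_order p \<alpha>) f \<le> ennreal C * weighted_integral p 0 (multiplier \<mu> f)"
      using down[OF bergman_order_spec[OF p]] f by blast
    ultimately have "?N (bergman_order p \<alpha>) f < top" using fin order.strict_trans1 by blast
    then show "f \<in> ?X" unfolding weighted_bergman_iff[OF p] using f bergman_order_spec[OF p] by blast
  qed
  have Xhol: "f \<in> ?hol" if "f \<in> ?X" for f using that by (simp add: weighted_bergman_def)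
  have Yhol: "g \<in> ?hol" if "g \<in> ?Y" for g using that by (simp add: bergman_def)
  have bij: "bij_betw ?T ?X ?Y"
  proof (rule bij_betwI[where g="multiplier \<nu>"])
    show "?T \<in> ?X \<rightarrow> ?Y" using iff Xhol by blast
    show "multiplier \<nu> \<in> ?Y \<rightarrow> ?X"
    proof
      fix g assume g: "g \<in> ?Y"
      then show "multiplier \<nu> g \<in> ?X" using iff[OF Shol[OF Yhol[OF g]]] unfolding T[OF Shol[OF Yhol[OF g]]] TS[OF Yhol[OF g]] by blast
    qed
    show "multiplier \<nu> (?T f) = f" if "f \<in> ?X" for f unfolding T[OF Xhol[OF that]] by (rule ST[OF Xhol[OF that]])
    show "?T (multiplier \<nu> g) = g" if "g \<in> ?Y" for g unfolding T[OF Shol[OF Yhol[OF that]]] by (rule TS[OF Yhol[OF that]])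
  qed
  define N where "N = bergman_order p \<alpha>"
  have N: "p * real N + \<alpha> > -1" unfolding N_def by (rule bergman_order_spec[OF p])
  let ?Q = "bergman_integral p \<alpha> N" and ?R = "bergman_integral p 0 0"
  let ?M = "\<lambda>g. weighted_integral p (p * real 0 + 0) (multiplier (\<lambda>j. of_nat j ^ 0) g)"
  from bergman_integral_comparable[OF p, where 'n='n and \<alpha>=\<alpha> and k=N]
  obtain C1 where C1': "C1 > 0 \<and> (\<forall>f\<in>?hol. ?Q f \<le> ennreal C1 * ?N N f \<and> ?N N f \<le> ennreal C1 * ?Q f)" ..
  have C1: "C1 > 0" "\<And>f. f \<in> ?hol \<Longrightarrow> ?Q f \<le> ennreal C1 * ?N N f" "\<And>f. f \<in> ?hol \<Longrightarrow> ?N N f \<le> ennreal C1 * ?Q f"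
    using C1' by simp_all
  from bergman_integral_comparable[OF p, where 'n='n and \<alpha>=0 and k=0]
  obtain C2 where C2'': "C2 > 0 \<and> (\<forall>g\<in>?hol. ?R g \<le> ennreal C2 * ?M g \<and> ?M g \<le> ennreal C2 * ?R g)" ..
  then have C2': "C2 > 0" "\<And>g. g \<in> ?hol \<Longrightarrow> ?R g \<le> ennreal C2 * ?M g" "\<And>g. g \<in> ?hol \<Longrightarrow> ?M g \<le> ennreal C2 * ?R g"
    by simp_all
  have M: "?M g = weighted_integral p 0 g" if "g \<in> ?hol" for g
    using multiplier_one[OF that] by simp
  have C2: "C2 > 0" "\<And>g. g \<in> ?hol \<Longrightarrow> ?R g \<le> ennreal C2 * weighted_integral p 0 g" "\<And>g. g \<in> ?hol \<Longrightarrow> weighted_integral p 0 g \<le> ennreal C2 * ?R g"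
    using C2' unfolding M by (simp_all only: M)
  obtain C3 where C3: "C3 \<ge> 0" "\<And>f. f \<in> ?hol \<Longrightarrow> weighted_integral p 0 (multiplier \<mu> f) \<le> ennreal C3 * (ennreal (norm (f 0) powr p) + ?N N f)"
    using up[OF N] by blast
  obtain C4 where C4: "C4 \<ge> 0" "\<And>f. f \<in> ?hol \<Longrightarrow> ?N N f \<le> ennreal C4 * weighted_integral p 0 (multiplier \<mu> f)"
    using down[OF N] by blast
  have at0: "multiplier \<mu> f 0 = f 0" if "f \<in> ?hol" for f
    using multiplier_at_0[OF holomorphic_ball_chol[OF that] se(1)] \<mu>0 by simp
  have normX: "bergman_norm p \<alpha> f = norm (f 0) + enn2real (?Q f) powr (1 / p)" if "f \<in> ?hol" for f
    unfolding N_def by (rule bergman_norm_eq[OF that])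
  have normY: "bergman_norm p 0 g = norm (g 0) + enn2real (?R g) powr (1 / p)" if "g \<in> ?hol" for g
    using bergman_norm_eq[OF that, of p 0] unfolding bergman_order_0 .
  have finite: "?Q f < top" "?R (multiplier \<mu> f) < top" if f: "f \<in> ?X" for f
  proof -
    have "weighted_integral p 0 (multiplier \<mu> f) < top" using iff[OF Xhol[OF f]] f unfolding T[OF Xhol[OF f]] bergman_iff by blast
    then show "?R (multiplier \<mu> f) < top" "?Q f < top"
      using C2(2)[OF Thol[OF Xhol[OF f]]] C4(2)[OF Xhol[OF f]] C1(2)[OF Xhol[OF f]] fin order.strict_trans1 by blast+
  qed
  have bound1: "\<exists>C. \<forall>f\<in>?X. bergman_norm p 0 (?T f) \<le> C * bergman_norm p \<alpha> f"
  proof -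
    define C where "C = C2 * C3 * (1 + C1)"
    have C0: "C \<ge> 0" using C1 C2 C3 by (simp add: C_def)
    let ?K = "C powr (1 / p) * 2 powr (1 / p)"
    have "bergman_norm p 0 (?T f) \<le> (1 + ?K) * bergman_norm p \<alpha> f" if fX: "f \<in> ?X" for f
    proof -
      have f: "f \<in> ?hol" by (rule Xhol[OF fX])
      obtain x where x: "x \<ge> 0" "?Q f = ennreal x" using finite(1)[OF fX] by (cases "?Q f") auto
      obtain y where y: "y \<ge> 0" "?R (multiplier \<mu> f) = ennreal y" using finite(2)[OF fX] by (cases "?R (multiplier \<mu> f)") auto
      have "ennreal y \<le> ennreal C2 * (ennreal C3 * (ennreal (norm (f 0) powr p) + ennreal C1 * ennreal x))"
        unfolding y(2)[symmetric] x(2)[symmetric]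
        by (rule order_trans[OF C2(2)[OF Thol[OF f]]], rule mult_left_mono, rule order_trans[OF C3(2)[OF f]], intro mult_left_mono add_left_mono C1(3)[OF f]) auto
      also have "\<dots> = ennreal (C2 * (C3 * (norm (f 0) powr p + C1 * x)))"
        using C1(1) C2(1) C3(1) x(1) by (simp add: ennreal_mult ennreal_plus)
      finally have "y \<le> C2 * (C3 * (norm (f 0) powr p + C1 * x))"
        using C1(1) C2(1) C3(1) x(1) by (subst (asm) ennreal_le_iff) auto
      also have "\<dots> \<le> C * (norm (f 0) powr p + x)"
      proof -
        have "norm (f 0) powr p + C1 * x \<le> (1 + C1) * (norm (f 0) powr p + x)"
          using C1(1) x(1) by (simp add: algebra_simps)
        then have "C2 * C3 * (norm (f 0) powr p + C1 * x) \<le> C2 * C3 * ((1 + C1) * (norm (f 0) powr p + x))"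
          using C2(1) C3(1) by (intro mult_left_mono) auto
        then show ?thesis by (simp only: C_def mult.assoc)
      qed
      finally have le: "y powr (1 / p) \<le> ?K * (norm (f 0) + x powr (1 / p))"
        using x(1) y(1) C0 by (intro powr_inverse_le_of_le[OF p]) auto
      have nY: "bergman_norm p 0 (?T f) = norm (f 0) + y powr (1 / p)"
        unfolding T[OF f] normY[OF Thol[OF f]] at0[OF f] y(2) using y(1) by simp
      have nX: "bergman_norm p \<alpha> f = norm (f 0) + x powr (1 / p)"
        unfolding normX[OF f] x(2) using x(1) by simp
      have "norm (f 0) \<le> norm (f 0) + x powr (1 / p)" by simp
      then show ?thesis unfolding nX nY distrib_right mult_1_left using le by (rule add_mono)
    qed
    then show ?thesis by blast
  qed
  have bound2: "\<exists>C. \<forall>g\<in>?Y. bergman_norm p \<alpha> (inv_into ?X ?T g) \<le> C * bergman_norm p 0 g"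
  proof -
    define C where "C = C1 * C4 * C2"
    have C0: "C \<ge> 0" using C1 C2 C4 by (simp add: C_def)
    let ?K = "C powr (1 / p) * 2 powr (1 / p)"
    have "bergman_norm p \<alpha> (inv_into ?X ?T g) \<le> (1 + ?K) * bergman_norm p 0 g" if gY: "g \<in> ?Y" for g
    proof -
      define f where "f = inv_into ?X ?T g"
      have gim: "g \<in> ?T ` ?X" using bij gY by (simp add: bij_betw_def)
      have fX: "f \<in> ?X" unfolding f_def by (rule inv_into_into[OF gim])
      have f: "f \<in> ?hol" by (rule Xhol[OF fX])
      have g: "multiplier \<mu> f = g" using f_inv_into_f[OF gim] unfolding f_def[symmetric] T[OF f] .
      obtain x where x: "x \<ge> 0" "?Q f = ennreal x" using finite(1)[OF fX] by (cases "?Q f") auto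
      obtain y where y: "y \<ge> 0" "?R g = ennreal y" using finite(2)[OF fX] unfolding g by (cases "?R g") auto
      have "ennreal x \<le> ennreal C1 * (ennreal C4 * (ennreal C2 * ennreal y))"
        unfolding y(2)[symmetric] x(2)[symmetric] g[symmetric]
        by (rule order_trans[OF C1(2)[OF f]], rule mult_left_mono, rule order_trans[OF C4(2)[OF f]], intro mult_left_mono C2(3)[OF Thol[OF f]]) auto
      also have "\<dots> = ennreal (C * y)"
        using C1(1) C2(1) C4(1) y(1) by (simp add: C_def ennreal_mult mult.assoc)
      finally have "x \<le> C * y" using C0 y(1) by (subst (asm) ennreal_le_iff) auto
      also have "\<dots> \<le> C * (norm (g 0) powr p + y)" using C0 by (intro mult_left_mono) auto
      finally have le: "x powr (1 / p) \<le> ?K * (norm (g 0) + y powr (1 / p))"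
        using x(1) y(1) C0 by (intro powr_inverse_le_of_le[OF p]) auto
      have "f 0 = g 0" using at0[OF f] unfolding g by simp
      then have nX: "bergman_norm p \<alpha> f = norm (g 0) + x powr (1 / p)"
        unfolding normX[OF f] x(2) using x(1) by simp
      have nY: "bergman_norm p 0 g = norm (g 0) + y powr (1 / p)"
        unfolding normY[OF Yhol[OF gY]] y(2) using y(1) by simp
      have "norm (g 0) \<le> norm (g 0) + y powr (1 / p)" by simp
      then show ?thesis unfolding f_def[symmetric] nX nY distrib_right mult_1_left using le by (rule add_mono)
    qed
    then show ?thesis by blast
  qed
  have lin: "?T (\<lambda>z. b * f z + d * g z) = (\<lambda>z. b * ?T f z + d * ?T g z)" if f: "f \<in> ?hol" and g: "g \<in> ?hol" for b d f g
  proof -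
    have "(\<lambda>z. b * f z + d * g z) \<in> ?hol"
    proof (rule holomorphic_ballI)
      show "(\<lambda>z. b * f z + d * g z) chol_on unit_ball"
        using holomorphic_ball_chol[OF f] holomorphic_ball_chol[OF g]
        by (intro ballI clinear_deriv_at_add clinear_deriv_at_mult clinear_deriv_at_const) blast+
      show "b * f z + d * g z = 0" if "z \<notin> unit_ball" for z using f g that by (simp add: holomorphic_ball_def)
    qed
    then show ?thesis unfolding T[OF f] T[OF g]
      by (simp only: T multiplier_lincomb[OF holomorphic_ball_chol[OF f] holomorphic_ball_chol[OF g] se(1)])
  qed
  have add: "?T (\<lambda>z. f z + g z) = (\<lambda>z. ?T f z + ?T g z)" if "f \<in> ?X" "g \<in> ?X" for f g
    using lin[OF Xhol[OF that(1)] Xhol[OF that(2)], of 1 1] by simp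
  have scale: "?T (\<lambda>z. d * f z) = (\<lambda>z. d * ?T f z)" if "f \<in> ?X" for d f
    using lin[OF Xhol[OF that] Xhol[OF that], of d 0] by simp
  show ?thesis unfolding invertible_operator_def using iff add scale bij bound1 bound2 by blast
qed

end
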